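(* Let $\beta_0=\sigma_0+i\tau_0$ ($\sigma_0,\tau_0\in\mathbb{R}$) be such that $\sigma_0^2+\tau_0^2=1$ and $\sigma_0^2<1/2$. There exist a complex-valued random variable $\xi$ and a bounded real sequence $\delta_N$ such that for every continuous function $f\colon\mathbb{C}\to\mathbb{R}$ with compact support, $$\sum_{\beta\in\mathbb{C}\colon\mathcal{Z}_N(\beta)=0} f\Big(n\Big(\frac{\beta}{\beta_0}-1\Big)-i\delta_N\Big)\;\longrightarrow\;\sum_{k\in\mathbb{Z}} f(2\pi i k+\xi)\qquad\text{in distribution, as }N\to\infty.$$
   Context: Let $X_1,X_2,\ldots$ be independent real standard normal random variables. For $N\in\mathbb{N}$ put $n=\log N$ (natural logarithm) and $\mathcal{Z}_N(\beta)=\sum_{k=1}^N e^{\beta\sqrt n X_k}$, $\beta\in\mathbb{C}$. Sums over zeros count multiplicities. *)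

theory Defs
  imports "HOL-Probability.Probability" "HOL-Complex_Analysis.Complex_Analysis"
begin

definition partition_fun :: "(nat \<Rightarrow> real) \<Rightarrow> nat \<Rightarrow> complex \<Rightarrow> complex" where
  "partition_fun x N \<beta> = (\<Sum>k=1..N. exp (\<beta> * complex_of_real (sqrt (ln (real N)) * x k)))"

text \<open>
  Multiplicities are expressed by \<open>zorder\<close>. For \<open>N \<ge> 2\<close> the zero set is discrete, so for
  compactly supported \<open>f\<close> only finitely many summands are nonzero and \<open>infsum\<close> is a
  finite sum. For \<open>N = 1\<close> there are no zeros. The degenerate value \<open>N = 0\<close>, where the partition
  function vanishes identically, is irrelevant to limits as \<open>N\<close> tends to infinity.
\<close>

definition rescaled_zeros_sum ::
    "(nat \<Rightarrow> real) \<Rightarrow> nat \<Rightarrow> complex \<Rightarrow> real \<Rightarrow> (complex \<Rightarrow> real) \<Rightarrow> real" where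
  "rescaled_zeros_sum x N \<beta>\<^sub>0 d f =
     (\<Sum>\<^sub>\<infinity>\<beta>\<in>{\<beta>. partition_fun x N \<beta> = 0}.
        real_of_int (zorder (partition_fun x N) \<beta>) *
          f (complex_of_real (ln (real N)) * (\<beta> / \<beta>\<^sub>0 - 1) - \<i> * complex_of_real d))"

end

theory Submission
  imports Defs
begin

text \<open>
  Write \<open>n = ln N\<close> and \<open>\<beta> = \<beta>\<^sub>0 * (1 + t / n)\<close>. The mean of the partition function at \<open>\<beta>\<^sub>0\<close> has modulus
  \<open>exp (n * (1 + (\<sigma>\<^sub>0\<^sup>2 - \<tau>\<^sub>0\<^sup>2) / 2))\<close>, its fluctuations are of order \<open>exp (n * (1 / 2 + \<sigma>\<^sub>0\<^sup>2))\<close>, and on the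
  unit circle these two orders coincide. Zeros occur where the mean and the fluctuations cancel, so both
  are followed in the variable \<open>t\<close>.

  The variance of the summand \<open>exp (\<beta>\<^sub>0 * sqrt n * X)\<close> is carried by values of \<open>X\<close> within distance \<open>O(1)\<close> of
  \<open>2 * \<sigma>\<^sub>0 * sqrt n\<close>. There the factor \<open>exp (\<beta>\<^sub>0 * t * X / sqrt n)\<close> introduced by the shift \<open>t\<close> is nearly
  the constant \<open>exp (2 * \<sigma>\<^sub>0 * \<beta>\<^sub>0 * t)\<close>. Divided by this constant and by \<open>exp (n * (1 / 2 + \<sigma>\<^sub>0\<^sup>2))\<close>, the
  fluctuations are a random number that does not depend on \<open>t\<close>, up to an error that tends to zero in mean, uniformly
  for bounded \<open>t\<close>. The error is controlled by expanding in powers of \<open>t\<close> (\<open>remainder_bound\<close>,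
  \<open>remainder_expectation\<close>): the coefficients are normalised sums of independent terms with explicit Gaussian
  second moments. The same division turns the mean into \<open>exp (\<i> * n * \<sigma>\<^sub>0 * \<tau>\<^sub>0 - t)\<close>, up to a factor tending to
  \<open>1\<close>, because \<open>\<beta>\<^sub>0 * (\<beta>\<^sub>0 - 2 * \<sigma>\<^sub>0) = - 1\<close>. With \<open>t = s + \<i> * \<delta>\<close> and \<open>\<delta> = n * \<sigma>\<^sub>0 * \<tau>\<^sub>0\<close> modulo \<open>2 * pi\<close>,
  the partition function becomes \<open>exp (- s)\<close> plus a random constant (\<open>local_fun_close\<close>).

  The random constant satisfies a central limit theorem (\<open>char_coeff_0_tendsto\<close>): the Lindeberg condition
  holds because \<open>\<sigma>\<^sub>0\<^sup>2 < 1 / 2\<close>, and the limit \<open>w\<close> is an isotropic complex normal variable because \<open>\<tau>\<^sub>0 \<noteq> 0\<close>.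
  Convergence of characteristic functions is turned into convergence of expectations of bounded continuous functions by
  approximation with trigonometric polynomials (\<open>tendsto_integral_if_char_tendsto\<close>).

  The zeros of \<open>exp (- s) + w\<close> are the points \<open>2 * pi * \<i> * k - Ln (- w)\<close>, hence \<open>\<xi> = - Ln (- w)\<close>. By Hurwitz'
  theorem (\<open>zero_sum_tendsto\<close>) the sum of a test function over the zeros depends continuously on the entire
  function, which gives the measurability of the zero sums and transfers the convergence of the
  functions to that of the zero sums.
\<close>

section \<open>Sums over the zeros of entire functions\<close>

definition zero_sum :: "(complex \<Rightarrow> complex) \<Rightarrow> (complex \<Rightarrow> real) \<Rightarrow> real" where
  "zero_sum h f = (\<Sum>\<^sub>\<infinity>z\<in>{z. h z = 0}. real_of_int (zorder h z) * f z)"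

lemma finite_zeros_ball:
  assumes "h holomorphic_on UNIV" "h a \<noteq> 0"
  shows "finite {z\<in>cball c R. h z = 0}" "finite {z\<in>ball c R. h z = 0}"
proof -
  show "finite {z\<in>cball c R. h z = 0}"
  proof (cases "h constant_on UNIV")
    case True
    then have "\<forall>z. h z \<noteq> 0" using assms(2) by (metis UNIV_I constant_on_def)
    then show ?thesis by simp
  next
    case False
    then show ?thesis
      using holomorphic_compact_finite_zeros[OF assms(1) open_UNIV connected_UNIV, of "cball c R"] by auto
  qed
  then show "finite {z\<in>ball c R. h z = 0}"
    by (rule rev_finite_subset) auto
qed

text \<open>
  When \<open>f\<close> vanishes off a bounded set, the defining infinite sum collapses to a finite one,
  which makes it accessible to counting arguments.
\<close>

lemma zero_sum_eq_sum:
  assumes "h holomorphic_on UNIV" "h a \<noteq> 0" "bounded S" "\<And>z. z \<notin> S \<Longrightarrow> f z = 0"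
  shows "finite {z\<in>S. h z = 0}"
    and "zero_sum h f = (\<Sum>z\<in>{z\<in>S. h z = 0}. real_of_int (zorder h z) * f z)"
proof -
  obtain R where R: "\<forall>z\<in>S. norm z \<le> R" using assms(3) by (auto simp: bounded_iff)
  then have sub: "{z\<in>S. h z = 0} \<subseteq> {z\<in>cball 0 R. h z = 0}" by auto
  show fin: "finite {z\<in>S. h z = 0}"
    by (rule finite_subset[OF sub finite_zeros_ball(1)[OF assms(1,2)]])
  have "zero_sum h f = (\<Sum>\<^sub>\<infinity>z\<in>{z\<in>S. h z = 0}. real_of_int (zorder h z) * f z)"
    unfolding zero_sum_def by (rule infsum_cong_neutral) (auto simp: assms(4))
  then show "zero_sum h f = (\<Sum>z\<in>{z\<in>S. h z = 0}. real_of_int (zorder h z) * f z)"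
    by (simp only: infsum_finite[OF fin])
qed

lemma zorder_nonneg_entire:
  assumes "h holomorphic_on UNIV" "h a \<noteq> 0"
  shows "zorder h z \<ge> 0"
proof -
  have "\<exists>w\<in>UNIV. h w \<noteq> 0" using assms(2) by blast
  from zorder_exist_zero[OF assms(1) open_UNIV connected_UNIV UNIV_I this, of z]
  show ?thesis by (auto split: if_splits)
qed

text \<open>
  Rouche's theorem on a disc: the winding numbers of the boundary circle are \<open>1\<close> inside and
  \<open>0\<close> outside, so the weighted count of the zeros reduces to the plain count.
\<close>

lemma Rouche_disc:
  assumes f: "f holomorphic_on UNIV" and g: "g holomorphic_on UNIV" and r: "r > 0"
    and less: "\<And>z. dist c z = r \<Longrightarrow> cmod (g z - f z) < cmod (f z)"
  shows "(\<Sum>p\<in>{p\<in>ball c r. g p = 0}. zorder g p) = (\<Sum>p\<in>{p\<in>ball c r. f p = 0}. zorder f p)"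
proof -
  define s where "s = ball c (r+1)"
  define \<gamma> where "\<gamma> = circlepath c r"
  define a where "a = c + of_real r"
  have a: "dist c a = r" using r by (simp add: a_def dist_norm)
  have fa: "f a \<noteq> 0" using less[OF a] by auto
  have ga: "g a \<noteq> 0" using less[OF a] by auto
  define d where "d = (\<lambda>z. g z - f z)"
  have d: "d holomorphic_on s" unfolding d_def by (intro holomorphic_intros holomorphic_on_subset[OF f] holomorphic_on_subset[OF g]) auto
  have gd: "(\<lambda>p. f p + d p) = g" by (auto simp: d_def)
  have fin: "finite {p\<in>s. f p = 0}" "finite {p\<in>s. g p = 0}"
    using finite_zeros_ball(2)[OF f fa] finite_zeros_ball(2)[OF g ga] by (auto simp: s_def)
  have R: "(\<Sum>p\<in>{p\<in>s. f p + d p = 0}. winding_number \<gamma> p * zorder (\<lambda>p. f p + d p) p)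
        = (\<Sum>p\<in>{p\<in>s. f p = 0}. winding_number \<gamma> p * zorder f p)"
  proof (rule Rouche_theorem)
    show "open s" "connected s" by (auto simp: s_def)
    show "finite {p\<in>s. f p + d p = 0}" using fin(2) by (simp add: d_def)
    show "finite {p \<in> s. f p = 0}" by (rule fin)
    show "f holomorphic_on s" by (rule holomorphic_on_subset[OF f]) auto
    show "d holomorphic_on s" by (rule d)
    show "valid_path \<gamma>" "pathfinish \<gamma> = pathstart \<gamma>" by (auto simp: \<gamma>_def)
    show "path_image \<gamma> \<subseteq> s" using r by (auto simp: \<gamma>_def s_def)
    show "\<forall>z\<in>path_image \<gamma>. cmod (d z) < cmod (f z)"
      using less r by (auto simp: \<gamma>_def d_def)
    show "\<forall>z. z \<notin> s \<longrightarrow> winding_number \<gamma> z = 0"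
    proof (intro allI impI)
      fix z assume "z \<notin> s"
      then show "winding_number \<gamma> z = 0"
        unfolding \<gamma>_def s_def
        by (intro winding_number_zero_outside[where s="cball c r"]) (use r in auto)
    qed
  qed
  have W: "(\<Sum>p\<in>{p\<in>s. h p = 0}. winding_number \<gamma> p * zorder h p) = complex_of_int (\<Sum>p\<in>{p\<in>ball c r. h p = 0}. zorder h p)"
    if fin: "finite {p\<in>s. h p = 0}" and nz: "\<And>z. dist c z = r \<Longrightarrow> h z \<noteq> 0" for h
  proof -
    have "(\<Sum>p\<in>{p\<in>s. h p = 0}. winding_number \<gamma> p * zorder h p) = (\<Sum>p\<in>{p\<in>ball c r. h p = 0}. of_int (zorder h p))"
    proof (rule sum.mono_neutral_cong_right[OF fin])
      show "{p \<in> ball c r. h p = 0} \<subseteq> {p \<in> s. h p = 0}" by (auto simp: s_def)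
      show "\<forall>i\<in>{p \<in> s. h p = 0} - {p \<in> ball c r. h p = 0}. winding_number \<gamma> i * of_int (zorder h i) = 0"
      proof
        fix i assume i: "i\<in>{p \<in> s. h p = 0} - {p \<in> ball c r. h p = 0}"
        then have "dist c i > r" using nz[of i] by force
        then have "winding_number \<gamma> i = 0"
          unfolding \<gamma>_def
          by (intro winding_number_zero_outside[where s="cball c r"]) (use r in auto)
        then show "winding_number \<gamma> i * of_int (zorder h i) = 0" by simp
      qed
      fix x assume "x \<in> {p \<in> ball c r. h p = 0}"
      then show "winding_number \<gamma> x * of_int (zorder h x) = of_int (zorder h x)"
        by (simp add: \<gamma>_def winding_number_circlepath dist_norm norm_minus_commute)
    qed
    then show ?thesis by simp
  qed
  have "complex_of_int (\<Sum>p\<in>{p\<in>ball c r. g p = 0}. zorder g p) = of_int (\<Sum>p\<in>{p\<in>ball c r. f p = 0}. zorder f p)"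
  proof -
    have nzf: "f z \<noteq> 0" if "dist c z = r" for z using less[OF that] by auto
    have nzg: "g z \<noteq> 0" if "dist c z = r" for z using less[OF that] by auto
    have gd': "f p + d p = g p" for p by (simp add: d_def)
    have "complex_of_int (\<Sum>p\<in>{p\<in>ball c r. g p = 0}. zorder g p) = (\<Sum>p\<in>{p\<in>s. g p = 0}. winding_number \<gamma> p * zorder g p)"
      using W[OF fin(2) nzg] by simp
    also have "\<dots> = (\<Sum>p\<in>{p\<in>s. f p = 0}. winding_number \<gamma> p * zorder f p)"
      using R unfolding gd gd' .
    also have "\<dots> = of_int (\<Sum>p\<in>{p\<in>ball c r. f p = 0}. zorder f p)"
      using W[OF fin(1) nzf] by simp
    finally show ?thesis .
  qed
  then show ?thesis by (simp only: of_int_eq_iff)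
qed


lemma eventually_at_right_0_less: "0 < (c::real) \<Longrightarrow> \<forall>\<^sub>F r in at_right 0. r < c"
  unfolding eventually_at_right_field by blast

text \<open>
  Hurwitz' theorem for zero sums. Small disjoint discs are put around the zeros of the limit. On the
  rest of a closed disc containing the support of \<open>f\<close> and on the boundary circles the limit is bounded away from
  zero, so \<open>h m\<close> eventually has no zeros there, and inside each disc it has, by Rouche, as many zeros
  as the limit. On each disc \<open>f\<close> is nearly constant.
\<close>

lemma zero_sum_tendsto:
  fixes h :: "nat \<Rightarrow> complex \<Rightarrow> complex"
  assumes h: "\<And>m. h m holomorphic_on UNIV" and h0: "h0 holomorphic_on UNIV" "h0 a \<noteq> 0"
    and unif: "uniform_limit (cball 0 R) h h0 sequentially"
    and \<rho>: "0 < \<rho>" "\<rho> < R" and f: "continuous_on UNIV f" "\<And>z. z \<notin> cball 0 \<rho> \<Longrightarrow> f z = 0"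
  shows "(\<lambda>m. zero_sum (h m) f) \<longlonglongrightarrow> zero_sum h0 f"
proof (rule tendstoI)
  fix \<epsilon> :: real assume \<epsilon>: "\<epsilon> > 0"
  define P' where "P' = {z\<in>cball 0 R. h0 z = 0}"
  define P where "P = {z\<in>cball 0 \<rho>. h0 z = 0}"
  have finP': "finite P'" and finP: "finite P"
    unfolding P'_def P_def by (rule finite_zeros_ball[OF h0])+
  have PP': "P \<subseteq> P'" and P'P: "P' \<inter> cball 0 \<rho> \<subseteq> P" using \<rho> by (auto simp: P_def P'_def)
  define D where "D = (\<Sum>p\<in>P. real_of_int (zorder h0 p))"
  have zpos: "0 \<le> zorder h0 p" for p by (rule zorder_nonneg_entire[OF h0])
  have D: "D \<ge> 0" unfolding D_def by (intro sum_nonneg) (simp add: zpos)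
  define e where "e = \<epsilon> / (D + 1)"
  have e: "e > 0" using \<epsilon> D by (simp add: e_def)
  have "\<forall>\<^sub>F r in at_right (0::real). 0 < r \<and> r < R - \<rho> \<and>
      (\<forall>p\<in>P'. \<forall>q\<in>P'. p \<noteq> q \<longrightarrow> 2 * r < dist p q) \<and>
      (\<forall>p\<in>P. \<forall>z. dist p z < r \<longrightarrow> \<bar>f z - f p\<bar> < e)"
  proof (intro eventually_conj eventually_ball_finite ballI finP' finP)
    show "\<forall>\<^sub>F r in at_right (0::real). 0 < r" by (simp add: eventually_at_right_less)
    show "\<forall>\<^sub>F r in at_right (0::real). r < R - \<rho>" using \<rho> by (intro eventually_at_right_0_less) simp
    fix p q
    show "\<forall>\<^sub>F r in at_right (0::real). p \<noteq> q \<longrightarrow> 2 * r < dist p q"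
    proof (cases "p = q")
      case False
      then have "\<forall>\<^sub>F r in at_right (0::real). r < dist p q / 2" by (intro eventually_at_right_0_less) simp
      then show ?thesis by eventually_elim simp
    qed simp
  next
    fix p
    have "isCont f p" using f(1) by (simp add: continuous_on_eq_continuous_at)
    then obtain d where d: "d > 0" "\<And>z. dist z p < d \<Longrightarrow> dist (f z) (f p) < e"
      using e unfolding continuous_at_eps_delta by blast
    show "\<forall>\<^sub>F r in at_right (0::real). \<forall>z. dist p z < r \<longrightarrow> \<bar>f z - f p\<bar> < e"
      using eventually_at_right_0_less[OF d(1)]
      by eventually_elim (use d(2) in \<open>force simp: dist_real_def dist_commute\<close>)
  qed
  then obtain r where r: "0 < r" "r < R - \<rho>"
      "\<And>p q. p\<in>P' \<Longrightarrow> q\<in>P' \<Longrightarrow> p \<noteq> q \<Longrightarrow> 2 * r < dist p q"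
      "\<And>p z. p\<in>P \<Longrightarrow> dist p z < r \<Longrightarrow> \<bar>f z - f p\<bar> < e"
    using eventually_happens'[OF trivial_limit_at_right_real] by (metis (mono_tags, lifting))
  have cbR: "z \<in> cball 0 R" if "p \<in> P" "dist p z \<le> r" for p z
    using that r(2) dist_triangle[of 0 z p] by (auto simp: P_def)
  have near: "z = p" if "p \<in> P" "dist p z \<le> r" "h0 z = 0" for p z
  proof (rule ccontr)
    assume "z \<noteq> p"
    moreover have "z \<in> P'" "p \<in> P'" using cbR[OF that(1,2)] that PP' by (auto simp: P'_def)
    ultimately show False using r(3)[of p z] r(1) that(2) by auto
  qed
  \<comment> \<open>The part of the disc of radius \<open>\<rho>\<close> outside the small discs, together with their boundary circles; \<open>h0\<close> has no zeros here.\<close>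
  define C where "C = (cball 0 \<rho> - (\<Union>p\<in>P. ball p r)) \<union> (\<Union>p\<in>P. sphere p r)"
  have "compact C" unfolding C_def
    by (intro compact_Un compact_UN compact_sphere finP compact_diff compact_cball open_UN ballI open_ball)
  have nzC: "h0 z \<noteq> 0" if "z \<in> C" for z
  proof
    assume z: "h0 z = 0"
    show False
    proof (cases "z \<in> (\<Union>p\<in>P. sphere p r)")
      case True
      then obtain p where p: "p \<in> P" "dist p z = r" by auto
      then show False using near[of p z] z r(1) by auto
    next
      case False
      then have "z \<in> P" "z \<notin> (\<Union>p\<in>P. ball p r)" using that z by (auto simp: C_def P_def)
      then show False using r(1) by auto
    qed
  qed
  obtain c where c: "c > 0" "\<And>z. z \<in> C \<Longrightarrow> c \<le> cmod (h0 z)"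
  proof (cases "C = {}")
    case False
    have "continuous_on C (\<lambda>z. cmod (h0 z))"
      by (intro continuous_intros holomorphic_on_imp_continuous_on holomorphic_on_subset[OF h0(1)]) auto
    from continuous_attains_inf[OF \<open>compact C\<close> False this] obtain x
      where "x \<in> C" "\<forall>y\<in>C. cmod (h0 x) \<le> cmod (h0 y)" by auto
    then show ?thesis using nzC that[of "cmod (h0 x)"] by auto
  qed (use that[of 1] in auto)
  have CR: "C \<subseteq> cball 0 R"
    using cbR \<rho> by (fastforce simp: C_def)
  obtain b where b: "b \<in> cball 0 R" "h0 b \<noteq> 0"
  proof -
    have "uncountable (cball (0::complex) R)" using \<rho> by (intro uncountable_cball) auto
    then have "\<not> cball 0 R \<subseteq> P'" using finP' finite_subset countable_finite by blast
    then obtain b where "b \<in> cball 0 R" "b \<notin> P'" by blast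
    then show ?thesis by (intro that[of b]) (auto simp: P'_def)
  qed
  \<comment> \<open>The second term makes \<open>h m\<close> nonzero at \<open>b\<close>, hence not identically zero.\<close>
  define c' where "c' = min c (cmod (h0 b))"
  have "c' > 0" using b c by (simp add: c'_def)
  from uniform_limitD[OF unif this]
  show "\<forall>\<^sub>F m in sequentially. dist (zero_sum (h m) f) (zero_sum h0 f) < \<epsilon>"
  proof eventually_elim
    case (elim m)
    have close: "cmod (h m z - h0 z) < cmod (h0 z)" if "z \<in> C" for z
      using elim c(2)[OF that] that CR by (fastforce simp: c'_def dist_norm)
    have hb: "h m b \<noteq> 0" using elim b by (force simp: c'_def dist_norm)
    define Z where "Z p = {z\<in>ball p r. h m z = 0}" for p
    have finZ: "finite (Z p)" for p unfolding Z_def by (rule finite_zeros_ball(2)[OF h hb])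
    have count: "(\<Sum>z\<in>Z p. zorder (h m) z) = zorder h0 p" if p: "p \<in> P" for p
    proof -
      have "(\<Sum>z\<in>Z p. zorder (h m) z) = (\<Sum>z\<in>{z\<in>ball p r. h0 z = 0}. zorder h0 z)"
        unfolding Z_def
        by (rule Rouche_disc[OF h0(1) h r(1)]) (use p close in \<open>auto simp: C_def\<close>)
      also have "{z\<in>ball p r. h0 z = 0} = {p}"
        using near[OF p] p r(1) by (fastforce simp: P_def)
      finally show ?thesis by simp
    qed
    have disj: "Z p \<inter> Z q = {}" if "p \<in> P" "q \<in> P" "p \<noteq> q" for p q
    proof (rule ccontr)
      assume "Z p \<inter> Z q \<noteq> {}"
      then obtain z where "dist p z < r" "dist q z < r" by (auto simp: Z_def)
      then have "dist p q < 2 * r" using dist_triangle[of p q z] by (simp add: dist_commute)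
      then show False using r(3)[of p q] that PP' by auto
    qed
    have "zero_sum (h m) f = (\<Sum>z\<in>{z\<in>cball 0 R. h m z = 0}. real_of_int (zorder (h m) z) * f z)"
      by (rule zero_sum_eq_sum(2)[OF h hb]) (use f(2) \<rho> in auto)
    also have "\<dots> = (\<Sum>z\<in>(\<Union>p\<in>P. Z p). real_of_int (zorder (h m) z) * f z)"
    proof (rule sum.mono_neutral_right)
      show "finite {z \<in> cball 0 R. h m z = 0}" by (rule finite_zeros_ball[OF h hb])
      show "\<Union> (Z ` P) \<subseteq> {z \<in> cball 0 R. h m z = 0}" using cbR by (fastforce simp: Z_def)
      show "\<forall>i\<in>{z \<in> cball 0 R. h m z = 0} - \<Union> (Z ` P). real_of_int (zorder (h m) i) * f i = 0"
      proof
        fix z assume z: "z \<in> {z \<in> cball 0 R. h m z = 0} - \<Union> (Z ` P)"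
        show "real_of_int (zorder (h m) z) * f z = 0"
        proof (cases "z \<in> cball 0 \<rho>")
          case True
          then have "z \<in> C" using z by (auto simp: C_def Z_def)
          then show ?thesis using close[of z] z by auto
        qed (use f(2) in auto)
      qed
    qed
    also have "\<dots> = (\<Sum>p\<in>P. \<Sum>z\<in>Z p. real_of_int (zorder (h m) z) * f z)"
      by (rule sum.UNION_disjoint) (use finP finZ disj in auto)
    finally have 1: "zero_sum (h m) f = (\<Sum>p\<in>P. \<Sum>z\<in>Z p. real_of_int (zorder (h m) z) * f z)" .
    have "zero_sum h0 f = (\<Sum>p\<in>P. real_of_int (zorder h0 p) * f p)"
      unfolding P_def by (rule zero_sum_eq_sum(2)[OF h0]) (use f(2) in auto)
    also have "\<dots> = (\<Sum>p\<in>P. \<Sum>z\<in>Z p. real_of_int (zorder (h m) z) * f p)"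
    proof (rule sum.cong[OF refl])
      fix p assume "p \<in> P"
      from count[OF this, symmetric]
      show "real_of_int (zorder h0 p) * f p = (\<Sum>z\<in>Z p. real_of_int (zorder (h m) z) * f p)"
        by (simp add: sum_distrib_right)
    qed
    finally have 2: "zero_sum h0 f = (\<Sum>p\<in>P. \<Sum>z\<in>Z p. real_of_int (zorder (h m) z) * f p)" .
    have "\<bar>zero_sum (h m) f - zero_sum h0 f\<bar> =
        \<bar>\<Sum>p\<in>P. \<Sum>z\<in>Z p. real_of_int (zorder (h m) z) * (f z - f p)\<bar>"
      unfolding 1 2 by (simp add: sum_subtractf right_diff_distrib)
    also have "\<dots> \<le> (\<Sum>p\<in>P. \<Sum>z\<in>Z p. \<bar>real_of_int (zorder (h m) z) * (f z - f p)\<bar>)"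
      by (intro order_trans[OF sum_abs] sum_mono order_refl)
    also have "\<dots> \<le> (\<Sum>p\<in>P. \<Sum>z\<in>Z p. real_of_int (zorder (h m) z) * e)"
    proof (intro sum_mono)
      fix p z assume p: "p \<in> P" and z: "z \<in> Z p"
      have "0 \<le> zorder (h m) z" by (rule zorder_nonneg_entire[OF h hb])
      moreover have "\<bar>f z - f p\<bar> < e" using r(4)[OF p] z by (auto simp: Z_def)
      ultimately show "\<bar>real_of_int (zorder (h m) z) * (f z - f p)\<bar> \<le> real_of_int (zorder (h m) z) * e"
        by (simp add: abs_mult mult_left_mono)
    qed
    also have "\<dots> = (\<Sum>p\<in>P. real_of_int (zorder h0 p) * e)"
    proof (rule sum.cong[OF refl])
      fix p assume "p \<in> P"
      from count[OF this, symmetric]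
      show "(\<Sum>z\<in>Z p. real_of_int (zorder (h m) z) * e) = real_of_int (zorder h0 p) * e"
        by (simp add: sum_distrib_right)
    qed
    also have "\<dots> = D * e" by (simp add: D_def sum_distrib_right)
    also have "\<dots> < \<epsilon>" using D \<epsilon> by (simp add: e_def field_simps)
    finally show ?case by (simp add: dist_real_def)
  qed
qed

lemma zorder_affine:
  assumes h: "h holomorphic_on UNIV" "h a \<noteq> 0" and \<alpha>: "\<alpha> \<noteq> 0"
    and e: "e holomorphic_on UNIV" "\<And>s. e s \<noteq> 0"
  shows "zorder (\<lambda>s. h (\<alpha> * s + b) * e s) s0 = zorder h (\<alpha> * s0 + b)"
proof -
  define z where "z = \<alpha> * s0 + b"
  define n where "n = zorder h z"
  define g where "g = zor_poly h z"
  have "\<exists>w\<in>UNIV. h w \<noteq> 0" using h(2) by blast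
  note fact = zorder_exist_zero[OF h(1) open_UNIV connected_UNIV UNIV_I this, of z, folded n_def g_def]
  have n: "n \<ge> 0" using conjunct1[OF fact] by (simp split: if_splits)
  from conjunct2[OF fact] obtain r where r: "r > 0" "g holomorphic_on cball z r"
      "\<And>w. w \<in> cball z r \<Longrightarrow> h w = g w * (w - z) ^ nat n \<and> g w \<noteq> 0"
    by blast
  define U where "U = ball s0 (r / cmod \<alpha>)"
  have U: "\<alpha> * s + b \<in> cball z r" if "s \<in> U" for s
  proof -
    have "z - (\<alpha> * s + b) = \<alpha> * (s0 - s)" by (simp add: z_def algebra_simps)
    then have "dist z (\<alpha> * s + b) = cmod \<alpha> * dist s0 s" by (simp add: dist_norm norm_mult)
    then show ?thesis using that \<alpha> by (simp add: U_def field_simps)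
  qed
  have "zorder (\<lambda>s. h (\<alpha> * s + b) * e s) s0 = n"
  proof (rule zorder_eqI)
    show "open U" "s0 \<in> U" using r \<alpha> by (auto simp: U_def)
    show "(\<lambda>s. g (\<alpha> * s + b) * \<alpha> ^ nat n * e s) holomorphic_on U"
    proof (intro holomorphic_intros holomorphic_on_subset[OF e(1)])
      have "g \<circ> (\<lambda>s. \<alpha> * s + b) holomorphic_on U"
        by (rule holomorphic_on_compose_gen[OF _ r(2)]) (use U in \<open>auto intro!: holomorphic_intros\<close>)
      then show "(\<lambda>s. g (\<alpha> * s + b)) holomorphic_on U" by (simp add: comp_def)
    qed auto
    show "g (\<alpha> * s0 + b) * \<alpha> ^ nat n * e s0 \<noteq> 0"
      using \<alpha> e(2) r(1) r(3)[of z] by (simp add: z_def)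
    fix s assume s: "s \<in> U" "s \<noteq> s0"
    have "\<alpha> * s + b - z = \<alpha> * (s - s0)" by (simp add: z_def algebra_simps)
    then have "h (\<alpha> * s + b) = g (\<alpha> * s + b) * (\<alpha> * (s - s0)) ^ nat n"
      using r(3)[OF U[OF s(1)]] by simp
    then show "h (\<alpha> * s + b) * e s = g (\<alpha> * s + b) * \<alpha> ^ nat n * e s * (s - s0) powi n"
      using n by (simp add: power_int_def power_mult_distrib)
  qed
  then show ?thesis by (simp add: n_def z_def)
qed

text \<open>
  Zero sums do not see a nonvanishing factor, and an affine change of the variable is absorbed into
  the test function. This permits normalising the partition function freely.
\<close>

lemma zero_sum_affine:
  assumes h: "h holomorphic_on UNIV" "h a \<noteq> 0" and \<alpha>: "\<alpha> \<noteq> 0"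
    and e: "e holomorphic_on UNIV" "\<And>s. e s \<noteq> 0"
  shows "zero_sum (\<lambda>s. h (\<alpha> * s + b) * e s) f = zero_sum h (\<lambda>z. f ((z - b) / \<alpha>))"
proof -
  have bij: "bij_betw (\<lambda>s. \<alpha> * s + b) {s. h (\<alpha> * s + b) * e s = 0} {z. h z = 0}"
    by (rule bij_betw_byWitness[where f'="\<lambda>z. (z - b) / \<alpha>"]) (use \<alpha> e(2) in auto)
  show ?thesis
    unfolding zero_sum_def
    unfolding infsum_reindex_bij_betw[OF bij, of "\<lambda>z. real_of_int (zorder h z) * f ((z - b) / \<alpha>)", symmetric]
    using \<alpha> by (simp add: zorder_affine[OF h \<alpha> e])
qed

text \<open>
  The zeros of the limiting function are simple and form a vertical lattice of period \<open>2 * pi * \<i>\<close>.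
\<close>

lemma zero_sum_exp:
  assumes w: "w \<noteq> 0"
  shows "zero_sum (\<lambda>s. exp (- s) + w) f = (\<Sum>\<^sub>\<infinity>k\<in>(UNIV :: int set). f (2 * complex_of_real pi * \<i> * of_int k + (- Ln (- w))))"
proof -
  define \<phi> where "\<phi> k = 2 * complex_of_real pi * \<i> * of_int k + (- Ln (- w))" for k :: int
  have 1: "exp (- s) + w = 0 \<longleftrightarrow> (\<exists>k. s = \<phi> k)" for s
  proof -
    have "exp (- s) + w = 0 \<longleftrightarrow> exp (- s) = exp (Ln (- w))"
      using w by (simp add: eq_neg_iff_add_eq_0)
    also have "\<dots> \<longleftrightarrow> (\<exists>k::int. - s = Ln (- w) + of_int (2 * k) * pi * \<i>)"
      by (subst exp_eq) simp
    also have "\<dots> \<longleftrightarrow> (\<exists>k::int. s = \<phi> (- k))"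
    proof (intro ex_cong1)
      fix k :: int
      have "- s - (Ln (- w) + of_int (2 * k) * pi * \<i>) = - (s - \<phi> (- k))"
        by (simp add: \<phi>_def algebra_simps)
      then show "(- s = Ln (- w) + of_int (2 * k) * pi * \<i>) = (s = \<phi> (- k))"
        by (metis diff_0 eq_iff_diff_eq_0 minus_equation_iff)
    qed
    also have "\<dots> \<longleftrightarrow> (\<exists>k::int. s = \<phi> k)" by (metis minus_minus)
    finally show ?thesis .
  qed
  have bij: "bij_betw \<phi> UNIV {s. exp (- s) + w = 0}"
    unfolding bij_betw_def by (auto simp: 1 inj_on_def) (simp add: \<phi>_def)
  have zo: "zorder (\<lambda>s. exp (- s) + w) s = 1" if "exp (- s) + w = 0" for s
  proof (rule zorder_zero_eqI)
    show "(\<lambda>s. exp (- s) + w) holomorphic_on UNIV" by (intro holomorphic_intros)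
    have "deriv (\<lambda>s. exp (- s) + w) s = - exp (- s)"
      by (rule DERIV_imp_deriv) (auto intro!: derivative_eq_intros)
    then show "(deriv ^^ nat 1) (\<lambda>s. exp (- s) + w) s \<noteq> 0" by simp
  qed (use that in auto)
  have "zero_sum (\<lambda>s. exp (- s) + w) f = (\<Sum>\<^sub>\<infinity>s\<in>{s. exp (- s) + w = 0}. f s)"
    unfolding zero_sum_def by (rule infsum_cong) (simp add: zo)
  also have "\<dots> = (\<Sum>\<^sub>\<infinity>k\<in>UNIV. f (\<phi> k))"
    by (rule infsum_reindex_bij_betw[OF bij, symmetric])
  finally show ?thesis by (simp add: \<phi>_def)
qed

section \<open>Zeros of partition functions and of shifted exponentials\<close>

lemma uniform_limit_sum:
  fixes f :: "'i \<Rightarrow> 'n \<Rightarrow> 'a \<Rightarrow> 'b::real_normed_vector"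
  assumes "\<And>i. i \<in> I \<Longrightarrow> uniform_limit S (f i) (g i) F"
  shows "uniform_limit S (\<lambda>n x. \<Sum>i\<in>I. f i n x) (\<lambda>x. \<Sum>i\<in>I. g i x) F"
  using assms by (induction I rule: infinite_finite_induct) (auto intro!: uniform_limit_intros)

lemma uniform_limit_exp_linear:
  fixes a :: "nat \<Rightarrow> real"
  assumes "a \<longlonglongrightarrow> a0"
  shows "uniform_limit (cball 0 R) (\<lambda>m \<beta>::complex. exp (\<beta> * complex_of_real (a m))) (\<lambda>\<beta>. exp (\<beta> * complex_of_real a0)) sequentially"
proof (rule uniform_limitI)
  fix e :: real assume e: "e > 0"
  define \<phi> where "\<phi> p = exp (fst p * complex_of_real (snd p))" for p :: "complex \<times> real"
  have "continuous_on (cball 0 R \<times> cball a0 1) \<phi>"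
    unfolding \<phi>_def by (intro continuous_intros)
  then have "uniformly_continuous_on (cball 0 R \<times> cball a0 1) \<phi>"
    by (intro compact_uniformly_continuous compact_Times compact_cball)
  then obtain d where d: "d > 0"
    "\<And>p q. p \<in> cball 0 R \<times> cball a0 1 \<Longrightarrow> q \<in> cball 0 R \<times> cball a0 1 \<Longrightarrow> dist q p < d \<Longrightarrow> dist (\<phi> q) (\<phi> p) < e"
    using e unfolding uniformly_continuous_on_def by metis
  have "\<forall>\<^sub>F m in sequentially. dist (a m) a0 < min d 1"
    using assms d(1) by (intro tendstoD) auto
  then show "\<forall>\<^sub>F m in sequentially. \<forall>\<beta>\<in>cball 0 R. dist (exp (\<beta> * complex_of_real (a m))) (exp (\<beta> * complex_of_real a0)) < e"
  proof eventually_elim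
    case (elim m)
    show ?case
    proof
      fix \<beta> :: complex assume "\<beta> \<in> cball 0 R"
      then have "dist (\<phi> (\<beta>, a m)) (\<phi> (\<beta>, a0)) < e"
        using elim by (intro d(2)) (auto simp: dist_Pair_Pair dist_commute)
      then show "dist (exp (\<beta> * complex_of_real (a m))) (exp (\<beta> * complex_of_real a0)) < e"
        by (simp add: \<phi>_def)
    qed
  qed
qed

lemma partition_fun_holomorphic: "partition_fun x N holomorphic_on UNIV"
  unfolding partition_fun_def by (intro holomorphic_intros)

lemma partition_fun_0: "partition_fun x N 0 = of_nat N"
  by (simp add: partition_fun_def)

lemma bounded_support:
  assumes "compact (closure {z. f z \<noteq> (0::real)})"
  obtains \<rho> :: real where "\<rho> > 0" "\<And>z::complex. z \<notin> cball 0 \<rho> \<Longrightarrow> f z = 0"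
proof -
  have "bounded {z. f z \<noteq> 0}"
    using assms compact_imp_bounded bounded_subset closure_subset by blast
  then obtain R where R: "R > 0" "\<forall>z\<in>{z. f z \<noteq> 0}. norm z \<le> R"
    using bounded_pos by blast
  then show ?thesis using that[of R] by force
qed

lemma rescaled_zeros_sum_eq_zero_sum:
  "rescaled_zeros_sum x N \<beta>0 d f =
     zero_sum (partition_fun x N) (\<lambda>\<beta>. f (complex_of_real (ln (real N)) * (\<beta> / \<beta>0 - 1) - \<i> * complex_of_real d))"
  by (simp add: rescaled_zeros_sum_def zero_sum_def)

text \<open>
  Continuity in the sample, for the product topology on sequences. It is the source of the
  measurability of the zero sum as a random variable.
\<close>

lemma continuous_rescaled_zeros_sum:
  assumes N: "N \<ge> 2" and \<beta>0: "\<beta>0 \<noteq> 0"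
    and f: "continuous_on UNIV f" "compact (closure {z. f z \<noteq> 0})"
  shows "continuous_on UNIV (\<lambda>x. rescaled_zeros_sum x N \<beta>0 d f)"
proof (rule continuous_on_sequentiallyI)
  fix u :: "nat \<Rightarrow> nat \<Rightarrow> real" and a assume u: "u \<longlonglongrightarrow> a"
  define n where "n = ln (real N)"
  have n: "n > 0" using N by (simp add: n_def)
  define F where "F \<beta> = f (complex_of_real n * (\<beta> / \<beta>0 - 1) - \<i> * complex_of_real d)" for \<beta>
  obtain \<rho> where \<rho>: "\<rho> > 0" "\<And>z. z \<notin> cball 0 \<rho> \<Longrightarrow> f z = 0" using bounded_support[OF f(2)] by blast
  define \<rho>' where "\<rho>' = cmod \<beta>0 * ((\<rho> + \<bar>d\<bar>) / n + 1)"
  have \<rho>': "\<rho>' > 0" using \<rho> n \<beta>0 by (auto simp: \<rho>'_def intro!: mult_pos_pos add_nonneg_pos)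
  have F0: "F \<beta> = 0" if "\<beta> \<notin> cball 0 \<rho>'" for \<beta>
    unfolding F_def
  proof (rule \<rho>(2), rule)
    assume "complex_of_real n * (\<beta> / \<beta>0 - 1) - \<i> * complex_of_real d \<in> cball 0 \<rho>"
    then have "cmod (complex_of_real n * (\<beta> / \<beta>0 - 1)) \<le> \<rho> + \<bar>d\<bar>"
      using norm_triangle_ineq2[of "complex_of_real n * (\<beta> / \<beta>0 - 1)" "\<i> * complex_of_real d"]
      by (simp add: norm_mult)
    then have "cmod (\<beta> / \<beta>0 - 1) \<le> (\<rho> + \<bar>d\<bar>) / n"
      using n unfolding norm_mult by (simp add: le_divide_eq mult.commute)
    then have "cmod (\<beta> / \<beta>0) \<le> (\<rho> + \<bar>d\<bar>) / n + 1"
      using norm_triangle_ineq2[of "\<beta> / \<beta>0" 1] by simp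
    then have "cmod \<beta> \<le> \<rho>'"
      using \<beta>0 by (simp add: \<rho>'_def norm_divide divide_le_eq mult.commute)
    then show False using that by simp
  qed
  have conv: "(\<lambda>m. u m k) \<longlonglongrightarrow> a k" for k
    by (rule continuous_on_tendsto_compose[OF continuous_on_product_coordinates u]) auto
  have "(\<lambda>m. zero_sum (partition_fun (u m) N) F) \<longlonglongrightarrow> zero_sum (partition_fun a N) F"
  proof (rule zero_sum_tendsto)
    show "uniform_limit (cball 0 (\<rho>' + 1)) (\<lambda>m. partition_fun (u m) N) (partition_fun a N) sequentially"
      unfolding partition_fun_def
      by (intro uniform_limit_sum uniform_limit_exp_linear tendsto_intros conv)
    show "continuous_on UNIV F" unfolding F_def
      by (intro continuous_on_compose2[OF f(1)] continuous_intros) (use \<beta>0 in auto)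
    show "partition_fun a N 0 \<noteq> 0" using N by (simp add: partition_fun_0)
  qed (use F0 \<rho>' in \<open>auto intro: partition_fun_holomorphic\<close>)
  then show "(\<lambda>m. rescaled_zeros_sum (u m) N \<beta>0 d f) \<longlonglongrightarrow> rescaled_zeros_sum a N \<beta>0 d f"
    unfolding rescaled_zeros_sum_eq_zero_sum F_def n_def .
qed

text \<open>
  The term \<open>X 0\<close> never enters the partition function and is replaced by a constant, as nothing is
  known about its measurability. For \<open>N \<le> 1\<close> the partition function does not depend on the sample.
\<close>

lemma measurable_rescaled_zeros_sum:
  assumes X: "\<And>k. k \<ge> 1 \<Longrightarrow> X k \<in> borel_measurable M" and \<beta>0: "\<beta>0 \<noteq> 0"
    and f: "continuous_on UNIV f" "compact (closure {z. f z \<noteq> 0})"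
  shows "(\<lambda>\<omega>. rescaled_zeros_sum (\<lambda>k. X k \<omega>) N \<beta>0 d f) \<in> borel_measurable M"
proof (cases "N \<ge> 2")
  case True
  define X' where "X' \<omega> k = (if k = 0 then 0 else X k \<omega>)" for \<omega> k
  have "partition_fun (\<lambda>k. X k \<omega>) N = partition_fun (X' \<omega>) N" for \<omega>
    unfolding partition_fun_def X'_def by (intro ext sum.cong) auto
  then have eq: "rescaled_zeros_sum (\<lambda>k. X k \<omega>) N \<beta>0 d f = rescaled_zeros_sum (X' \<omega>) N \<beta>0 d f" for \<omega>
    by (simp add: rescaled_zeros_sum_def)
  have "(\<lambda>x. rescaled_zeros_sum x N \<beta>0 d f) \<in> borel_measurable borel"
    by (rule borel_measurable_continuous_onI) (rule continuous_rescaled_zeros_sum[OF True \<beta>0 f])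
  moreover have "X' \<in> borel_measurable M"
  proof (rule measurable_coordinatewise_then_product)
    fix k show "(\<lambda>\<omega>. X' \<omega> k) \<in> borel_measurable M"
      using X[of k] by (cases "k = 0") (auto simp: X'_def)
  qed
  ultimately show ?thesis unfolding eq by (rule measurable_compose[rotated])
next
  case False
  then have "N = 0 \<or> N = 1" by auto
  then have "partition_fun x N = partition_fun (\<lambda>_. 0) N" for x
    by (auto simp: partition_fun_def)
  then have "rescaled_zeros_sum (\<lambda>k. X k \<omega>) N \<beta>0 d f = rescaled_zeros_sum (\<lambda>k. 0) N \<beta>0 d f" for \<omega>
    unfolding rescaled_zeros_sum_def by metis
  then show ?thesis by simp
qed

lemma exp_add_const_nonzero: "\<exists>a. exp (- a) + w \<noteq> (0::complex)"
proof (rule ccontr)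
  assume "\<not> ?thesis"
  then have "exp (- (0::complex)) = exp (- (1::complex))" by (metis add_right_cancel)
  then have "exp (1::real) = 1"
    by (metis exp_zero exp_minus inverse_1 inverse_inverse_eq of_real_1 exp_of_real of_real_eq_iff minus_zero)
  then show False by simp
qed

lemma uniform_limit_exp_add:
  assumes "(w :: nat \<Rightarrow> complex) \<longlonglongrightarrow> w0"
  shows "uniform_limit S (\<lambda>m s. exp (- s) + w m) (\<lambda>s. exp (- s) + w0) sequentially"
proof (rule uniform_limitI)
  fix e :: real assume "e > 0"
  from tendstoD[OF assms this]
  show "\<forall>\<^sub>F m in sequentially. \<forall>s\<in>S. dist (exp (- s) + w m) (exp (- s) + w0) < e"
    by eventually_elim (simp add: dist_norm)
qed

text \<open>
  This includes \<open>w = 0\<close>, where the function has no zeros at all: as \<open>w\<close> tends to \<open>0\<close>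
  the zeros escape to infinity on the right and leave the support of \<open>f\<close>.
\<close>

lemma continuous_zero_sum_exp:
  assumes f: "continuous_on UNIV f" "compact (closure {z. f z \<noteq> 0})"
  shows "continuous_on UNIV (\<lambda>w. zero_sum (\<lambda>s. exp (- s) + w) f)"
proof (rule continuous_on_sequentiallyI)
  fix u :: "nat \<Rightarrow> complex" and a assume u: "u \<longlonglongrightarrow> a"
  obtain \<rho> where \<rho>: "\<rho> > 0" "\<And>z. z \<notin> cball 0 \<rho> \<Longrightarrow> f z = 0" using bounded_support[OF f(2)] by blast
  obtain b where "exp (- b) + a \<noteq> 0" using exp_add_const_nonzero by blast
  then show "(\<lambda>m. zero_sum (\<lambda>s. exp (- s) + u m) f) \<longlonglongrightarrow> zero_sum (\<lambda>s. exp (- s) + a) f"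
    by (intro zero_sum_tendsto[where \<rho>=\<rho> and R="\<rho> + 1"] uniform_limit_exp_add u f)
       (use \<rho> in \<open>auto intro!: holomorphic_intros\<close>)
qed

text \<open>
  A form of Hurwitz' theorem that is uniform over bounded \<open>w\<close>, by compactness. It is the
  deterministic bridge from small errors in the random function to small errors in its zero sum.
\<close>

lemma zero_sum_exp_stable:
  assumes f: "continuous_on UNIV f" and \<rho>: "\<rho> > 0" "\<And>z. z \<notin> cball 0 \<rho> \<Longrightarrow> f z = 0"
    and e: "e > 0"
  shows "\<exists>\<eta>>0. \<forall>w\<in>cball 0 L. \<forall>h. h holomorphic_on UNIV \<longrightarrow>
    (\<forall>s\<in>cball 0 (\<rho> + 1). cmod (h s - (exp (- s) + w)) \<le> \<eta>) \<longrightarrow>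
    \<bar>zero_sum h f - zero_sum (\<lambda>s. exp (- s) + w) f\<bar> \<le> e"
proof (rule ccontr)
  assume "\<not> ?thesis"
  then have "\<exists>w h. w \<in> cball 0 L \<and> h holomorphic_on UNIV \<and>
    (\<forall>s\<in>cball 0 (\<rho> + 1). cmod (h s - (exp (- s) + w)) \<le> 1 / real (Suc m)) \<and>
    \<not> \<bar>zero_sum h f - zero_sum (\<lambda>s. exp (- s) + w) f\<bar> \<le> e" for m
    by (metis zero_less_divide_1_iff of_nat_0_less_iff zero_less_Suc)
  then obtain w h where w: "\<And>m. w m \<in> cball 0 L" and h: "\<And>m. h m holomorphic_on UNIV"
    and hw: "\<And>m s. s\<in>cball 0 (\<rho> + 1) \<Longrightarrow> cmod (h m s - (exp (- s) + w m)) \<le> 1 / real (Suc m)"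
    and bad: "\<And>m. e < \<bar>zero_sum (h m) f - zero_sum (\<lambda>s. exp (- s) + w m) f\<bar>"
    by (metis not_le)
  have "compact (cball (0::complex) L)" by simp
  then obtain w0 \<phi> where \<phi>: "strict_mono (\<phi> :: nat \<Rightarrow> nat)" "(w \<circ> \<phi>) \<longlonglongrightarrow> w0"
    unfolding compact_def using w by metis
  obtain b where b: "exp (- b) + w0 \<noteq> 0" using exp_add_const_nonzero by blast
  have lim: "(\<lambda>m. zero_sum (g m) f) \<longlonglongrightarrow> zero_sum (\<lambda>s. exp (- s) + w0) f"
    if "\<And>m. g m holomorphic_on UNIV"
      "uniform_limit (cball 0 (\<rho> + 1)) g (\<lambda>s. exp (- s) + w0) sequentially" for g
    by (rule zero_sum_tendsto[OF that(1) _ b that(2)]) (use \<rho> f in \<open>auto intro!: holomorphic_intros\<close>)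
  have u1: "uniform_limit (cball 0 (\<rho> + 1)) (\<lambda>m s. exp (- s) + w (\<phi> m)) (\<lambda>s. exp (- s) + w0) sequentially"
    using uniform_limit_exp_add[OF \<phi>(2)] by (simp add: comp_def)
  have "uniform_limit (cball 0 (\<rho> + 1)) (\<lambda>m s. h (\<phi> m) s - (exp (- s) + w (\<phi> m))) (\<lambda>s. 0) sequentially"
  proof (rule uniform_limit_null_comparison)
    show "\<forall>\<^sub>F m in sequentially. \<forall>s\<in>cball 0 (\<rho> + 1). norm (h (\<phi> m) s - (exp (- s) + w (\<phi> m))) \<le> 1 / real (Suc m)"
    proof (intro always_eventually allI ballI)
      fix m s assume "s \<in> cball (0::complex) (\<rho> + 1)"
      then have "norm (h (\<phi> m) s - (exp (- s) + w (\<phi> m))) \<le> 1 / real (Suc (\<phi> m))" by (rule hw)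
      also have "\<dots> \<le> 1 / real (Suc m)" using seq_suble[OF \<phi>(1), of m] by (simp add: field_simps)
      finally show "norm (h (\<phi> m) s - (exp (- s) + w (\<phi> m))) \<le> 1 / real (Suc m)" .
    qed
    show "uniform_limit (cball (0::complex) (\<rho> + 1)) (\<lambda>m s. 1 / real (Suc m)) (\<lambda>s. 0) sequentially"
    proof (rule uniform_limitI)
      fix e :: real assume "e > 0"
      from tendstoD[OF LIMSEQ_inverse_real_of_nat this]
      show "\<forall>\<^sub>F m in sequentially. \<forall>s\<in>cball (0::complex) (\<rho> + 1). dist (1 / real (Suc m)) 0 < e"
        by eventually_elim (simp add: inverse_eq_divide)
    qed
  qed
  from uniform_limit_add[OF this u1]
  have u2: "uniform_limit (cball 0 (\<rho> + 1)) (\<lambda>m. h (\<phi> m)) (\<lambda>s. exp (- s) + w0) sequentially" by simp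
  have "(\<lambda>m. zero_sum (h (\<phi> m)) f - zero_sum (\<lambda>s. exp (- s) + w (\<phi> m)) f) \<longlonglongrightarrow>
      zero_sum (\<lambda>s. exp (- s) + w0) f - zero_sum (\<lambda>s. exp (- s) + w0) f"
    by (intro tendsto_diff lim h u1 u2) (auto intro!: holomorphic_intros)
  then have "(\<lambda>m. zero_sum (h (\<phi> m)) f - zero_sum (\<lambda>s. exp (- s) + w (\<phi> m)) f) \<longlonglongrightarrow> 0" by simp
  from tendstoD[OF this e] obtain m where "\<bar>zero_sum (h (\<phi> m)) f - zero_sum (\<lambda>s. exp (- s) + w (\<phi> m)) f\<bar> < e"
    by (auto simp: eventually_sequentially)
  then show False using bad[of "\<phi> m"] by simp
qed

section \<open>Weak convergence in the plane from characteristic functions\<close>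

text \<open>
  Complex linear combinations of the plane waves \<open>exp (\<i> * \<langle>u, w\<rangle>)\<close>, where
  \<open>\<langle>u, w\<rangle> = Re (cnj u * w)\<close> is the real inner product of the plane. Integrals of these functions are exactly what
  characteristic functions control.
\<close>

inductive trig_poly :: "(complex \<Rightarrow> complex) \<Rightarrow> bool" where
  wave: "trig_poly (\<lambda>w. exp (\<i> * complex_of_real (Re (cnj u * w))))"
| add: "trig_poly f \<Longrightarrow> trig_poly g \<Longrightarrow> trig_poly (\<lambda>w. f w + g w)"
| scale: "trig_poly f \<Longrightarrow> trig_poly (\<lambda>w. c * f w)"

lemma trig_poly_mult_wave:
  "trig_poly f \<Longrightarrow> trig_poly (\<lambda>w. exp (\<i> * complex_of_real (Re (cnj u * w))) * f w)"
proof (induction rule: trig_poly.induct)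
  case (wave v)
  have "(\<lambda>w. exp (\<i> * complex_of_real (Re (cnj u * w))) * exp (\<i> * complex_of_real (Re (cnj v * w)))) =
    (\<lambda>w. exp (\<i> * complex_of_real (Re (cnj (u + v) * w))))"
    by (simp add: exp_add[symmetric] algebra_simps)
  then show ?case using trig_poly.wave[of "u + v"] by simp
next
  case (add f g)
  then show ?case using trig_poly.add by (simp add: distrib_left)
next
  case (scale f c)
  then show ?case using trig_poly.scale[OF scale.IH, of c] by (simp add: mult.left_commute)
qed

lemma trig_poly_mult: "trig_poly f \<Longrightarrow> trig_poly g \<Longrightarrow> trig_poly (\<lambda>w. f w * g w)"
proof (induction rule: trig_poly.induct)
  case (wave u) then show ?case by (rule trig_poly_mult_wave)
next
  case (add f h)
  then show ?case using trig_poly.add by (simp add: distrib_right)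
next
  case (scale f c)
  then show ?case using trig_poly.scale[of "\<lambda>w. f w * g w" c] by (simp add: mult.assoc)
qed

lemma trig_poly_const: "trig_poly (\<lambda>_. c)"
  using trig_poly.scale[OF trig_poly.wave[of 0], of c] by simp

lemma trig_poly_cos: "trig_poly (\<lambda>w. complex_of_real (cos (Re (cnj u * w))))"
proof -
  have "(\<lambda>w. complex_of_real (cos (Re (cnj u * w)))) =
    (\<lambda>w. 1/2 * (exp (\<i> * complex_of_real (Re (cnj u * w))) + exp (\<i> * complex_of_real (Re (cnj (- u) * w)))))"
    by (rule ext) (simp only: cos_of_real[symmetric] cos_exp_eq, simp add: algebra_simps)
  then show ?thesis
    using trig_poly.scale[OF trig_poly.add[OF trig_poly.wave[of u] trig_poly.wave[of "- u"]], of "1/2"] by (simp only:)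
qed

lemma trig_poly_sin: "trig_poly (\<lambda>w. complex_of_real (sin (Re (cnj u * w))))"
proof -
  have "(\<lambda>w. complex_of_real (sin (Re (cnj u * w)))) =
    (\<lambda>w. (1/(2*\<i>)) * (exp (\<i> * complex_of_real (Re (cnj u * w))) + (-1) * exp (\<i> * complex_of_real (Re (cnj (- u) * w)))))"
    by (rule ext) (simp only: sin_of_real[symmetric] sin_exp_eq, simp add: algebra_simps diff_divide_distrib)
  then show ?thesis
    using trig_poly.scale[OF trig_poly.add[OF trig_poly.wave[of u] trig_poly.scale[OF trig_poly.wave[of "- u"], of "-1"]], of "1/(2*\<i>)"] by (simp only:)
qed

lemma trig_poly_bounded: "trig_poly f \<Longrightarrow> \<exists>B. \<forall>w. cmod (f w) \<le> B"
proof (induction rule: trig_poly.induct)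
  case (wave u) show ?case by (intro exI[of _ 1]) simp
next
  case (add f g)
  then obtain A B where "\<forall>w. cmod (f w) \<le> A" "\<forall>w. cmod (g w) \<le> B" by blast
  then have "\<forall>w. cmod (f w + g w) \<le> A + B" by (meson add_mono norm_triangle_ineq order_trans)
  then show ?case by blast
next
  case (scale f c)
  then obtain B where "\<forall>w. cmod (f w) \<le> B" by blast
  then have "\<forall>w. cmod (c * f w) \<le> cmod c * B" by (simp add: norm_mult mult_left_mono)
  then show ?case by blast
qed

lemma trig_poly_continuous: "trig_poly f \<Longrightarrow> continuous_on UNIV f"
  by (induction rule: trig_poly.induct) (auto intro!: continuous_intros)

lemma trig_poly_integrable:
  assumes "trig_poly f" "prob_space \<mu>" "sets \<mu> = sets borel"
  shows "integrable \<mu> f"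
proof -
  interpret prob_space \<mu> by fact
  obtain B where "\<forall>w. cmod (f w) \<le> B" using trig_poly_bounded[OF assms(1)] by blast
  moreover have "f \<in> borel_measurable \<mu>"
    using borel_measurable_continuous_onI[OF trig_poly_continuous[OF assms(1)]] assms(3)
    by (simp cong: measurable_cong_sets)
  ultimately show ?thesis by (intro integrable_const_bound[of _ B]) auto
qed

lemma trig_poly_integral_tendsto:
  assumes "trig_poly f" "\<And>n. prob_space (\<mu> n)" "\<And>n. sets (\<mu> n) = sets borel"
    "prob_space \<nu>" "sets \<nu> = sets borel"
    and char: "\<And>u. (\<lambda>n. \<integral>w. exp (\<i> * complex_of_real (Re (cnj u * w))) \<partial>\<mu> n) \<longlonglongrightarrow>
       (\<integral>w. exp (\<i> * complex_of_real (Re (cnj u * w))) \<partial>\<nu>)"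
  shows "(\<lambda>n. \<integral>w. f w \<partial>\<mu> n) \<longlonglongrightarrow> (\<integral>w. f w \<partial>\<nu>)"
  using assms(1)
proof (induction rule: trig_poly.induct)
  case (wave u) show ?case by (rule char)
next
  case (add f g)
  have "integrable (\<mu> n) f" "integrable (\<mu> n) g" "integrable \<nu> f" "integrable \<nu> g" for n
    using add trig_poly_integrable assms by auto
  then show ?case using tendsto_add[OF add.IH] by simp
next
  case (scale f c)
  then show ?case using tendsto_mult_left[OF scale.IH, of c] by simp
qed

text \<open>
  The plane modulo the lattice of period \<open>2 * L\<close> in both coordinates.
\<close>

definition torus_map :: "real \<Rightarrow> complex \<Rightarrow> complex \<times> complex" where
  "torus_map L w = (cis (pi / L * Re w), cis (pi / L * Im w))"

definition torus :: "(complex \<times> complex) set" where "torus = sphere 0 1 \<times> sphere 0 1"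

lemma torus_map_in: "torus_map L w \<in> torus"
  by (simp add: torus_map_def torus_def)

text \<open>
  Stone-Weierstrass on the torus: the functions that pull back to trigonometric polynomials form an
  algebra, and it contains the real coordinates of the two circles, which separate points.
\<close>

lemma trig_poly_approx_torus:
  assumes F: "continuous_on torus F" and e: "e > 0"
  obtains g where "trig_poly (\<lambda>w. complex_of_real (g (torus_map L w)))"
    "\<And>p. p \<in> torus \<Longrightarrow> \<bar>F p - g p\<bar> < e"
proof -
  define R where "R = {g. continuous_on torus g \<and> trig_poly (\<lambda>w. complex_of_real (g (torus_map L w)))}"
  have "function_ring_on R torus"
  proof
    show "compact torus" unfolding torus_def by (intro compact_Times compact_sphere)
    fix x y assume xy: "x \<in> torus" "y \<in> torus" "x \<noteq> y"
    have "trig_poly (\<lambda>w. complex_of_real (cos (pi / L * Re w)))"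
      using trig_poly_cos[of "complex_of_real (pi / L)"] by simp
    then have 1: "(\<lambda>p. Re (fst p)) \<in> R" by (auto simp: R_def torus_map_def intro!: continuous_intros)
    have "trig_poly (\<lambda>w. complex_of_real (sin (pi / L * Re w)))"
      using trig_poly_sin[of "complex_of_real (pi / L)"] by simp
    then have 2: "(\<lambda>p. Im (fst p)) \<in> R" by (auto simp: R_def torus_map_def intro!: continuous_intros)
    have "trig_poly (\<lambda>w. complex_of_real (cos (pi / L * Im w)))"
      using trig_poly_cos[of "\<i> * complex_of_real (pi / L)"] by simp
    then have 3: "(\<lambda>p. Re (snd p)) \<in> R" by (auto simp: R_def torus_map_def intro!: continuous_intros)
    have "trig_poly (\<lambda>w. complex_of_real (sin (pi / L * Im w)))"
      using trig_poly_sin[of "\<i> * complex_of_real (pi / L)"] by simp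
    then have 4: "(\<lambda>p. Im (snd p)) \<in> R" by (auto simp: R_def torus_map_def intro!: continuous_intros)
    show "\<exists>f\<in>R. f x \<noteq> f y"
      using 1 2 3 4 xy(3) by (metis complex_eqI prod_eqI)
  qed (auto simp: R_def intro!: continuous_intros trig_poly_const trig_poly_mult trig_poly.add)
  then interpret function_ring_on R torus .
  from Stone_Weierstrass_basic[OF F e] show ?thesis using that by (auto simp: R_def)
qed

text \<open>
  A function supported in a disc of radius less than \<open>L\<close> extends periodically. The function on the torus
  is given by the arguments of the two coordinates; the jump of \<open>Arg\<close> at \<open>-1\<close> does no harm because the
  function vanishes near it.
\<close>

lemma compact_support_eq_torus:
  fixes \<Phi> :: "complex \<Rightarrow> real"
  assumes cont: "continuous_on UNIV \<Phi>" and supp: "\<And>w. w \<notin> cball 0 K \<Longrightarrow> \<Phi> w = 0" and K: "0 < K" "K < L"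
  obtains F where "continuous_on torus F" "\<And>w. cmod w < L \<Longrightarrow> F (torus_map L w) = \<Phi> w"
    "range F \<subseteq> range \<Phi>"
proof -
  define F where "F p = \<Phi> (Complex (L / pi * Arg (fst p)) (L / pi * Arg (snd p)))" for p
  define c where "c = cos (pi * K / L)"
  define S1 where "S1 = {p::complex \<times> complex. fst p \<notin> \<real>\<^sub>\<le>\<^sub>0 \<and> snd p \<notin> \<real>\<^sub>\<le>\<^sub>0}"
  define S2 where "S2 = {p::complex \<times> complex. Re (fst p) < c}"
  define S3 where "S3 = {p::complex \<times> complex. Re (snd p) < c}"
  have L: "L > 0" using K by simp
  have c: "c > -1"
  proof -
    have "cos (pi * K / L) > cos pi" using K by (intro cos_monotone_0_pi) (auto simp: field_simps)
    then show ?thesis by (simp add: c_def)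
  qed
  have big: "L / pi * \<bar>Arg a\<bar> > K" if "a \<in> sphere 0 1" "Re a < c" for a
  proof (rule ccontr)
    assume "\<not> ?thesis"
    then have "\<bar>Arg a\<bar> \<le> pi * K / L" using L by (simp add: field_simps not_less)
    then have "cos \<bar>Arg a\<bar> \<ge> c" unfolding c_def
      using K by (intro cos_monotone_0_pi_le) (auto simp: field_simps)
    moreover have "Re a = cos (Arg a)"
    proof -
      have "norm a = 1" "a \<noteq> 0" using that(1) by auto
      then have "cis (Arg a) = a" using cis_Arg[of a] by (simp add: sgn_eq)
      then show ?thesis by (metis cis.sel(1))
    qed
    ultimately show False using that(2) by simp
  qed
  have z2: "F p = 0" if "p \<in> torus" "p \<in> S2" for p
    unfolding F_def
  proof (rule supp, rule)
    assume "Complex (L / pi * Arg (fst p)) (L / pi * Arg (snd p)) \<in> cball 0 K"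
    then have "\<bar>L / pi * Arg (fst p)\<bar> \<le> K"
      using abs_Re_le_cmod[of "Complex (L / pi * Arg (fst p)) (L / pi * Arg (snd p))"] by simp
    moreover have "fst p \<in> sphere 0 1" using that(1) by (simp add: torus_def mem_Times_iff)
    ultimately show False using big[of "fst p"] that L by (auto simp: S2_def abs_mult)
  qed
  have z3: "F p = 0" if "p \<in> torus" "p \<in> S3" for p
    unfolding F_def
  proof (rule supp, rule)
    assume "Complex (L / pi * Arg (fst p)) (L / pi * Arg (snd p)) \<in> cball 0 K"
    then have "\<bar>L / pi * Arg (snd p)\<bar> \<le> K"
      using abs_Im_le_cmod[of "Complex (L / pi * Arg (fst p)) (L / pi * Arg (snd p))"] by simp
    moreover have "snd p \<in> sphere 0 1" using that(1) by (simp add: torus_def mem_Times_iff)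
    ultimately show False using big[of "snd p"] that L by (auto simp: S3_def abs_mult)
  qed
  have o2: "open S2" unfolding S2_def by (intro open_Collect_less continuous_intros)
  have o3: "open S3" unfolding S3_def by (intro open_Collect_less continuous_intros)
  have o1: "open S1"
  proof -
    have "S1 = (- \<real>\<^sub>\<le>\<^sub>0) \<times> (- \<real>\<^sub>\<le>\<^sub>0)" by (auto simp: S1_def)
    then show ?thesis using closed_nonpos_Reals_complex by (simp add: open_Times open_Compl)
  qed
  have cover: "torus \<subseteq> S1 \<union> S2 \<union> S3"
  proof
    fix p assume p: "p \<in> torus"
    have aux: "Re a < c" if "a \<in> sphere 0 1" "a \<in> \<real>\<^sub>\<le>\<^sub>0" for a :: complex
    proof -
      from that(2) obtain x where "a = of_real x" "x \<le> 0" by (auto elim: nonpos_Reals_cases)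
      then have "a = -1" using that(1) by auto
      then show ?thesis using c by simp
    qed
    have "fst p \<in> sphere 0 1" "snd p \<in> sphere 0 1" using p by (simp_all add: torus_def mem_Times_iff)
    then show "p \<in> S1 \<union> S2 \<union> S3" using aux[of "fst p"] aux[of "snd p"]
      unfolding S1_def S2_def S3_def by blast
  qed
  have iso: "isCont F p" if "p \<in> S1" for p
  proof -
    have "isCont (\<lambda>p. Arg (fst p)) p" "isCont (\<lambda>p. Arg (snd p)) p"
      using that isCont_o2[where f=fst and g=Arg and a=p] isCont_o2[where f=snd and g=Arg and a=p]
      by (simp_all add: S1_def continuous_at_Arg isCont_fst isCont_snd)
    then have "isCont (\<lambda>p. Complex (L / pi * Arg (fst p)) (L / pi * Arg (snd p))) p"
      unfolding Complex_eq by (intro continuous_intros)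
    then show ?thesis unfolding F_def
      by (rule isCont_o2) (use cont in \<open>simp add: continuous_on_eq_continuous_at\<close>)
  qed
  have "continuous_on torus F"
    unfolding continuous_on_eq_continuous_within
  proof
    fix p assume p: "p \<in> torus"
    consider "p \<in> S1" | "p \<in> S2" | "p \<in> S3" using cover p by blast
    then show "continuous (at p within torus) F"
    proof cases
      case 1 then show ?thesis using iso continuous_at_imp_continuous_at_within by blast
    next
      case 2
      have "\<forall>\<^sub>F q in at p within torus. F q = F p"
        using z2 p 2 o2 by (auto simp: eventually_at_topological intro!: exI[of _ S2])
      then show ?thesis unfolding continuous_within by (rule tendsto_eventually)
    next
      case 3
      have "\<forall>\<^sub>F q in at p within torus. F q = F p"
        using z3 p 3 o3 by (auto simp: eventually_at_topological intro!: exI[of _ S3])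
      then show ?thesis unfolding continuous_within by (rule tendsto_eventually)
    qed
  qed
  moreover have "F (torus_map L w) = \<Phi> w" if w: "cmod w < L" for w
  proof -
    have "\<bar>Re w\<bar> < L" "\<bar>Im w\<bar> < L" using w abs_Re_le_cmod[of w] abs_Im_le_cmod[of w] by auto
    then have "-pi < pi / L * Re w \<and> pi / L * Re w \<le> pi" "-pi < pi / L * Im w \<and> pi / L * Im w \<le> pi"
      using L by (auto simp: abs_less_iff pos_less_divide_eq pos_divide_le_eq minus_less_iff
          mult_less_cancel_left_pos[of pi "- L", simplified])
    then have "Arg (cis (pi / L * Re w)) = pi / L * Re w" "Arg (cis (pi / L * Im w)) = pi / L * Im w"
      by (auto intro!: Arg_cis)
    then show ?thesis using L by (simp add: F_def torus_map_def)
  qed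
  ultimately show ?thesis using that by (auto simp: F_def)
qed


text \<open>
  The continuity theorem in the plane, under a uniform second moment bound. A bounded continuous
  function is cut off, periodised and replaced by a trigonometric polynomial \<open>T\<close>. The error is at most
  \<open>e\<close> on the disc of radius \<open>K\<close> and bounded outside it, where the second moment bound keeps
  the mass below \<open>C / K\<^sup>2\<close>.
\<close>

lemma tendsto_integral_if_char_tendsto:
  fixes \<Phi> :: "complex \<Rightarrow> real"
  assumes \<mu>: "\<And>n. prob_space (\<mu> n)" "\<And>n. sets (\<mu> n) = sets borel"
    and \<nu>: "prob_space \<nu>" "sets \<nu> = sets borel"
    and char: "\<And>u. (\<lambda>n. \<integral>w. exp (\<i> * complex_of_real (Re (cnj u * w))) \<partial>\<mu> n) \<longlonglongrightarrow>
       (\<integral>w. exp (\<i> * complex_of_real (Re (cnj u * w))) \<partial>\<nu>)"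
    and moment: "\<And>n. integrable (\<mu> n) (\<lambda>w. (cmod w)\<^sup>2)" "\<And>n. (\<integral>w. (cmod w)\<^sup>2 \<partial>\<mu> n) \<le> C"
      "integrable \<nu> (\<lambda>w. (cmod w)\<^sup>2)" "(\<integral>w. (cmod w)\<^sup>2 \<partial>\<nu>) \<le> C"
    and \<Phi>: "continuous_on UNIV \<Phi>" "\<And>w. \<bar>\<Phi> w\<bar> \<le> B"
  shows "(\<lambda>n. \<integral>w. \<Phi> w \<partial>\<mu> n) \<longlonglongrightarrow> (\<integral>w. \<Phi> w \<partial>\<nu>)"
proof (rule tendstoI)
  fix e' :: real assume e': "e' > 0"
  define e where "e = e' / 5"
  have e: "e > 0" using e' by (simp add: e_def)
  have B: "B \<ge> 0" using \<Phi>(2)[of 0] by simp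
  have C: "C \<ge> 0" using order_trans[OF _ moment(4), of 0] by simp
  \<comment> \<open>So large that the mass outside the disc of radius \<open>K\<close> contributes at most \<open>e\<close>; the summand \<open>1\<close> only keeps it positive.\<close>
  define K where "K = sqrt (2 * B * C / e) + 1"
  have K: "K > 0" using B C e by (simp add: K_def add_nonneg_pos)
  have KC: "2 * B * C / K\<^sup>2 \<le> e"
  proof -
    have "2 * B * C / e = (sqrt (2 * B * C / e))\<^sup>2" using B C e by simp
    also have "\<dots> \<le> K\<^sup>2" unfolding K_def using B C e by (intro power_mono) auto
    finally show ?thesis using K e by (simp add: field_simps)
  qed
  define ct where "ct w = max 0 (min 1 (K + 1 - cmod w))" for w
  have "continuous_on UNIV (\<lambda>w. \<Phi> w * ct w)" unfolding ct_def by (intro continuous_intros \<Phi>(1))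
  then obtain F where F: "continuous_on torus F" "\<And>w. cmod w < K + 2 \<Longrightarrow> F (torus_map (K+2) w) = \<Phi> w * ct w"
      "range F \<subseteq> range (\<lambda>w. \<Phi> w * ct w)"
    by (rule compact_support_eq_torus[where K="K+1" and L="K+2"]) (use K in \<open>auto simp: ct_def\<close>)
  obtain g where g: "trig_poly (\<lambda>w. complex_of_real (g (torus_map (K+2) w)))"
    "\<And>p. p \<in> torus \<Longrightarrow> \<bar>F p - g p\<bar> < e"
    using trig_poly_approx_torus[OF F(1) e, of "K+2"] by blast
  define T where "T w = g (torus_map (K+2) w)" for w
  have T: "trig_poly (\<lambda>w. complex_of_real (T w))" using g(1) by (simp add: T_def)
  have FB: "\<bar>F p\<bar> \<le> B" for p
  proof -
    obtain w where "F p = \<Phi> w * ct w" using F(3) by blast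
    moreover have "\<bar>\<Phi> w * ct w\<bar> \<le> B * 1" unfolding abs_mult
      by (intro mult_mono \<Phi>(2)) (auto simp: ct_def B)
    ultimately show ?thesis by simp
  qed
  have close: "\<bar>\<Phi> w - T w\<bar> \<le> e + 2 * B / K\<^sup>2 * (cmod w)\<^sup>2" for w
  proof (cases "cmod w \<le> K")
    case True
    then have "F (torus_map (K+2) w) = \<Phi> w" using F(2)[of w] by (simp add: ct_def)
    then have "\<bar>\<Phi> w - T w\<bar> < e" using g(2)[OF torus_map_in, of "K+2" w] by (simp add: T_def)
    moreover have "0 \<le> 2 * B / K\<^sup>2 * (cmod w)\<^sup>2" using B by simp
    ultimately show ?thesis by simp
  next
    case False
    have "\<bar>F (torus_map (K+2) w) - T w\<bar> < e" unfolding T_def by (rule g(2)[OF torus_map_in])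
    then have "\<bar>\<Phi> w - T w\<bar> \<le> e + 2 * B" using FB[of "torus_map (K+2) w"] \<Phi>(2)[of w] by linarith
    moreover have "2 * B * 1 \<le> 2 * B * ((cmod w)\<^sup>2 / K\<^sup>2)"
      using False K B by (intro mult_left_mono) (auto simp: power_mono)
    ultimately show ?thesis by simp
  qed
  have Tc: "continuous_on UNIV T"
    using continuous_on_Re[OF trig_poly_continuous[OF T]] by simp
  have diff: "\<bar>(\<integral>w. \<Phi> w \<partial>\<kappa>) - (\<integral>w. T w \<partial>\<kappa>)\<bar> \<le> 2 * e"
    if \<kappa>: "prob_space \<kappa>" "sets \<kappa> = sets borel" and m: "integrable \<kappa> (\<lambda>w. (cmod w)\<^sup>2)" "(\<integral>w. (cmod w)\<^sup>2 \<partial>\<kappa>) \<le> C" for \<kappa>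
  proof -
    interpret prob_space \<kappa> by fact
    have "\<Phi> \<in> borel_measurable \<kappa>"
      using borel_measurable_continuous_onI[OF \<Phi>(1)] \<kappa>(2) by (simp cong: measurable_cong_sets)
    then have i1: "integrable \<kappa> \<Phi>" by (intro integrable_const_bound[of _ B]) (auto simp: \<Phi>(2))
    have i2: "integrable \<kappa> T" using integrable_Re[OF trig_poly_integrable[OF T \<kappa>]] by simp
    have "\<bar>(\<integral>w. \<Phi> w \<partial>\<kappa>) - (\<integral>w. T w \<partial>\<kappa>)\<bar> = \<bar>\<integral>w. \<Phi> w - T w \<partial>\<kappa>\<bar>" using i1 i2 by simp
    also have "\<dots> \<le> (\<integral>w. \<bar>\<Phi> w - T w\<bar> \<partial>\<kappa>)" by (rule integral_abs_bound)
    also have "\<dots> \<le> (\<integral>w. e + 2 * B / K\<^sup>2 * (cmod w)\<^sup>2 \<partial>\<kappa>)"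
      by (intro integral_mono close) (use i1 i2 m in auto)
    also have "\<dots> = e + 2 * B / K\<^sup>2 * (\<integral>w. (cmod w)\<^sup>2 \<partial>\<kappa>)" using m by (simp add: prob_space)
    also have "\<dots> \<le> e + 2 * B / K\<^sup>2 * C" using m(2) B by (intro add_left_mono mult_left_mono) auto
    also have "\<dots> \<le> 2 * e" using KC by simp
    finally show ?thesis .
  qed
  have "(\<lambda>n. \<integral>w. complex_of_real (T w) \<partial>\<mu> n) \<longlonglongrightarrow> (\<integral>w. complex_of_real (T w) \<partial>\<nu>)"
    by (rule trig_poly_integral_tendsto[OF T \<mu> \<nu> char])
  then have "(\<lambda>n. \<integral>w. T w \<partial>\<mu> n) \<longlonglongrightarrow> (\<integral>w. T w \<partial>\<nu>)"
    by (simp add: tendsto_of_real_iff)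
  from tendstoD[OF this e]
  show "\<forall>\<^sub>F n in sequentially. dist (\<integral>w. \<Phi> w \<partial>\<mu> n) (\<integral>w. \<Phi> w \<partial>\<nu>) < e'"
  proof eventually_elim
    case (elim n)
    then show ?case
      using diff[OF \<mu> moment(1,2), of n] diff[OF \<nu> moment(3,4)] e_def unfolding dist_real_def by linarith
  qed
qed

section \<open>Gaussian integrals\<close>

abbreviation gauss :: "real measure" where "gauss \<equiv> std_normal_distribution"

text \<open>
  Exponential tilting shifts a normal law: completing the square turns the weight
  \<open>exp (a * x)\<close> into the translation \<open>x + a\<close>.
\<close>

lemma has_bochner_integral_gauss_tilt:
  fixes h :: "real \<Rightarrow> 'b::{banach, second_countable_topology}"
  assumes h: "has_bochner_integral gauss (\<lambda>x. h (x + a)) v" and [measurable]: "h \<in> borel_measurable borel"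
  shows "has_bochner_integral gauss (\<lambda>x. exp (a * x) *\<^sub>R h x) (exp (a\<^sup>2 / 2) *\<^sub>R v)"
proof -
  have *: "std_normal_density (x + a) * exp (a * (x + a)) = exp (a\<^sup>2 / 2) * std_normal_density x" for x
  proof -
    have "- (x + a)\<^sup>2 / 2 + a * (x + a) = a\<^sup>2 / 2 + - x\<^sup>2 / 2" by (simp add: power2_eq_square field_simps)
    then have "exp (- (x + a)\<^sup>2 / 2) * exp (a * (x + a)) = exp (a\<^sup>2 / 2) * exp (- x\<^sup>2 / 2)"
      by (simp only: exp_add[symmetric])
    then show ?thesis by (simp add: std_normal_density_def)
  qed
  have "integrable gauss (\<lambda>x. h (x + a))" "(\<integral>x. h (x + a) \<partial>gauss) = v"
    using h by (auto simp: has_bochner_integral_iff)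
  then have "has_bochner_integral lborel (\<lambda>x. std_normal_density x *\<^sub>R h (x + a)) v"
    by (simp add: has_bochner_integral_iff integrable_density integral_density)
  then have "has_bochner_integral lborel (\<lambda>x. exp (a\<^sup>2 / 2) *\<^sub>R (std_normal_density x *\<^sub>R h (x + a))) (exp (a\<^sup>2 / 2) *\<^sub>R v)"
    by (rule has_bochner_integral_scaleR_right)
  then have "has_bochner_integral lborel (\<lambda>x. std_normal_density (a + 1 * x) *\<^sub>R (exp (a * (a + 1 * x)) *\<^sub>R h (a + 1 * x))) ((exp (a\<^sup>2 / 2) *\<^sub>R v) /\<^sub>R \<bar>1\<bar>)"
    using * by (simp add: add.commute)
  then have "has_bochner_integral lborel (\<lambda>x. std_normal_density x *\<^sub>R (exp (a * x) *\<^sub>R h x)) (exp (a\<^sup>2 / 2) *\<^sub>R v)"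
    by (subst lborel_has_bochner_integral_real_affine_iff[of 1 _ _ a]) auto
  then show ?thesis by (intro has_bochner_integral_density) auto
qed

lemma exp_complex_times_real:
  "exp (\<beta> * complex_of_real x) = exp (Re \<beta> * x) *\<^sub>R cis (Im \<beta> * x)"
  by (simp add: complex_eq_iff Re_exp Im_exp)

lemma has_bochner_integral_gauss_exp:
  "has_bochner_integral gauss (\<lambda>x. exp (\<beta> * complex_of_real x)) (exp (\<beta>\<^sup>2 / 2))"
proof -
  interpret g: real_distribution gauss by (rule real_dist_normal_dist)
  define \<sigma> \<tau> where "\<sigma> = Re \<beta>" and "\<tau> = Im \<beta>"
  have "integrable gauss (\<lambda>x. cis (\<tau> * x))"
    by (intro g.integrable_const_bound[of _ 1]) (auto simp: cis_conv_exp)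
  moreover have "(\<integral>x. cis (\<tau> * x) \<partial>gauss) = exp (- \<tau>\<^sup>2 / 2)"
    using fun_cong[OF char_std_normal_distribution, of \<tau>] by (simp add: char_def cis_conv_exp)
  ultimately have "has_bochner_integral gauss (\<lambda>x. cis (\<tau> * x)) (exp (- \<tau>\<^sup>2 / 2))"
    by (simp add: has_bochner_integral_iff)
  then have "has_bochner_integral gauss (\<lambda>x. cis (\<tau> * \<sigma>) * cis (\<tau> * x)) (cis (\<tau> * \<sigma>) * exp (- \<tau>\<^sup>2 / 2))"
    by (rule has_bochner_integral_mult_right)
  then have "has_bochner_integral gauss (\<lambda>x. cis (\<tau> * (x + \<sigma>))) (cis (\<tau> * \<sigma>) * exp (- \<tau>\<^sup>2 / 2))"
    by (simp add: cis_mult algebra_simps)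
  from has_bochner_integral_gauss_tilt[OF this]
  have "has_bochner_integral gauss (\<lambda>x. exp (\<sigma> * x) *\<^sub>R cis (\<tau> * x)) (exp (\<sigma>\<^sup>2 / 2) *\<^sub>R (cis (\<tau> * \<sigma>) * exp (- \<tau>\<^sup>2 / 2)))"
    by (simp add: cis_conv_exp)
  moreover have "exp (\<sigma>\<^sup>2 / 2) *\<^sub>R (cis (\<tau> * \<sigma>) * exp (- \<tau>\<^sup>2 / 2)) = exp (\<beta>\<^sup>2 / 2)"
  proof -
    have "\<beta> = Complex \<sigma> \<tau>" by (simp add: \<sigma>_def \<tau>_def)
    then have "\<beta>\<^sup>2 / 2 = complex_of_real (\<sigma>\<^sup>2 / 2) + (\<i> * complex_of_real (\<tau> * \<sigma>) + complex_of_real (- \<tau>\<^sup>2 / 2))"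
      by (simp add: complex_eq_iff power2_eq_square field_simps)
    then have "exp (\<beta>\<^sup>2 / 2) = exp (complex_of_real (\<sigma>\<^sup>2 / 2)) * (exp (\<i> * complex_of_real (\<tau> * \<sigma>)) * exp (complex_of_real (- \<tau>\<^sup>2 / 2)))"
      by (simp only: exp_add)
    then show ?thesis unfolding exp_of_real cis_conv_exp scaleR_conv_of_real by (rule sym)
  qed
  ultimately show ?thesis by (simp add: exp_complex_times_real \<sigma>_def \<tau>_def)
qed

lemma has_bochner_integral_gauss_exp_real:
  "has_bochner_integral gauss (\<lambda>x. exp (a * x)) (exp (a\<^sup>2 / 2))"
proof -
  interpret g: real_distribution gauss by (rule real_dist_normal_dist)
  have "has_bochner_integral gauss (\<lambda>x. 1::real) 1"
    using g.prob_space by (simp add: has_bochner_integral_iff)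
  from has_bochner_integral_gauss_tilt[where h="\<lambda>_. 1::real", OF this] show ?thesis by simp
qed

text \<open>
  Under the weight, \<open>x\<close> behaves like a standard normal variable plus \<open>2 * s * sqrt n\<close>, so
  \<open>x / sqrt n - 2 * s\<close> becomes a centred normal variable of variance \<open>1 / n\<close>.
\<close>

lemma gauss_tilted_even_moment:
  assumes n: "n > 0"
  shows "has_bochner_integral gauss (\<lambda>x. exp (2 * s * sqrt n * x) * (x / sqrt n - 2 * s) ^ (2 * j))
    (exp (2 * s\<^sup>2 * n) * (fact (2 * j) / (2 ^ j * fact j * n ^ j)))"
proof -
  have "has_bochner_integral lborel (\<lambda>x. std_normal_density x *\<^sub>R x ^ (2 * j)) (fact (2 * j) / (2^j * fact j))"
    using std_normal_moment_even[of j] by simp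
  then have "has_bochner_integral gauss (\<lambda>x. x ^ (2 * j)) (fact (2 * j) / (2^j * fact j))"
    by (intro has_bochner_integral_density) auto
  then have "has_bochner_integral gauss (\<lambda>x. x ^ (2 * j) / n ^ j) (fact (2 * j) / (2^j * fact j) / n ^ j)"
    by (rule has_bochner_integral_divide_zero)
  moreover have "((x + 2 * s * sqrt n) / sqrt n - 2 * s) ^ (2 * j) = x ^ (2 * j) / n ^ j" for x
  proof -
    have "(x + 2 * s * sqrt n) / sqrt n - 2 * s = x / sqrt n" using n by (simp add: field_simps)
    then show ?thesis using n by (simp add: power_mult power_divide)
  qed
  ultimately have "has_bochner_integral gauss (\<lambda>x. ((x + 2 * s * sqrt n) / sqrt n - 2 * s) ^ (2 * j)) (fact (2 * j) / (2^j * fact j) / n ^ j)"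
    by simp
  from has_bochner_integral_gauss_tilt[where h="\<lambda>x. (x / sqrt n - 2 * s) ^ (2 * j)", OF this]
  show ?thesis using n by (simp add: power_mult_distrib field_simps)
qed

lemma fact_double_le: "(fact (2 * j) :: nat) \<le> (2 ^ j * fact j)\<^sup>2"
proof (induction j)
  case (Suc j)
  have "(fact (2 * Suc j) :: nat) = (2 * j + 2) * ((2 * j + 1) * fact (2 * j))" by (simp add: algebra_simps)
  also have "\<dots> \<le> (2 * j + 2) * ((2 * j + 2) * (2 ^ j * fact j)\<^sup>2)"
    by (intro mult_left_mono mult_mono Suc.IH) auto
  also have "\<dots> = (2 ^ Suc j * fact (Suc j))\<^sup>2" by (simp add: power2_eq_square algebra_simps)
  finally show ?case .
qed simp

lemma even_moment_le: "fact (2 * j) / (2 ^ j * fact j) \<le> (2 ^ j * fact j :: real)"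
proof -
  have "real (fact (2 * j)) \<le> real ((2 ^ j * fact j)\<^sup>2)" using fact_double_le[of j] by (simp only: of_nat_le_iff)
  then show ?thesis by (simp add: divide_le_eq power2_eq_square)
qed

lemma (in prob_space) expectation_norm_le_sqrt:
  fixes Y :: "'a \<Rightarrow> 'b::{banach, second_countable_topology}"
  assumes [measurable]: "Y \<in> borel_measurable M" and i: "integrable M (\<lambda>\<omega>. (norm (Y \<omega>))\<^sup>2)"
  shows "integrable M Y" "expectation (\<lambda>\<omega>. norm (Y \<omega>)) \<le> sqrt (expectation (\<lambda>\<omega>. (norm (Y \<omega>))\<^sup>2))"
proof -
  have "integrable M (\<lambda>\<omega>. 1 + (norm (Y \<omega>))\<^sup>2)" using i by simp
  then show int: "integrable M Y"
  proof (rule Bochner_Integration.integrable_bound)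
    have "x \<le> 1 + x\<^sup>2" for x :: real
    proof (cases "x \<le> 1")
      case True then show ?thesis using zero_le_power2[of x] by linarith
    next
      case False then show ?thesis using mult_left_mono[of 1 x x] unfolding power2_eq_square by linarith
    qed
    then show "AE \<omega> in M. norm (Y \<omega>) \<le> norm (1 + (norm (Y \<omega>))\<^sup>2)" by simp
  qed simp
  have "0 \<le> variance (\<lambda>\<omega>. norm (Y \<omega>))" by (rule variance_positive)
  also have "\<dots> = expectation (\<lambda>\<omega>. (norm (Y \<omega>))\<^sup>2) - (expectation (\<lambda>\<omega>. norm (Y \<omega>)))\<^sup>2"
    using int i by (intro variance_eq) auto
  finally show "expectation (\<lambda>\<omega>. norm (Y \<omega>)) \<le> sqrt (expectation (\<lambda>\<omega>. (norm (Y \<omega>))\<^sup>2))"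
    by (simp add: real_le_rsqrt)
qed


section \<open>Sums of functions of independent normal variables\<close>

text \<open>
  The limit of the \<open>n\<close>-th powers in a triangular array: both \<open>c n\<close> and
  \<open>exp (- v n / 2)\<close> lie in the unit disc and differ by \<open>o(1 / n)\<close>, so their \<open>n\<close>-th powers
  differ by \<open>o(1)\<close>.
\<close>

lemma tendsto_power_of_char_approx:
  fixes c :: "nat \<Rightarrow> complex" and v :: "nat \<Rightarrow> real"
  assumes c: "\<And>n. cmod (c n) \<le> 1" and v0: "\<And>n. 0 \<le> v n"
    and v: "(\<lambda>n. real n * v n) \<longlonglongrightarrow> V"
    and approx: "(\<lambda>n. real n * cmod (c n - (1 - v n / 2))) \<longlonglongrightarrow> 0"
  shows "(\<lambda>n. c n ^ n) \<longlonglongrightarrow> exp (- V / 2)"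
proof -
  have vq: "(\<lambda>n. real n * (v n)\<^sup>2) \<longlonglongrightarrow> 0"
  proof -
    have "(\<lambda>n. (real n * v n) * (real n * v n) * (1 / real n)) \<longlonglongrightarrow> V * V * 0"
      by (intro tendsto_mult v lim_1_over_n)
    moreover have "(real n * v n) * (real n * v n) * (1 / real n) = real n * (v n)\<^sup>2" for n
      by (cases "n = 0") (auto simp: power2_eq_square)
    ultimately show ?thesis by simp
  qed
  have small: "cmod (1 - complex_of_real (v n / 2) - complex_of_real (exp (- v n / 2))) \<le> (v n)\<^sup>2" for n
  proof -
    define x where "x = v n / 2"
    have x: "x \<ge> 0" using v0 by (simp add: x_def)
    have 1: "1 - x \<le> exp (- x)" using exp_ge_add_one_self[of "- x"] by simp
    have "1 + x \<le> exp x" by (rule exp_ge_add_one_self)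
    then have "exp (- x) \<le> 1 / (1 + x)" using x by (simp add: exp_minus field_simps)
    also have "\<dots> \<le> 1 - x + x\<^sup>2"
    proof -
      have "1 \<le> (1 - x + x\<^sup>2) * (1 + x)" using x by (simp add: power2_eq_square algebra_simps)
      then show ?thesis using x by (simp add: divide_le_eq)
    qed
    finally have 2: "exp (- x) \<le> 1 - x + x\<^sup>2" .
    have "1 - complex_of_real (v n / 2) - complex_of_real (exp (- v n / 2)) = complex_of_real (1 - x - exp (- x))"
      by (simp add: x_def)
    then have "cmod (1 - complex_of_real (v n / 2) - complex_of_real (exp (- v n / 2))) = \<bar>1 - x - exp (- x)\<bar>"
      by (simp only: norm_of_real)
    also have "\<dots> \<le> x\<^sup>2" using 1 2 by linarith
    also have "\<dots> \<le> (v n)\<^sup>2" by (simp add: x_def power_divide)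
    finally show ?thesis .
  qed
  have "(\<lambda>n. c n ^ n - complex_of_real (exp (- v n / 2)) ^ n) \<longlonglongrightarrow> 0"
  proof (rule Lim_null_comparison)
    show "\<forall>\<^sub>F n in sequentially. norm (c n ^ n - complex_of_real (exp (- v n / 2)) ^ n)
       \<le> real n * cmod (c n - (1 - v n / 2)) + real n * (v n)\<^sup>2"
    proof (intro always_eventually allI)
      fix n
      have "cmod (complex_of_real (exp (- v n / 2))) \<le> 1" using v0[of n] by simp
      from norm_power_diff[OF c this, of n n]
      have "norm (c n ^ n - complex_of_real (exp (- v n / 2)) ^ n) \<le> real n * cmod (c n - complex_of_real (exp (- v n / 2)))" .
      also have "cmod (c n - complex_of_real (exp (- v n / 2))) \<le>
          cmod (c n - (1 - v n / 2)) + cmod (1 - complex_of_real (v n / 2) - complex_of_real (exp (- v n / 2)))"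
        by (rule order_trans[OF _ norm_triangle_ineq]) simp
      also have "\<dots> \<le> cmod (c n - (1 - v n / 2)) + (v n)\<^sup>2" using small[of n] by simp
      finally show "norm (c n ^ n - complex_of_real (exp (- v n / 2)) ^ n)
         \<le> real n * cmod (c n - (1 - v n / 2)) + real n * (v n)\<^sup>2"
        by (simp add: mult_left_mono distrib_left)
    qed
    show "(\<lambda>n. real n * cmod (c n - (1 - v n / 2)) + real n * (v n)\<^sup>2) \<longlonglongrightarrow> 0"
      using tendsto_add[OF approx vq] by simp
  qed
  moreover have "(\<lambda>n. complex_of_real (exp (- v n / 2)) ^ n) \<longlonglongrightarrow> exp (- V / 2)"
  proof -
    have "(\<lambda>n. complex_of_real (exp (- (real n * v n) / 2))) \<longlonglongrightarrow> complex_of_real (exp (- V / 2))"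
      by (intro tendsto_intros v) auto
    moreover have "complex_of_real (exp (- (real n * v n) / 2)) = complex_of_real (exp (- v n / 2)) ^ n" for n
      by (simp add: exp_of_nat_mult[symmetric] of_real_power[symmetric] del: of_real_power)
    ultimately show ?thesis by simp
  qed
  ultimately have "(\<lambda>n. (c n ^ n - complex_of_real (exp (- v n / 2)) ^ n) + complex_of_real (exp (- v n / 2)) ^ n) \<longlonglongrightarrow> 0 + complex_of_real (exp (- V / 2))"
    by (rule tendsto_add)
  then show ?thesis by simp
qed

locale std_normal_sequence = prob_space M for M :: "'a measure" +
  fixes X :: "nat \<Rightarrow> 'a \<Rightarrow> real"
  assumes indep: "indep_vars (\<lambda>_. borel) X {1..}"
    and normal: "\<And>k. k \<ge> 1 \<Longrightarrow> distributed M lborel (X k) (\<lambda>x. ennreal (std_normal_density x))"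
begin

lemma X_measurable: "k \<ge> 1 \<Longrightarrow> X k \<in> borel_measurable M"
  using distributed_measurable[OF normal, of k] by simp

lemma distr_X: "k \<ge> 1 \<Longrightarrow> distr M borel (X k) = gauss"
  using distributed_distr_eq_density[OF normal, of k] by (metis distr_cong sets_lborel)

lemma distr_comp_X:
  assumes "k \<ge> 1" and h: "h \<in> borel_measurable borel"
  shows "distr M borel (\<lambda>\<omega>. h (X k \<omega>)) = distr gauss borel h"
proof -
  have "distr gauss borel h = distr (distr M borel (X k)) borel h" using distr_X[OF assms(1)] by simp
  also have "\<dots> = distr M borel (h \<circ> X k)" using h X_measurable[OF assms(1)] by (intro distr_distr) auto
  finally show ?thesis by (simp add: comp_def)
qed

lemma integrable_X:
  fixes h :: "real \<Rightarrow> 'b::{banach, second_countable_topology}"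
  assumes "k \<ge> 1" "h \<in> borel_measurable borel"
  shows "integrable M (\<lambda>\<omega>. h (X k \<omega>)) \<longleftrightarrow> integrable gauss h"
  using integrable_distr_eq[of "X k" M borel h] assms distr_X[of k] X_measurable by simp

lemma integral_X:
  fixes h :: "real \<Rightarrow> 'b::{banach, second_countable_topology}"
  assumes "k \<ge> 1" "h \<in> borel_measurable borel"
  shows "(\<integral>\<omega>. h (X k \<omega>) \<partial>M) = (\<integral>x. h x \<partial>gauss)"
  using integral_distr[of "X k" M borel h] assms distr_X[of k] X_measurable by simp

text \<open>
  A Lindeberg central limit theorem for triangular arrays whose rows are functions of the same
  i.i.d. sequence. The last hypothesis is the Lindeberg condition, in the form of the error term in the
  second order expansion of a characteristic function.
\<close>

lemma char_sum_tendsto: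
  fixes \<zeta> :: "nat \<Rightarrow> real \<Rightarrow> real"
  assumes meas [measurable]: "\<And>N. \<zeta> N \<in> borel_measurable borel"
    and sq: "\<And>N. integrable gauss (\<lambda>x. (\<zeta> N x)\<^sup>2)" and mean: "\<And>N. (\<integral>x. \<zeta> N x \<partial>gauss) = 0"
    and var: "(\<lambda>N. real N * (\<integral>x. (\<zeta> N x)\<^sup>2 \<partial>gauss)) \<longlonglongrightarrow> V"
    and lind: "(\<lambda>N. real N * (\<integral>x. min (6 * (\<zeta> N x)\<^sup>2) (\<bar>\<zeta> N x\<bar> ^ 3) \<partial>gauss)) \<longlonglongrightarrow> 0"
  shows "(\<lambda>N. \<integral>\<omega>. exp (\<i> * complex_of_real (\<Sum>k=1..N. \<zeta> N (X k \<omega>))) \<partial>M) \<longlonglongrightarrow> exp (- V / 2)"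
proof -
  interpret g: real_distribution gauss by (rule real_dist_normal_dist)
  define c where "c N = char (distr gauss borel (\<zeta> N)) 1" for N
  define v where "v N = (\<integral>x. (\<zeta> N x)\<^sup>2 \<partial>gauss)" for N
  have int: "integrable gauss (\<zeta> N)" for N
    by (rule g.expectation_norm_le_sqrt(1)) (use sq in auto)
  have "(\<lambda>N. c N ^ N) \<longlonglongrightarrow> exp (- V / 2)"
  proof (rule tendsto_power_of_char_approx)
    show "cmod (c N) \<le> 1" for N
    proof -
      interpret d: real_distribution "distr gauss borel (\<zeta> N)"
        by (rule g.real_distribution_distr) simp
      show ?thesis unfolding c_def by (rule d.cmod_char_le_1)
    qed
    show "0 \<le> v N" for N by (simp add: v_def)
    show "(\<lambda>N. real N * v N) \<longlonglongrightarrow> V" using var by (simp add: v_def)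
    show "(\<lambda>N. real N * cmod (c N - (1 - v N / 2))) \<longlonglongrightarrow> 0"
    proof (rule Lim_null_comparison[OF _ lind], intro always_eventually allI)
      fix N
      have "cmod (c N - (1 - 1\<^sup>2 * v N / 2)) \<le> (1\<^sup>2 / 6) * g.expectation (\<lambda>x. min (6 * (\<zeta> N x)\<^sup>2) (\<bar>1\<bar> * \<bar>\<zeta> N x\<bar> ^ 3))"
        unfolding c_def
      proof (rule g.char_approx3')
        show "g.variance (\<zeta> N) = v N" by (simp add: v_def mean)
      qed (use int sq mean in auto)
      moreover have "0 \<le> g.expectation (\<lambda>x. min (6 * (\<zeta> N x)\<^sup>2) (\<bar>\<zeta> N x\<bar> ^ 3))"
        by (intro integral_nonneg_AE) auto
      ultimately have "cmod (c N - (1 - v N / 2)) \<le> g.expectation (\<lambda>x. min (6 * (\<zeta> N x)\<^sup>2) (\<bar>\<zeta> N x\<bar> ^ 3))"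
        unfolding power_one mult_1 abs_one by linarith
      then show "norm (real N * cmod (c N - (1 - v N / 2))) \<le> real N * (\<integral>x. min (6 * (\<zeta> N x)\<^sup>2) (\<bar>\<zeta> N x\<bar> ^ 3) \<partial>gauss)"
        by (simp add: mult_left_mono)
    qed
  qed
  moreover have "(\<integral>\<omega>. exp (\<i> * complex_of_real (\<Sum>k=1..N. \<zeta> N (X k \<omega>))) \<partial>M) = c N ^ N" for N
  proof -
    define S where "S \<omega> = (\<Sum>k=1..N. \<zeta> N (X k \<omega>))" for \<omega>
    have S: "S \<in> borel_measurable M"
      unfolding S_def by (intro borel_measurable_sum measurable_compose[OF X_measurable meas]) auto
    have ind: "indep_vars (\<lambda>_. borel) (\<lambda>k \<omega>. \<zeta> N (X k \<omega>)) {1..N}"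
      by (rule indep_vars_compose2[OF indep_vars_subset[OF indep]]) auto
    have "(\<integral>\<omega>. exp (\<i> * complex_of_real (S \<omega>)) \<partial>M) = char (distr M borel S) 1"
      using S by (simp add: char_def integral_distr)
    also have "\<dots> = (\<Prod>k\<in>{1..N}. char (distr M borel (\<lambda>\<omega>. \<zeta> N (X k \<omega>))) 1)"
      unfolding S_def by (rule char_distr_sum[OF ind])
    also have "\<dots> = (\<Prod>k\<in>{1..N}. c N)"
      by (intro prod.cong refl) (simp add: c_def distr_comp_X)
    finally show ?thesis by (simp add: S_def)
  qed
  ultimately show ?thesis by simp
qed

definition centered_sum :: "nat \<Rightarrow> (real \<Rightarrow> complex) \<Rightarrow> 'a \<Rightarrow> complex" where
  "centered_sum N g \<omega> = (\<Sum>k=1..N. g (X k \<omega>) - (\<integral>x. g x \<partial>gauss))"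

lemma centered_sum_measurable:
  assumes [measurable]: "g \<in> borel_measurable borel"
  shows "centered_sum N g \<in> borel_measurable M"
  unfolding centered_sum_def
  by (intro borel_measurable_sum borel_measurable_diff measurable_compose[OF X_measurable assms]) auto

text \<open>
  Orthogonality of independent centred summands: in the double sum for the squared modulus only the
  diagonal terms have a nonzero mean.
\<close>

lemma centered_sum_second_moment:
  assumes [measurable]: "g \<in> borel_measurable borel" and sq: "integrable gauss (\<lambda>x. (cmod (g x))\<^sup>2)"
  shows "integrable M (\<lambda>\<omega>. (cmod (centered_sum N g \<omega>))\<^sup>2)"
    and "expectation (\<lambda>\<omega>. (cmod (centered_sum N g \<omega>))\<^sup>2) \<le> real N * (\<integral>x. (cmod (g x))\<^sup>2 \<partial>gauss)"
proof -
  interpret g: real_distribution gauss by (rule real_dist_normal_dist)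
  define m where "m = (\<integral>x. g x \<partial>gauss)"
  define h where "h x = g x - m" for x
  have [measurable]: "h \<in> borel_measurable borel" unfolding h_def by measurable
  have hcnj: "(\<lambda>x. cnj (h x)) \<in> borel_measurable borel"
    by (rule measurable_compose[OF _ borel_measurable_continuous_onI]) (auto intro: continuous_intros)
  have gi: "integrable gauss g" by (rule g.expectation_norm_le_sqrt(1)[OF _ sq]) simp
  have hi: "integrable gauss h" unfolding h_def using gi by simp
  have h0: "(\<integral>x. h x \<partial>gauss) = 0" unfolding h_def using gi g.prob_space by (simp add: m_def)
  define r where "r x = Re (cnj m * g x)" for x
  have hsq: "(\<lambda>x. (cmod (h x))\<^sup>2) = (\<lambda>x. ((cmod (g x))\<^sup>2 - 2 * r x) + (cmod m)\<^sup>2)"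
    unfolding h_def r_def cmod_power2 by (rule ext) (simp add: power2_eq_square algebra_simps)
  have ri: "integrable gauss r" unfolding r_def using gi by (intro integrable_Re) auto
  have r: "(\<integral>x. r x \<partial>gauss) = (cmod m)\<^sup>2"
  proof -
    have "(\<integral>x. r x \<partial>gauss) = Re (\<integral>x. cnj m * g x \<partial>gauss)"
      unfolding r_def using gi by (intro integral_Re) auto
    also have "\<dots> = Re (cnj m * m)" using gi by (simp add: m_def)
    also have "\<dots> = (cmod m)\<^sup>2" unfolding cmod_power2 by (simp add: power2_eq_square)
    finally show ?thesis .
  qed
  have ri2: "integrable gauss (\<lambda>x. (cmod (g x))\<^sup>2 - 2 * r x)" using sq ri by auto
  have hsqi: "integrable gauss (\<lambda>x. (cmod (h x))\<^sup>2)"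
    unfolding hsq by (rule Bochner_Integration.integrable_add[OF ri2]) simp
  have hvar: "(\<integral>x. (cmod (h x))\<^sup>2 \<partial>gauss) = (\<integral>x. (cmod (g x))\<^sup>2 \<partial>gauss) - (cmod m)\<^sup>2"
  proof -
    have "(\<integral>x. ((cmod (g x))\<^sup>2 - 2 * r x) + (cmod m)\<^sup>2 \<partial>gauss) =
      (\<integral>x. (cmod (g x))\<^sup>2 - 2 * r x \<partial>gauss) + (\<integral>x. (cmod m)\<^sup>2 \<partial>gauss)"
      by (rule Bochner_Integration.integral_add[OF ri2]) simp
    also have "(\<integral>x. (cmod (g x))\<^sup>2 - 2 * r x \<partial>gauss) = (\<integral>x. (cmod (g x))\<^sup>2 \<partial>gauss) - 2 * (\<integral>x. r x \<partial>gauss)"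
      using sq ri by simp
    finally show ?thesis unfolding hsq r using g.prob_space by simp
  qed
  define P where "P k l \<omega> = h (X k \<omega>) * cnj (h (X l \<omega>))" for k l \<omega>
  have cross: "integrable M (P k l) \<and> (\<integral>\<omega>. P k l \<omega> \<partial>M) = 0" if kl: "k \<in> {1..N}" "l \<in> {1..N}" "k \<noteq> l" for k l
  proof -
    define Y where "Y i x = (if i = k then h x else cnj (h x))" for i :: nat and x
    have [measurable]: "Y i \<in> borel_measurable borel" for i
      unfolding Y_def by (cases "i = k") (auto simp: hcnj)
    have ind: "indep_vars (\<lambda>_. borel) (\<lambda>i \<omega>. Y i (X i \<omega>)) {k, l}"
      by (rule indep_vars_compose2[OF indep_vars_subset[OF indep]]) (use kl in auto)
    have "integrable gauss (Y i)" for i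
      unfolding Y_def using hi integrable_bounded_linear[OF bounded_linear_cnj hi] by (cases "i = k") auto
    then have Yi: "integrable M (\<lambda>\<omega>. Y i (X i \<omega>))" if "i \<in> {k, l}" for i
      using that kl by (subst integrable_X) auto
    have eq: "P k l = (\<lambda>\<omega>. \<Prod>i\<in>{k, l}. Y i (X i \<omega>))"
      using kl by (auto simp: P_def Y_def fun_eq_iff)
    have "Y k = h" by (simp add: Y_def fun_eq_iff)
    then have "(\<integral>\<omega>. Y k (X k \<omega>) \<partial>M) = 0"
      using kl h0 by (subst integral_X) auto
    then show ?thesis
      unfolding eq using indep_vars_integrable[OF _ ind Yi] indep_vars_lebesgue_integral[OF _ ind Yi] kl
      by auto
  qed
  have diag: "integrable M (P k k) \<and> (\<integral>\<omega>. P k k \<omega> \<partial>M) = of_real (\<integral>x. (cmod (h x))\<^sup>2 \<partial>gauss)" if "k \<in> {1..N}" for k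
  proof -
    have eq: "P k k = (\<lambda>\<omega>. complex_of_real ((cmod (h (X k \<omega>)))\<^sup>2))"
      by (simp only: P_def fun_eq_iff complex_norm_square simp_thms)
    have k: "k \<ge> 1" using that by simp
    have m: "(\<lambda>x. (cmod (h x))\<^sup>2) \<in> borel_measurable borel" by measurable
    show ?thesis unfolding eq integral_complex_of_real complex_of_real_integrable_eq
      unfolding integrable_X[OF k m] integral_X[OF k m] using hsqi by simp
  qed
  have Pint: "integrable M (P k l)" if "k \<in> {1..N}" "l \<in> {1..N}" for k l
    using cross[OF that] diag[OF that(1)] by (cases "k = l") auto
  have sum: "complex_of_real ((cmod (centered_sum N g \<omega>))\<^sup>2) = (\<Sum>k=1..N. \<Sum>l=1..N. P k l \<omega>)" for \<omega>
    unfolding complex_norm_square centered_sum_def P_def m_def[symmetric] h_def[symmetric] cnj_sum sum_product ..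
  have "complex_integrable M (\<lambda>\<omega>. complex_of_real ((cmod (centered_sum N g \<omega>))\<^sup>2))"
    unfolding sum by (intro Bochner_Integration.integrable_sum Pint)
  then show int: "integrable M (\<lambda>\<omega>. (cmod (centered_sum N g \<omega>))\<^sup>2)"
    using complex_of_real_integrable_eq by blast
  have "complex_of_real (expectation (\<lambda>\<omega>. (cmod (centered_sum N g \<omega>))\<^sup>2)) = (\<integral>\<omega>. (\<Sum>k=1..N. \<Sum>l=1..N. P k l \<omega>) \<partial>M)"
    unfolding sum[symmetric] by (rule integral_complex_of_real[symmetric])
  also have "\<dots> = (\<Sum>k=1..N. \<Sum>l=1..N. \<integral>\<omega>. P k l \<omega> \<partial>M)"
  proof -
    have "(\<integral>\<omega>. (\<Sum>k=1..N. \<Sum>l=1..N. P k l \<omega>) \<partial>M) = (\<Sum>k=1..N. \<integral>\<omega>. (\<Sum>l=1..N. P k l \<omega>) \<partial>M)"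
      by (intro Bochner_Integration.integral_sum Bochner_Integration.integrable_sum Pint)
    also have "\<dots> = (\<Sum>k=1..N. \<Sum>l=1..N. \<integral>\<omega>. P k l \<omega> \<partial>M)"
      by (intro sum.cong refl Bochner_Integration.integral_sum Pint)
    finally show ?thesis .
  qed
  also have "\<dots> = (\<Sum>k=1..N. \<Sum>l=1..N. if l = k then of_real (\<integral>x. (cmod (h x))\<^sup>2 \<partial>gauss) else 0)"
    by (intro sum.cong refl) (use cross diag in auto)
  also have "\<dots> = complex_of_real (real N * (\<integral>x. (cmod (h x))\<^sup>2 \<partial>gauss))"
    by (simp add: sum.delta)
  finally have "expectation (\<lambda>\<omega>. (cmod (centered_sum N g \<omega>))\<^sup>2) = real N * (\<integral>x. (cmod (h x))\<^sup>2 \<partial>gauss)"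
    by (simp only: of_real_eq_iff)
  then show "expectation (\<lambda>\<omega>. (cmod (centered_sum N g \<omega>))\<^sup>2) \<le> real N * (\<integral>x. (cmod (g x))\<^sup>2 \<partial>gauss)"
    unfolding hvar by (simp add: mult_left_mono)
qed

end

section \<open>Expansion of the partition function near the unit circle\<close>

lemma power_power2_commute: "((a::'a::comm_monoid_mult) ^ j)\<^sup>2 = (a\<^sup>2) ^ j"
  by (simp add: mult.commute flip: power_mult)

text \<open>
  The square root of the \<open>2 * j\<close>-th moment of a normal variable of variance \<open>1 / n\<close> grows like
  \<open>sqrt (fact j)\<close>, which the factor \<open>1 / fact j\<close> of the exponential series beats. This yields a
  geometric bound with ratio of order \<open>1 / sqrt n\<close>.
\<close>

lemma moment_weight_le_geometric: "(r::real) \<ge> 0 \<Longrightarrow> n > 0 \<Longrightarrow>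
  r ^ j / fact j * sqrt (fact (2 * j) / (2 ^ j * fact j * n ^ j)) \<le> (r * sqrt (2 / n)) ^ j"
proof -
  assume r: "r \<ge> 0" and n: "n > 0"
  have "fact (2 * j) / (2 ^ j * fact j * n ^ j) = fact (2 * j) / (2 ^ j * fact j) / n ^ j" by simp
  also have "\<dots> \<le> 2 ^ j * fact j / n ^ j"
    using n even_moment_le[of j] by (intro divide_right_mono) auto
  also have "\<dots> = fact j * (2 / n) ^ j" by (simp add: power_divide)
  also have "\<dots> \<le> (fact j)\<^sup>2 * (2 / n) ^ j"
    using n fact_ge_1[of j, where 'a=real] by (intro mult_right_mono) (auto simp: power2_eq_square)
  also have "\<dots> = (fact j * sqrt (2 / n) ^ j)\<^sup>2"
  proof -
    have "(sqrt (2 / n) ^ j)\<^sup>2 = ((sqrt (2 / n))\<^sup>2) ^ j" by (rule power_power2_commute)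
    also have "\<dots> = (2 / n) ^ j" using n by simp
    finally show ?thesis by (simp only: power_mult_distrib)
  qed
  finally have "sqrt (fact (2 * j) / (2 ^ j * fact j * n ^ j)) \<le> fact j * sqrt (2 / n) ^ j"
    using n by (intro real_le_lsqrt) auto
  then have "r ^ j / fact j * sqrt (fact (2 * j) / (2 ^ j * fact j * n ^ j)) \<le> r ^ j / fact j * (fact j * sqrt (2 / n) ^ j)"
    using r by (intro mult_left_mono) auto
  also have "\<dots> = (r * sqrt (2 / n)) ^ j" by (simp add: power_mult_distrib)
  finally show ?thesis .
qed

lemma norm_exp_minus_1_le: "norm (exp w - 1) \<le> exp (norm w) - 1" for w :: complex
proof -
  have 1: "(\<lambda>j. w ^ Suc j /\<^sub>R fact (Suc j)) sums (exp w - 1)"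
    using exp_converges[of w] by (subst sums_Suc_iff) simp
  have 2: "(\<lambda>j. norm w ^ Suc j /\<^sub>R fact (Suc j)) sums (exp (norm w) - 1)"
    using exp_converges[of "norm w"] by (subst sums_Suc_iff) simp
  have "norm (\<Sum>j. w ^ Suc j /\<^sub>R fact (Suc j)) \<le> (\<Sum>j. norm w ^ Suc j /\<^sub>R fact (Suc j))"
    by (rule norm_suminf_le[OF _ sums_summable[OF 2]]) (simp add: norm_mult norm_power del: power_Suc fact_Suc)
  then show ?thesis by (simp only: sums_unique[OF 1, symmetric] sums_unique[OF 2, symmetric])
qed

text \<open>
  The parameter \<open>\<sigma> + \<i> * \<tau>\<close> lies on the arcs of the unit circle where \<open>\<sigma>\<^sup>2 < 1 / 2\<close>.
  With \<open>n = energy N = ln N\<close>, the square of \<open>scale N\<close> is, for \<open>N \<ge> 1\<close>, equal to \<open>N\<close> times the second absolute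
  moment of \<open>base N\<close>, the term of the partition function at \<open>\<beta>0\<close>. That moment is carried by
  values of \<open>x\<close> near \<open>2 * \<sigma> * sqrt n\<close>, and \<open>tilt N x\<close> measures the deviation from this point.
  A shift of the parameter multiplies \<open>base N\<close> by \<open>exp (z * tilt N x)\<close> up to a deterministic factor;
  expanding this exponential in powers of \<open>z\<close> gives the random power series with coefficients \<open>coeff N j / fact j\<close>.
  Its constant term carries the limit and \<open>remainder r N\<close> dominates the rest on the disc of radius \<open>r\<close>.
\<close>

locale critical_circle = std_normal_sequence +
  fixes \<sigma> \<tau> :: real
  assumes circle: "\<sigma>\<^sup>2 + \<tau>\<^sup>2 = 1" and small: "\<sigma>\<^sup>2 < 1 / 2"
begin

definition \<beta>0 :: complex where "\<beta>0 = Complex \<sigma> \<tau>"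
definition energy :: "nat \<Rightarrow> real" where "energy N = ln (real N)"
definition scale :: "nat \<Rightarrow> real" where "scale N = exp (energy N * (1 / 2 + \<sigma>\<^sup>2))"
definition tilt :: "nat \<Rightarrow> real \<Rightarrow> real" where "tilt N x = x / sqrt (energy N) - 2 * \<sigma>"
definition base :: "nat \<Rightarrow> real \<Rightarrow> complex" where "base N x = exp (\<beta>0 * complex_of_real (sqrt (energy N) * x))"
definition term_coeff :: "nat \<Rightarrow> nat \<Rightarrow> real \<Rightarrow> complex" where
  "term_coeff N j x = base N x * complex_of_real (tilt N x ^ j)"
definition term_fun :: "nat \<Rightarrow> complex \<Rightarrow> real \<Rightarrow> complex" where
  "term_fun N z x = base N x * exp (z * complex_of_real (tilt N x))"
definition coeff :: "nat \<Rightarrow> nat \<Rightarrow> 'a \<Rightarrow> complex" where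
  "coeff N j \<omega> = centered_sum N (term_coeff N j) \<omega> / complex_of_real (scale N)"
definition remainder :: "real \<Rightarrow> nat \<Rightarrow> 'a \<Rightarrow> real" where
  "remainder r N \<omega> = (\<Sum>j. r ^ Suc j / fact (Suc j) * cmod (coeff N (Suc j) \<omega>))"

lemma scale_pos: "scale N > 0" by (simp add: scale_def)

lemma term_coeff_measurable: "term_coeff N j \<in> borel_measurable borel"
  unfolding term_coeff_def base_def tilt_def
  by measurable

lemma coeff_measurable: "coeff N j \<in> borel_measurable M"
  unfolding coeff_def using centered_sum_measurable[OF term_coeff_measurable] by measurable

lemma cmod_base: "cmod (base N x) = exp (\<sigma> * sqrt (energy N) * x)"
  by (simp add: base_def \<beta>0_def)

lemma exp_energy: "N \<ge> 1 \<Longrightarrow> exp (energy N) = real N"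
  by (simp add: energy_def)

lemma scale_sq: "N \<ge> 1 \<Longrightarrow> (scale N)\<^sup>2 = real N * exp (2 * \<sigma>\<^sup>2 * energy N)"
  unfolding scale_def exp_energy[symmetric]
  unfolding exp_double[symmetric] exp_add[symmetric] by (simp add: algebra_simps)

lemma term_coeff_sq:
  assumes "N \<ge> 2"
  shows "has_bochner_integral gauss (\<lambda>x. (cmod (term_coeff N j x))\<^sup>2)
    (exp (2 * \<sigma>\<^sup>2 * energy N) * (fact (2 * j) / (2 ^ j * fact j * energy N ^ j)))"
proof -
  have "energy N > 0" using assms by (simp add: energy_def)
  note moment = gauss_tilted_even_moment[OF this, of \<sigma> j]
  have "(cmod (term_coeff N j x))\<^sup>2 = exp (2 * \<sigma> * sqrt (energy N) * x) * (x / sqrt (energy N) - 2 * \<sigma>) ^ (2 * j)" for x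
  proof -
    have "(cmod (term_coeff N j x))\<^sup>2 = (exp (\<sigma> * sqrt (energy N) * x))\<^sup>2 * (\<bar>tilt N x\<bar> ^ j)\<^sup>2"
      by (simp add: term_coeff_def norm_mult power_mult_distrib cmod_base norm_power)
    also have "(\<bar>tilt N x\<bar> ^ j)\<^sup>2 = tilt N x ^ (2 * j)" unfolding power_power2_commute by (simp add: power_mult)
    also have "(exp (\<sigma> * sqrt (energy N) * x))\<^sup>2 = exp (2 * \<sigma> * sqrt (energy N) * x)"
      unfolding exp_double[symmetric] by (simp add: mult.assoc)
    finally show ?thesis by (simp add: tilt_def)
  qed
  then show ?thesis using moment by simp
qed

text \<open>
  The normalisation is such that \<open>coeff N j\<close> has second moment at most \<open>\<kappa>\<^sup>2\<close>, which is of
  order \<open>energy N ^ (- j)\<close>: the coefficients of positive index are asymptotically negligible.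
\<close>

lemma coeff_moments:
  fixes j :: nat
  assumes N: "N \<ge> 2"
  defines "\<kappa> \<equiv> sqrt (fact (2 * j) / (2 ^ j * fact j * energy N ^ j))"
  shows "integrable gauss (term_coeff N j)"
    and "(\<integral>x. cmod (term_coeff N j x) \<partial>gauss) \<le> exp (\<sigma>\<^sup>2 * energy N) * \<kappa>"
    and "integrable M (coeff N j)"
    and "expectation (\<lambda>\<omega>. cmod (coeff N j \<omega>)) \<le> \<kappa>"
proof -
  interpret g: real_distribution gauss by (rule real_dist_normal_dist)
  have n: "energy N > 0" using N by (simp add: energy_def)
  have \<kappa>2: "\<kappa>\<^sup>2 = fact (2 * j) / (2 ^ j * fact j * energy N ^ j)" and \<kappa>0: "\<kappa> \<ge> 0" using n by (simp_all add: \<kappa>_def)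
  from term_coeff_sq[OF N, of j]
  have i: "integrable gauss (\<lambda>x. (cmod (term_coeff N j x))\<^sup>2)"
    and v: "(\<integral>x. (cmod (term_coeff N j x))\<^sup>2 \<partial>gauss) = exp (2 * \<sigma>\<^sup>2 * energy N) * \<kappa>\<^sup>2"
    unfolding \<kappa>2 by (auto simp: has_bochner_integral_iff)
  show "integrable gauss (term_coeff N j)"
    by (rule g.expectation_norm_le_sqrt(1)[OF _ i]) (simp add: term_coeff_measurable)
  have "(\<integral>x. cmod (term_coeff N j x) \<partial>gauss) \<le> sqrt (exp (2 * \<sigma>\<^sup>2 * energy N) * \<kappa>\<^sup>2)"
    unfolding v[symmetric] by (rule g.expectation_norm_le_sqrt(2)[OF _ i]) (simp add: term_coeff_measurable)
  also have "exp (2 * \<sigma>\<^sup>2 * energy N) = (exp (\<sigma>\<^sup>2 * energy N))\<^sup>2"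
    by (simp add: exp_double[symmetric] mult.assoc)
  finally show "(\<integral>x. cmod (term_coeff N j x) \<partial>gauss) \<le> exp (\<sigma>\<^sup>2 * energy N) * \<kappa>"
    using \<kappa>0 by (simp add: real_sqrt_mult)
  have eq: "(\<lambda>\<omega>. (cmod (coeff N j \<omega>))\<^sup>2) = (\<lambda>\<omega>. (cmod (centered_sum N (term_coeff N j) \<omega>))\<^sup>2 / (scale N)\<^sup>2)"
    using scale_pos[of N] by (simp add: coeff_def norm_divide power_divide)
  note cs = centered_sum_second_moment[OF term_coeff_measurable i, of N]
  have i2: "integrable M (\<lambda>\<omega>. (cmod (coeff N j \<omega>))\<^sup>2)" unfolding eq using cs(1) by simp
  have "expectation (\<lambda>\<omega>. (cmod (coeff N j \<omega>))\<^sup>2) \<le> real N * (exp (2 * \<sigma>\<^sup>2 * energy N) * \<kappa>\<^sup>2) / (scale N)\<^sup>2"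
    unfolding eq using cs(2) v scale_pos[of N] by (simp add: divide_right_mono)
  also have "\<dots> = \<kappa>\<^sup>2" using N by (simp add: scale_sq)
  finally have e2: "expectation (\<lambda>\<omega>. (cmod (coeff N j \<omega>))\<^sup>2) \<le> \<kappa>\<^sup>2" .
  show "integrable M (coeff N j)" by (rule expectation_norm_le_sqrt(1)[OF coeff_measurable i2])
  have "expectation (\<lambda>\<omega>. cmod (coeff N j \<omega>)) \<le> sqrt (expectation (\<lambda>\<omega>. (cmod (coeff N j \<omega>))\<^sup>2))"
    by (rule expectation_norm_le_sqrt(2)[OF coeff_measurable i2])
  also have "\<dots> \<le> \<kappa>" using e2 \<kappa>0 by (metis real_sqrt_le_mono real_sqrt_abs abs_of_nonneg)
  finally show "expectation (\<lambda>\<omega>. cmod (coeff N j \<omega>)) \<le> \<kappa>" .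
qed

lemma summable_term_coeff:
  assumes "r \<ge> 0"
  shows "summable (\<lambda>j. r ^ j / fact j * cmod (term_coeff N j x))"
proof -
  have "summable (\<lambda>j. cmod (base N x) * (inverse (fact j) * (r * \<bar>tilt N x\<bar>) ^ j))"
    by (intro summable_mult summable_exp)
  moreover have "cmod (base N x) * (inverse (fact j) * (r * \<bar>tilt N x\<bar>) ^ j) = r ^ j / fact j * cmod (term_coeff N j x)" for j
    by (simp add: term_coeff_def norm_mult norm_power power_mult_distrib field_simps)
  ultimately show ?thesis by simp
qed

lemma term_coeff_sums: "(\<lambda>j. z ^ j / fact j * term_coeff N j x) sums term_fun N z x"
proof -
  have "(\<lambda>j. base N x * ((z * complex_of_real (tilt N x)) ^ j /\<^sub>R fact j)) sums term_fun N z x"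
    unfolding term_fun_def by (intro sums_mult exp_converges)
  moreover have "base N x * ((z * complex_of_real (tilt N x)) ^ j /\<^sub>R fact j) = z ^ j / fact j * term_coeff N j x" for j
    by (simp add: term_coeff_def power_mult_distrib scaleR_conv_of_real field_simps)
  ultimately show ?thesis by simp
qed

lemma summable_integral_term_coeff:
  assumes N: "N \<ge> 2" and r: "0 \<le> r" "r * sqrt (2 / energy N) < 1"
  shows "summable (\<lambda>j. r ^ j / fact j * (\<integral>x. cmod (term_coeff N j x) \<partial>gauss))"
proof (rule summable_comparison_test')
  have n: "energy N > 0" using N by (simp add: energy_def)
  show "summable (\<lambda>j. exp (\<sigma>\<^sup>2 * energy N) * (r * sqrt (2 / energy N)) ^ j)"
    using r n by (intro summable_mult summable_geometric) (simp add: abs_mult)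
  fix j :: nat
  define \<kappa> where "\<kappa> = sqrt (fact (2 * j) / (2 ^ j * fact j * energy N ^ j))"
  have "0 \<le> (\<integral>x. cmod (term_coeff N j x) \<partial>gauss)" by simp
  moreover have "r ^ j / fact j * (\<integral>x. cmod (term_coeff N j x) \<partial>gauss) \<le> r ^ j / fact j * (exp (\<sigma>\<^sup>2 * energy N) * \<kappa>)"
    unfolding \<kappa>_def using r by (intro mult_left_mono coeff_moments(2)[OF N]) auto
  moreover have "exp (\<sigma>\<^sup>2 * energy N) * (r ^ j / fact j * \<kappa>) \<le> exp (\<sigma>\<^sup>2 * energy N) * (r * sqrt (2 / energy N)) ^ j"
    unfolding \<kappa>_def using r n by (intro mult_left_mono moment_weight_le_geometric) auto
  ultimately show "norm (r ^ j / fact j * (\<integral>x. cmod (term_coeff N j x) \<partial>gauss)) \<le> exp (\<sigma>\<^sup>2 * energy N) * (r * sqrt (2 / energy N)) ^ j"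
    using r by (simp add: mult.left_commute abs_mult)
qed

lemma integral_term_coeff_sums:
  assumes N: "N \<ge> 2" and r: "cmod z \<le> r" "r * sqrt (2 / energy N) < 1"
  shows "(\<lambda>j. z ^ j / fact j * (\<integral>x. term_coeff N j x \<partial>gauss)) sums (\<integral>x. term_fun N z x \<partial>gauss)"
proof -
  have r0: "cmod z * sqrt (2 / energy N) < 1"
    
  proof -
    have "0 \<le> sqrt (2 / energy N)" using N by (simp add: energy_def)
    from mult_right_mono[OF r(1) this] show ?thesis using r(2) by linarith
  qed
  have "(\<lambda>j. \<integral>x. z ^ j / fact j * term_coeff N j x \<partial>gauss) sums (\<integral>x. (\<Sum>j. z ^ j / fact j * term_coeff N j x) \<partial>gauss)"
  proof (rule sums_integral)
    show "integrable gauss (\<lambda>x. z ^ j / fact j * term_coeff N j x)" for j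
      using coeff_moments(1)[OF N] by simp
    show "AE x in gauss. summable (\<lambda>j. norm (z ^ j / fact j * term_coeff N j x))"
      using summable_term_coeff[of "cmod z" N] by (simp add: norm_mult norm_divide norm_power)
    show "summable (\<lambda>j. \<integral>x. norm (z ^ j / fact j * term_coeff N j x) \<partial>gauss)"
      using summable_integral_term_coeff[OF N _ r0] by (simp add: norm_mult norm_divide norm_power)
  qed
  then show ?thesis
    using sums_unique[OF term_coeff_sums[where z=z and N=N], symmetric] by simp
qed

lemma coeff_sums:
  assumes N: "N \<ge> 2" and r: "cmod z \<le> r" "r * sqrt (2 / energy N) < 1"
  shows "(\<lambda>j. z ^ j / fact j * coeff N j \<omega>) sums (centered_sum N (term_fun N z) \<omega> / complex_of_real (scale N))"
proof -
  have "(\<lambda>j. (\<Sum>k=1..N. z ^ j / fact j * term_coeff N j (X k \<omega>) - z ^ j / fact j * (\<integral>x. term_coeff N j x \<partial>gauss)) / complex_of_real (scale N))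
    sums (centered_sum N (term_fun N z) \<omega> / complex_of_real (scale N))"
    unfolding centered_sum_def
    by (intro sums_divide sums_sum sums_diff term_coeff_sums integral_term_coeff_sums[OF N r])
  moreover have "(\<Sum>k=1..N. z ^ j / fact j * term_coeff N j (X k \<omega>) - z ^ j / fact j * (\<integral>x. term_coeff N j x \<partial>gauss)) / complex_of_real (scale N)
      = z ^ j / fact j * coeff N j \<omega>" for j
    unfolding coeff_def centered_sum_def by (simp add: sum_distrib_left right_diff_distrib)
  ultimately show ?thesis by simp
qed

lemma summable_coeff:
  assumes N: "N \<ge> 2" and r: "0 \<le> r" "r * sqrt (2 / energy N) < 1"
  shows "summable (\<lambda>j. r ^ j / fact j * cmod (coeff N j \<omega>))"
proof (rule summable_comparison_test')
  show "summable (\<lambda>j. (\<Sum>k=1..N. r ^ j / fact j * cmod (term_coeff N j (X k \<omega>)) + r ^ j / fact j * (\<integral>x. cmod (term_coeff N j x) \<partial>gauss)) / scale N)"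
    by (intro summable_divide summable_sum summable_add summable_term_coeff summable_integral_term_coeff N r)
  fix j :: nat
  have "cmod (centered_sum N (term_coeff N j) \<omega>) \<le> (\<Sum>k=1..N. cmod (term_coeff N j (X k \<omega>)) + (\<integral>x. cmod (term_coeff N j x) \<partial>gauss))"
    unfolding centered_sum_def
    by (rule order_trans[OF norm_sum sum_mono])
       (rule order_trans[OF norm_triangle_ineq4 add_left_mono[OF integral_norm_bound]])
  then have "r ^ j / fact j * cmod (coeff N j \<omega>) \<le> r ^ j / fact j * ((\<Sum>k=1..N. cmod (term_coeff N j (X k \<omega>)) + (\<integral>x. cmod (term_coeff N j x) \<partial>gauss)) / scale N)"
    using r scale_pos[of N] by (intro mult_left_mono) (auto simp: coeff_def norm_divide divide_right_mono)
  also have "\<dots> = (\<Sum>k=1..N. r ^ j / fact j * cmod (term_coeff N j (X k \<omega>)) + r ^ j / fact j * (\<integral>x. cmod (term_coeff N j x) \<partial>gauss)) / scale N"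
    by (simp add: sum_distrib_left distrib_left)
  finally show "norm (r ^ j / fact j * cmod (coeff N j \<omega>)) \<le> (\<Sum>k=1..N. r ^ j / fact j * cmod (term_coeff N j (X k \<omega>)) + r ^ j / fact j * (\<integral>x. cmod (term_coeff N j x) \<partial>gauss)) / scale N"
    using r by (simp add: abs_mult)
qed

text \<open>
  Working with the power series gives a bound that is uniform in \<open>z\<close> on a disc, for each sample
  \<open>\<omega>\<close>. Second moments for single values of \<open>z\<close> would not suffice for controlling zeros.
\<close>

lemma remainder_bound:
  assumes N: "N \<ge> 2" and r: "0 \<le> r" "cmod z \<le> r" "r * sqrt (2 / energy N) < 1"
  shows "cmod (centered_sum N (term_fun N z) \<omega> / complex_of_real (scale N) - coeff N 0 \<omega>) \<le> remainder r N \<omega>"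
proof -
  have "(\<lambda>j. z ^ Suc j / fact (Suc j) * coeff N (Suc j) \<omega>) sums (centered_sum N (term_fun N z) \<omega> / complex_of_real (scale N) - coeff N 0 \<omega>)"
    using coeff_sums[OF N r(2,3), of \<omega>] by (subst sums_Suc_iff) simp
  then have "centered_sum N (term_fun N z) \<omega> / complex_of_real (scale N) - coeff N 0 \<omega> = (\<Sum>j. z ^ Suc j / fact (Suc j) * coeff N (Suc j) \<omega>)"
    by (rule sums_unique)
  also have "cmod \<dots> \<le> remainder r N \<omega>"
    unfolding remainder_def
  proof (rule norm_suminf_le)
    show "summable (\<lambda>j. r ^ Suc j / fact (Suc j) * cmod (coeff N (Suc j) \<omega>))"
      using summable_coeff[OF N r(1,3)] by (subst summable_Suc_iff)
    show "norm (z ^ Suc j / fact (Suc j) * coeff N (Suc j) \<omega>) \<le> r ^ Suc j / fact (Suc j) * cmod (coeff N (Suc j) \<omega>)" for j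
      unfolding norm_mult norm_divide norm_power norm_fact
      using r by (intro mult_right_mono divide_mono power_mono) auto
  qed
  finally show ?thesis .
qed

lemma remainder_expectation:
  fixes r :: real and N :: nat
  assumes N: "N \<ge> 2" and r: "0 \<le> r" "r * sqrt (2 / energy N) < 1"
  defines "q \<equiv> r * sqrt (2 / energy N)"
  shows "integrable M (remainder r N)" "expectation (remainder r N) \<le> q / (1 - q)"
    "0 \<le> remainder r N \<omega>"
proof -
  have n: "energy N > 0" using N by (simp add: energy_def)
  have q: "0 \<le> q" "q < 1" using r n by (auto simp: q_def)
  define F where "F j \<omega> = r ^ Suc j / fact (Suc j) * cmod (coeff N (Suc j) \<omega>)" for j \<omega>
  have F0: "F j \<omega> \<ge> 0" for j \<omega> using r by (simp add: F_def)
  have int: "integrable M (F j)" for j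
    unfolding F_def using coeff_moments(3)[OF N, of "Suc j"] by simp
  have sm: "summable (\<lambda>j. F j \<omega>)" for \<omega>
    unfolding F_def using summable_coeff[OF N r] by (subst summable_Suc_iff)
  have le: "expectation (F j) \<le> q ^ Suc j" for j
  proof -
    have "expectation (F j) = r ^ Suc j / fact (Suc j) * expectation (\<lambda>\<omega>. cmod (coeff N (Suc j) \<omega>))"
      unfolding F_def by (rule integral_mult_right_zero)
    also have "\<dots> \<le> r ^ Suc j / fact (Suc j) * sqrt (fact (2 * Suc j) / (2 ^ Suc j * fact (Suc j) * energy N ^ Suc j))"
      using r by (intro mult_left_mono coeff_moments(4)[OF N]) auto
    also have "\<dots> \<le> q ^ Suc j" unfolding q_def using r n by (intro moment_weight_le_geometric)
    finally show ?thesis .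
  qed
  have geo: "(\<lambda>j. q ^ Suc j) sums (q / (1 - q))"
    using sums_mult[OF geometric_sums[of q], of q] q by simp
  have sE: "summable (\<lambda>j. expectation (F j))"
    using le F0 by (intro summable_comparison_test'[OF sums_summable[OF geo]]) simp
  have sn: "summable (\<lambda>j. expectation (\<lambda>\<omega>. norm (F j \<omega>)))" using sE F0 by simp
  have ae: "AE \<omega> in M. summable (\<lambda>j. norm (F j \<omega>))" using sm F0 by simp
  have eq: "remainder r N = (\<lambda>\<omega>. \<Sum>j. F j \<omega>)" by (simp add: remainder_def F_def fun_eq_iff)
  show "integrable M (remainder r N)" unfolding eq by (rule integrable_suminf[OF int ae sn])
  have "expectation (remainder r N) = (\<Sum>j. expectation (F j))"
    unfolding eq by (rule integral_suminf[OF int ae sn])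
  also have "\<dots> \<le> (\<Sum>j. q ^ Suc j)" by (rule suminf_le[OF le sE sums_summable[OF geo]])
  also have "\<dots> = q / (1 - q)" by (rule sums_unique[OF geo, symmetric])
  finally show "expectation (remainder r N) \<le> q / (1 - q)" .
  show "0 \<le> remainder r N \<omega>" unfolding eq by (rule suminf_nonneg[OF sm F0])
qed


lemma \<beta>0_square: "\<beta>0\<^sup>2 = complex_of_real (\<sigma>\<^sup>2 - \<tau>\<^sup>2) + \<i> * complex_of_real (2 * \<sigma> * \<tau>)"
  by (simp add: \<beta>0_def complex_eq_iff power2_eq_square)

lemma cmod_\<beta>0: "cmod \<beta>0 = 1"
  using circle by (simp add: \<beta>0_def cmod_def)

lemma \<tau>_sq: "\<tau>\<^sup>2 = 1 - \<sigma>\<^sup>2" using circle by simp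

lemma energy_at_top: "filterlim energy at_top sequentially"
  unfolding energy_def using filterlim_compose[OF ln_at_top filterlim_real_sequentially] .

lemma exp_energy_tendsto_0:
  assumes "\<kappa> < 0"
  shows "(\<lambda>N. exp (energy N * \<kappa>)) \<longlonglongrightarrow> 0"
proof -
  have "filterlim (\<lambda>N. \<kappa> * energy N) at_bot sequentially"
    using filterlim_tendsto_neg_mult_at_bot[OF tendsto_const assms energy_at_top] .
  from filterlim_compose[OF exp_at_bot this] show ?thesis by (simp add: mult.commute)
qed

lemma term_fun_eq:
  "term_fun N z x = exp ((\<beta>0 * complex_of_real (sqrt (energy N)) + z / complex_of_real (sqrt (energy N))) * complex_of_real x)
     * exp (- (2 * complex_of_real \<sigma> * z))"
  unfolding term_fun_def base_def tilt_def exp_add[symmetric]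
  by (simp add: algebra_simps)

text \<open>
  Up to a phase the mean has no exponential growth in \<open>energy N\<close>. This is where
  \<open>\<sigma>\<^sup>2 + \<tau>\<^sup>2 = 1\<close> enters: it says that mean and fluctuations have the same exponential order.
\<close>

lemma scaled_mean_term_fun:
  assumes N: "N \<ge> 2"
  shows "of_nat N * (\<integral>x. term_fun N z x \<partial>gauss) / complex_of_real (scale N) =
    exp (\<i> * complex_of_real (energy N * \<sigma> * \<tau>) + z * (\<beta>0 - 2 * complex_of_real \<sigma>) + z\<^sup>2 / complex_of_real (2 * energy N))"
proof -
  define n where "n = energy N"
  have n: "n > 0" using N by (simp add: energy_def n_def)
  define b where "b = \<beta>0 * complex_of_real (sqrt n) + z / complex_of_real (sqrt n)"
  have sq: "complex_of_real (sqrt n) * complex_of_real (sqrt n) = complex_of_real n"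
    using n by (simp flip: of_real_mult)
  have snz: "complex_of_real (sqrt n) \<noteq> 0" using n by simp
  have b2: "b\<^sup>2 = \<beta>0\<^sup>2 * complex_of_real n + 2 * \<beta>0 * z + z\<^sup>2 / complex_of_real n"
    unfolding b_def power2_sum using snz by (simp add: power_mult_distrib power_divide power2_eq_square[of "complex_of_real (sqrt n)"] sq)
  have "(\<integral>x. term_fun N z x \<partial>gauss) = exp (b\<^sup>2 / 2) * exp (- (2 * complex_of_real \<sigma> * z))"
    unfolding term_fun_eq n_def[symmetric] b_def[symmetric]
    using has_bochner_integral_gauss_exp[of b] by (simp add: has_bochner_integral_iff)
  moreover have "of_nat N = exp (complex_of_real n)"
    using exp_energy[of N] N by (simp add: n_def exp_of_real)
  moreover have "complex_of_real (scale N) = exp (complex_of_real (n * (1 / 2 + \<sigma>\<^sup>2)))"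
    by (simp only: scale_def n_def exp_of_real)
  ultimately have "of_nat N * (\<integral>x. term_fun N z x \<partial>gauss) / complex_of_real (scale N) =
      exp (complex_of_real n + (b\<^sup>2 / 2 + - (2 * complex_of_real \<sigma> * z)) - complex_of_real (n * (1 / 2 + \<sigma>\<^sup>2)))"
    by (simp only: exp_add exp_diff)
  also have "complex_of_real n + (b\<^sup>2 / 2 + - (2 * complex_of_real \<sigma> * z)) - complex_of_real (n * (1 / 2 + \<sigma>\<^sup>2)) =
     \<i> * complex_of_real (n * \<sigma> * \<tau>) + z * (\<beta>0 - 2 * complex_of_real \<sigma>) + z\<^sup>2 / complex_of_real (2 * n)"
  proof -
    have "complex_of_real n + \<beta>0\<^sup>2 * complex_of_real n / 2 - complex_of_real (n * (1 / 2 + \<sigma>\<^sup>2)) = \<i> * complex_of_real (n * \<sigma> * \<tau>)"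
      unfolding \<beta>0_square \<tau>_sq by (simp add: complex_eq_iff field_simps)
    note const = this
    have "z\<^sup>2 / complex_of_real (2 * n) = z\<^sup>2 / complex_of_real n / 2" by simp
    then show ?thesis unfolding b2 const[symmetric] by (simp add: algebra_simps add_divide_distrib)
  qed
  finally show ?thesis by (simp add: n_def)
qed

text \<open>
  The relative rate of mean and fluctuations in the rescaled variable, which fixes the period
  of the limiting zeros.
\<close>

lemma \<beta>0_identity: "\<beta>0 * (\<beta>0 - 2 * complex_of_real \<sigma>) = -1"
  using circle by (simp add: \<beta>0_def complex_eq_iff power2_eq_square algebra_simps)

lemma partition_fun_decomposition:
  assumes N: "N \<ge> 2"
  shows "partition_fun (\<lambda>k. X k \<omega>) N (\<beta>0 * (1 + t / complex_of_real (energy N))) *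
      (exp (- (2 * complex_of_real \<sigma> * (\<beta>0 * t))) / complex_of_real (scale N)) =
    centered_sum N (term_fun N (\<beta>0 * t)) \<omega> / complex_of_real (scale N) +
    exp (\<i> * complex_of_real (energy N * \<sigma> * \<tau>) - t + (\<beta>0 * t)\<^sup>2 / complex_of_real (2 * energy N))"
proof -
  define n where "n = energy N"
  have n: "n > 0" using N by (simp add: energy_def n_def)
  have "exp (\<beta>0 * (1 + t / complex_of_real n) * complex_of_real (sqrt n * x)) * exp (- (2 * complex_of_real \<sigma> * (\<beta>0 * t))) = term_fun N (\<beta>0 * t) x" for x
  proof -
    have "complex_of_real (sqrt n) / complex_of_real n = 1 / complex_of_real (sqrt n)"
      using n by (simp add: divide_eq_eq eq_divide_eq flip: of_real_mult)
    moreover have "\<beta>0 * (1 + t / complex_of_real n) * complex_of_real (sqrt n * x) =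
       (\<beta>0 * complex_of_real (sqrt n) + \<beta>0 * t * (complex_of_real (sqrt n) / complex_of_real n)) * complex_of_real x"
      by (simp add: algebra_simps)
    ultimately have "\<beta>0 * (1 + t / complex_of_real n) * complex_of_real (sqrt n * x) =
       (\<beta>0 * complex_of_real (sqrt n) + \<beta>0 * t / complex_of_real (sqrt n)) * complex_of_real x"
      by simp
    then show ?thesis unfolding term_fun_eq n_def[symmetric] by (simp only:)
  qed
  then have "partition_fun (\<lambda>k. X k \<omega>) N (\<beta>0 * (1 + t / complex_of_real n)) * exp (- (2 * complex_of_real \<sigma> * (\<beta>0 * t))) =
    (\<Sum>k=1..N. term_fun N (\<beta>0 * t) (X k \<omega>))"
    unfolding partition_fun_def n_def energy_def sum_distrib_right by simp
  also have "\<dots> = centered_sum N (term_fun N (\<beta>0 * t)) \<omega> + of_nat N * (\<integral>x. term_fun N (\<beta>0 * t) x \<partial>gauss)"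
    unfolding centered_sum_def by (simp add: sum_subtractf)
  finally have "partition_fun (\<lambda>k. X k \<omega>) N (\<beta>0 * (1 + t / complex_of_real n)) * exp (- (2 * complex_of_real \<sigma> * (\<beta>0 * t))) / complex_of_real (scale N) =
    centered_sum N (term_fun N (\<beta>0 * t)) \<omega> / complex_of_real (scale N) + of_nat N * (\<integral>x. term_fun N (\<beta>0 * t) x \<partial>gauss) / complex_of_real (scale N)"
    by (simp add: add_divide_distrib)
  moreover have "\<beta>0 * t * (\<beta>0 - 2 * complex_of_real \<sigma>) = - t"
    using \<beta>0_identity by (metis mult.assoc mult.commute mult_minus1)
  ultimately show ?thesis unfolding scaled_mean_term_fun[OF N] n_def by simp
qed

text \<open>
  The phase of the mean at \<open>\<beta>0\<close>, reduced modulo \<open>2 * pi\<close> so as to be bounded in \<open>N\<close>.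
\<close>

definition phase :: "nat \<Rightarrow> real" where
  "phase N = energy N * \<sigma> * \<tau> - 2 * pi * of_int \<lfloor>energy N * \<sigma> * \<tau> / (2 * pi)\<rfloor>"

lemma phase_bounds: "0 \<le> phase N" "phase N \<le> 2 * pi"
proof -
  define y where "y = energy N * \<sigma> * \<tau> / (2 * pi)"
  have "phase N = 2 * pi * (y - of_int \<lfloor>y\<rfloor>)" by (simp add: phase_def y_def field_simps)
  moreover have "0 \<le> y - of_int \<lfloor>y\<rfloor>" "y - of_int \<lfloor>y\<rfloor> \<le> 1" by linarith+
  ultimately show "0 \<le> phase N" "phase N \<le> 2 * pi" by (simp_all add: mult_le_cancel_left1)
qed

lemma exp_phase: "exp (\<i> * complex_of_real (energy N * \<sigma> * \<tau>)) = exp (\<i> * complex_of_real (phase N))"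
proof -
  have "\<i> * complex_of_real (energy N * \<sigma> * \<tau>) = \<i> * complex_of_real (phase N) + of_int (2 * \<lfloor>energy N * \<sigma> * \<tau> / (2 * pi)\<rfloor>) * complex_of_real pi * \<i>"
    by (simp add: phase_def algebra_simps)
  then show ?thesis unfolding exp_eq by (intro exI[of _ "\<lfloor>energy N * \<sigma> * \<tau> / (2 * pi)\<rfloor>"]) simp
qed

text \<open>
  The partition function in the variable \<open>s\<close> for which \<open>\<beta> = \<beta>0 * (1 + (s + \<i> * phase N) / energy N)\<close>,
  divided by a nonvanishing factor that makes the fluctuations of order \<open>1\<close> and asymptotically constant in \<open>s\<close>.
\<close>

definition local_fun :: "nat \<Rightarrow> 'a \<Rightarrow> complex \<Rightarrow> complex" where
  "local_fun N \<omega> s = partition_fun (\<lambda>k. X k \<omega>) N (\<beta>0 / complex_of_real (energy N) * s + \<beta>0 * (1 + \<i> * complex_of_real (phase N) / complex_of_real (energy N)))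
     * (exp (- (2 * complex_of_real \<sigma> * (\<beta>0 * (s + \<i> * complex_of_real (phase N))))) / complex_of_real (scale N))"

lemma local_fun_holomorphic: "local_fun N \<omega> holomorphic_on UNIV"
proof -
  have "scale N \<noteq> 0" using scale_pos[of N] by simp
  then show ?thesis unfolding local_fun_def partition_fun_def by (intro holomorphic_intros) auto
qed

lemma rescaled_zeros_sum_eq_local:
  assumes N: "N \<ge> 2"
  shows "rescaled_zeros_sum (\<lambda>k. X k \<omega>) N \<beta>0 (phase N) f = zero_sum (local_fun N \<omega>) f"
proof -
  define n where "n = energy N"
  have n: "n > 0" using N by (simp add: energy_def n_def)
  have b: "\<beta>0 \<noteq> 0" using cmod_\<beta>0 by auto
  define b where "b = \<beta>0 * (1 + \<i> * complex_of_real (phase N) / complex_of_real n)"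
  have "zero_sum (local_fun N \<omega>) f = zero_sum (partition_fun (\<lambda>k. X k \<omega>) N) (\<lambda>z. f ((z - b) / (\<beta>0 / complex_of_real n)))"
    unfolding local_fun_def[abs_def] n_def[symmetric] b_def[symmetric]
  proof (rule zero_sum_affine[OF partition_fun_holomorphic])
    show "partition_fun (\<lambda>k. X k \<omega>) N 0 \<noteq> 0" using N by (simp add: partition_fun_0)
    show "\<beta>0 / complex_of_real n \<noteq> 0" using b n by simp
    show "(\<lambda>s. exp (- (2 * complex_of_real \<sigma> * (\<beta>0 * (s + \<i> * complex_of_real (phase N))))) / complex_of_real (scale N)) holomorphic_on UNIV"
      using scale_pos[of N] by (intro holomorphic_intros) auto
  qed (use scale_pos[of N] in auto)
  also have "(\<lambda>z. f ((z - b) / (\<beta>0 / complex_of_real n))) =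
    (\<lambda>\<beta>. f (complex_of_real (ln (real N)) * (\<beta> / \<beta>0 - 1) - \<i> * complex_of_real (phase N)))"
  proof -
    have aux: "(z - u * (1 + v / m)) / (u / m) = m * (z / u - 1) - v" if "u \<noteq> 0" "m \<noteq> 0" for z u v m :: complex
      using that by (simp add: field_simps)
    have "(z - b) / (\<beta>0 / complex_of_real n) = complex_of_real n * (z / \<beta>0 - 1) - \<i> * complex_of_real (phase N)" for z
      unfolding b_def by (rule aux) (use b n in auto)
    then show ?thesis by (simp add: n_def energy_def)
  qed
  finally show ?thesis by (simp add: rescaled_zeros_sum_eq_zero_sum)
qed

text \<open>
  The random function is \<open>exp (- s)\<close>, coming from the mean, plus a random constant. Of the two errors,
  the first collects the higher coefficients of the random power series, the second the quadratic
  term \<open>w\<close> in the exponent of the mean.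
\<close>

lemma local_fun_close:
  assumes N: "N \<ge> 2" and s: "cmod s \<le> R" and r: "r = R + 2 * pi" "r * sqrt (2 / energy N) < 1"
  shows "cmod (local_fun N \<omega> s - (exp (- s) + coeff N 0 \<omega>)) \<le>
    remainder r N \<omega> + exp R * (exp (r\<^sup>2 / (2 * energy N)) - 1)"
proof -
  define n where "n = energy N"
  have n: "n > 0" using N by (simp add: energy_def n_def)
  have R: "R \<ge> 0" using s norm_ge_zero order_trans by blast
  define t where "t = s + \<i> * complex_of_real (phase N)"
  have t: "cmod (\<beta>0 * t) \<le> r"
  proof -
    have "cmod t \<le> cmod s + \<bar>phase N\<bar>"
      unfolding t_def by (rule order_trans[OF norm_triangle_ineq]) (simp add: norm_mult)
    then show ?thesis using s r phase_bounds[of N] by (simp add: norm_mult cmod_\<beta>0)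
  qed
  have arg: "\<beta>0 / complex_of_real n * s + \<beta>0 * (1 + \<i> * complex_of_real (phase N) / complex_of_real n) = \<beta>0 * (1 + t / complex_of_real n)"
    by (simp add: t_def algebra_simps add_divide_distrib)
  define w where "w = (\<beta>0 * t)\<^sup>2 / complex_of_real (2 * n)"
  have "exp (\<i> * complex_of_real (n * \<sigma> * \<tau>) - t + w) = exp (\<i> * complex_of_real (n * \<sigma> * \<tau>)) * exp (- t) * exp w"
    by (simp add: exp_add exp_diff exp_minus divide_inverse)
  also have "\<dots> = exp (- s) * exp w"
    unfolding exp_phase[of N, folded n_def] by (simp add: t_def flip: exp_add)
  finally have mean: "exp (\<i> * complex_of_real (n * \<sigma> * \<tau>) - t + w) = exp (- s) * exp w" .
  have "local_fun N \<omega> s = centered_sum N (term_fun N (\<beta>0 * t)) \<omega> / complex_of_real (scale N) + exp (- s) * exp w"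
    unfolding local_fun_def n_def[symmetric] arg unfolding t_def[symmetric]
    unfolding partition_fun_decomposition[OF N, folded n_def] w_def[symmetric] mean ..
  then have "local_fun N \<omega> s - (exp (- s) + coeff N 0 \<omega>) =
      (centered_sum N (term_fun N (\<beta>0 * t)) \<omega> / complex_of_real (scale N) - coeff N 0 \<omega>) + exp (- s) * (exp w - 1)"
    by (simp add: algebra_simps)
  also have "cmod \<dots> \<le> remainder r N \<omega> + cmod (exp (- s) * (exp w - 1))"
    by (intro order_trans[OF norm_triangle_ineq] add_right_mono remainder_bound[OF N _ t r(2)]) (use R r in auto)
  also have "cmod (exp (- s) * (exp w - 1)) \<le> exp R * (exp (r\<^sup>2 / (2 * n)) - 1)"
    unfolding norm_mult
  proof (rule mult_mono)
    show "cmod (exp (- s)) \<le> exp R" using s abs_Re_le_cmod[of s] by simp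
    have "cmod w = (cmod (\<beta>0 * t))\<^sup>2 / (2 * n)" using n by (simp add: w_def norm_divide norm_power)
    also have "\<dots> \<le> r\<^sup>2 / (2 * n)" using n t by (intro divide_right_mono power_mono) auto
    finally have w: "cmod w \<le> r\<^sup>2 / (2 * n)" .
    have "cmod (exp w - 1) \<le> exp (cmod w) - 1" by (rule norm_exp_minus_1_le)
    then show "cmod (exp w - 1) \<le> exp (r\<^sup>2 / (2 * n)) - 1" using w by (smt (verit) exp_le_cancel_iff)
  qed auto
  finally show ?thesis by (simp add: n_def)
qed


section \<open>Central limit theorem for the leading coefficient\<close>

definition summand :: "nat \<Rightarrow> real \<Rightarrow> complex" where
  "summand N x = base N x / complex_of_real (scale N)"

lemma term_coeff_0: "term_coeff N 0 = base N"
  by (simp add: term_coeff_def fun_eq_iff)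

lemma base_measurable: "base N \<in> borel_measurable borel"
  using term_coeff_measurable[of N 0] by (simp add: term_coeff_0)

lemma summand_measurable: "summand N \<in> borel_measurable borel"
  unfolding summand_def[abs_def] using base_measurable[of N] by measurable

lemma energy_nonneg: "energy N \<ge> 0"
  by (cases "N = 0") (auto simp: energy_def)

lemma base_norm_sq: "(cmod (base N x))\<^sup>2 = exp (2 * \<sigma> * sqrt (energy N) * x)"
  unfolding cmod_base exp_double[symmetric] by (simp add: mult.assoc)

lemma summand_integral_norm_sq:
  "integrable gauss (\<lambda>x. (cmod (summand N x))\<^sup>2)"
  "N \<ge> 1 \<Longrightarrow> (\<integral>x. (cmod (summand N x))\<^sup>2 \<partial>gauss) = 1 / real N"
proof -
  have eq: "(\<lambda>x. (cmod (summand N x))\<^sup>2) = (\<lambda>x. exp (2 * \<sigma> * sqrt (energy N) * x) / (scale N)\<^sup>2)"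
    by (simp add: summand_def norm_divide power_divide base_norm_sq)
  have i: "has_bochner_integral gauss (\<lambda>x. exp (2 * \<sigma> * sqrt (energy N) * x)) (exp (2 * \<sigma>\<^sup>2 * energy N))"
    using has_bochner_integral_gauss_exp_real[of "2 * \<sigma> * sqrt (energy N)"] energy_nonneg[of N]
    by (simp add: power_mult_distrib mult_ac)
  show "integrable gauss (\<lambda>x. (cmod (summand N x))\<^sup>2)" unfolding eq using i by (simp add: has_bochner_integral_iff)
  show "(\<integral>x. (cmod (summand N x))\<^sup>2 \<partial>gauss) = 1 / real N" if "N \<ge> 1"
    unfolding eq using i that by (simp add: has_bochner_integral_iff scale_sq)
qed

lemma summand_integral:
  "integrable gauss (summand N)"
  "N \<ge> 1 \<Longrightarrow> cmod (\<integral>x. summand N x \<partial>gauss) = 1 / real N"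
proof -
  have "(\<beta>0 * complex_of_real (sqrt (energy N)))\<^sup>2 = \<beta>0\<^sup>2 * complex_of_real (energy N)"
    using energy_nonneg[of N] by (simp add: power_mult_distrib flip: of_real_power)
  then have i: "has_bochner_integral gauss (base N) (exp (\<beta>0\<^sup>2 * complex_of_real (energy N) / 2))"
    using has_bochner_integral_gauss_exp[of "\<beta>0 * complex_of_real (sqrt (energy N))"]
    by (simp add: base_def[abs_def] mult.assoc)
  then show "integrable gauss (summand N)" by (simp add: summand_def[abs_def] has_bochner_integral_iff)
  assume N: "N \<ge> 1"
  have "(\<integral>x. summand N x \<partial>gauss) = exp (\<beta>0\<^sup>2 * complex_of_real (energy N) / 2) / complex_of_real (scale N)"
    using i by (simp add: summand_def[abs_def] has_bochner_integral_iff)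
  then have "cmod (\<integral>x. summand N x \<partial>gauss) = exp ((\<sigma>\<^sup>2 - \<tau>\<^sup>2) * energy N / 2) / exp (energy N * (1 / 2 + \<sigma>\<^sup>2))"
    by (simp add: norm_divide \<beta>0_square scale_def)
  also have "\<dots> = exp (- energy N)"
    unfolding exp_diff[symmetric] \<tau>_sq by (simp add: algebra_simps add_divide_distrib diff_divide_distrib)
  also have "\<dots> = 1 / real N" using exp_energy[OF N] by (simp add: exp_minus inverse_eq_divide)
  finally show "cmod (\<integral>x. summand N x \<partial>gauss) = 1 / real N" .
qed

text \<open>
  The integral of the square, as opposed to that of the squared modulus, is negligible since
  \<open>\<tau> \<noteq> 0\<close>. Hence the limiting normal law is isotropic.
\<close>

lemma summand_integral_sq:
  "integrable gauss (\<lambda>x. (summand N x)\<^sup>2)"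
  "N \<ge> 1 \<Longrightarrow> cmod (of_nat N * (\<integral>x. (summand N x)\<^sup>2 \<partial>gauss)) = exp (energy N * (- 2 * \<tau>\<^sup>2))"
proof -
  have e2: "(2 * \<beta>0 * complex_of_real (sqrt (energy N)))\<^sup>2 / 2 = 2 * \<beta>0\<^sup>2 * complex_of_real (energy N)"
    using energy_nonneg[of N] by (simp add: power_mult_distrib flip: of_real_power)
  have "(base N x)\<^sup>2 = exp (2 * \<beta>0 * complex_of_real (sqrt (energy N)) * complex_of_real x)" for x
    unfolding base_def exp_double[symmetric] by (simp add: mult.assoc)
  then have i: "has_bochner_integral gauss (\<lambda>x. (base N x)\<^sup>2) (exp (2 * \<beta>0\<^sup>2 * complex_of_real (energy N)))"
    using has_bochner_integral_gauss_exp[of "2 * \<beta>0 * complex_of_real (sqrt (energy N))"] e2 by simp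
  then show "integrable gauss (\<lambda>x. (summand N x)\<^sup>2)" by (simp add: summand_def[abs_def] has_bochner_integral_iff power_divide)
  assume N: "N \<ge> 1"
  have "(\<integral>x. (summand N x)\<^sup>2 \<partial>gauss) = exp (2 * \<beta>0\<^sup>2 * complex_of_real (energy N)) / (complex_of_real (scale N))\<^sup>2"
    using i by (simp add: summand_def[abs_def] has_bochner_integral_iff power_divide)
  then have "cmod (of_nat N * (\<integral>x. (summand N x)\<^sup>2 \<partial>gauss)) = real N * (exp (2 * (\<sigma>\<^sup>2 - \<tau>\<^sup>2) * energy N) / (scale N)\<^sup>2)"
    by (simp add: norm_mult norm_divide norm_power \<beta>0_square)
  also have "\<dots> = exp (2 * (\<sigma>\<^sup>2 - \<tau>\<^sup>2) * energy N) / exp (2 * \<sigma>\<^sup>2 * energy N)" using N by (simp add: scale_sq)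
  also have "\<dots> = exp (energy N * (- 2 * \<tau>\<^sup>2))"
    unfolding exp_diff[symmetric] by (simp add: algebra_simps)
  finally show "cmod (of_nat N * (\<integral>x. (summand N x)\<^sup>2 \<partial>gauss)) = exp (energy N * (- 2 * \<tau>\<^sup>2))" .
qed

lemma summand_integral_powr:
  assumes N: "N \<ge> 1"
  shows "integrable gauss (\<lambda>x. cmod (summand N x) powr q)"
    "real N * (\<integral>x. cmod (summand N x) powr q \<partial>gauss) = exp (energy N * (1 + q\<^sup>2 * \<sigma>\<^sup>2 / 2 - q / 2 - q * \<sigma>\<^sup>2))"
proof -
  have "cmod (summand N x) powr q = exp (q * \<sigma> * sqrt (energy N) * x) / exp (q * energy N * (1 / 2 + \<sigma>\<^sup>2))" for x
    by (simp add: summand_def norm_divide cmod_base scale_def powr_def ln_div exp_diff[symmetric] algebra_simps)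
  then have eq: "(\<lambda>x. cmod (summand N x) powr q) = (\<lambda>x. exp (q * \<sigma> * sqrt (energy N) * x) / exp (q * energy N * (1 / 2 + \<sigma>\<^sup>2)))"
    by (rule ext)
  have i: "has_bochner_integral gauss (\<lambda>x. exp (q * \<sigma> * sqrt (energy N) * x)) (exp (q\<^sup>2 * \<sigma>\<^sup>2 * energy N / 2))"
    using has_bochner_integral_gauss_exp_real[of "q * \<sigma> * sqrt (energy N)"] energy_nonneg[of N]
    by (simp add: power_mult_distrib)
  show "integrable gauss (\<lambda>x. cmod (summand N x) powr q)" unfolding eq using i by (simp add: has_bochner_integral_iff)
  have "real N * (\<integral>x. cmod (summand N x) powr q \<partial>gauss) = exp (energy N) * (exp (q\<^sup>2 * \<sigma>\<^sup>2 * energy N / 2) / exp (q * energy N * (1 / 2 + \<sigma>\<^sup>2)))"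
    unfolding eq using i exp_energy[OF N] by (simp add: has_bochner_integral_iff)
  also have "\<dots> = exp (energy N * (1 + q\<^sup>2 * \<sigma>\<^sup>2 / 2 - q / 2 - q * \<sigma>\<^sup>2))"
    unfolding exp_diff[symmetric] exp_add[symmetric] by (simp add: algebra_simps)
  finally show "real N * (\<integral>x. cmod (summand N x) powr q \<partial>gauss) = exp (energy N * (1 + q\<^sup>2 * \<sigma>\<^sup>2 / 2 - q / 2 - q * \<sigma>\<^sup>2))" .
qed

text \<open>
  Reduces the Lindeberg integrand to a moment of order \<open>q\<close>, which for an exponential can be computed exactly.
\<close>

lemma min_square_cube_le_powr:
  fixes y q :: real
  assumes "2 < q" "q \<le> 3" "0 \<le> y"
  shows "min (6 * y\<^sup>2) (y ^ 3) \<le> 6 * y powr q"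
proof (cases "y \<le> 1")
  case True
  show ?thesis
  proof (cases "y = 0")
    case False
    then have "y ^ 3 = y powr 3" using assms(3) by (simp add: powr_numeral)
    also have "\<dots> \<le> y powr q" using assms True False by (intro powr_mono') auto
    finally have "y ^ 3 \<le> 6 * y powr q" by (smt (verit) powr_ge_zero)
    then show ?thesis by simp
  qed simp
next
  case False
  then have "y\<^sup>2 = y powr 2" by (simp add: powr_numeral)
  also have "\<dots> \<le> y powr q" using assms False by (intro powr_mono) auto
  finally show ?thesis by simp
qed

text \<open>
  The central limit theorem for real projections of the leading coefficient. The Lindeberg condition follows from a moment
  of order \<open>q\<close> slightly above \<open>2\<close>, and such a moment is small precisely because \<open>\<sigma>\<^sup>2 < 1 / 2\<close>.
\<close>

lemma char_coeff_0_tendsto: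
  "(\<lambda>N. \<integral>\<omega>. exp (\<i> * complex_of_real (Re (cnj u * coeff N 0 \<omega>))) \<partial>M) \<longlonglongrightarrow> exp (- (cmod u)\<^sup>2 / 4)"
proof -
  interpret g: real_distribution gauss by (rule real_dist_normal_dist)
  define m where "m N = (\<integral>x. summand N x \<partial>gauss)" for N
  define y where "y N x = Re (cnj u * summand N x)" for N x
  define \<mu> where "\<mu> N = Re (cnj u * m N)" for N
  define \<zeta> where "\<zeta> N x = y N x - \<mu> N" for N x
  note [measurable] = summand_measurable
  have [measurable]: "y N \<in> borel_measurable borel" "\<zeta> N \<in> borel_measurable borel" for N
    unfolding \<zeta>_def[abs_def] y_def[abs_def] by measurable
  have yi: "integrable gauss (y N)" for N
    unfolding y_def[abs_def] by (intro integrable_Re integrable_mult_right summand_integral)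
  have ym: "(\<integral>x. y N x \<partial>gauss) = \<mu> N" for N
    unfolding y_def \<mu>_def m_def using summand_integral(1)[of N] by (subst integral_Re) auto
  have y2: "(\<lambda>x. (y N x)\<^sup>2) = (\<lambda>x. ((cmod u)\<^sup>2 * (cmod (summand N x))\<^sup>2 + Re ((cnj u)\<^sup>2 * (summand N x)\<^sup>2)) / 2)" for N
  proof
    fix x
    have "(Re w)\<^sup>2 = ((cmod w)\<^sup>2 + Re (w\<^sup>2)) / 2" for w
      unfolding cmod_power2 by (simp add: power2_eq_square)
    from this[of "cnj u * summand N x"]
    show "(y N x)\<^sup>2 = ((cmod u)\<^sup>2 * (cmod (summand N x))\<^sup>2 + Re ((cnj u)\<^sup>2 * (summand N x)\<^sup>2)) / 2"
      by (simp only: y_def norm_mult power_mult_distrib complex_mod_cnj)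
  qed
  have i1: "integrable gauss (\<lambda>x. (cmod u)\<^sup>2 * (cmod (summand N x))\<^sup>2)" for N
    using summand_integral_norm_sq(1) by simp
  have i2: "integrable gauss (\<lambda>x. Re ((cnj u)\<^sup>2 * (summand N x)\<^sup>2))" for N
    by (intro integrable_Re integrable_mult_right summand_integral_sq)
  have y2i: "integrable gauss (\<lambda>x. (y N x)\<^sup>2)" for N
    unfolding y2 by (intro integrable_divide_zero Bochner_Integration.integrable_add i1 i2)
  have y2v: "(\<integral>x. (y N x)\<^sup>2 \<partial>gauss) = ((cmod u)\<^sup>2 * (\<integral>x. (cmod (summand N x))\<^sup>2 \<partial>gauss) + Re ((cnj u)\<^sup>2 * (\<integral>x. (summand N x)\<^sup>2 \<partial>gauss))) / 2" for N
  proof -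
    have "(\<integral>x. (y N x)\<^sup>2 \<partial>gauss) = ((\<integral>x. (cmod u)\<^sup>2 * (cmod (summand N x))\<^sup>2 \<partial>gauss) + (\<integral>x. Re ((cnj u)\<^sup>2 * (summand N x)\<^sup>2) \<partial>gauss)) / 2"
      unfolding y2 integral_divide_zero by (simp only: Bochner_Integration.integral_add[OF i1 i2])
    also have "(\<integral>x. Re ((cnj u)\<^sup>2 * (summand N x)\<^sup>2) \<partial>gauss) = Re (\<integral>x. (cnj u)\<^sup>2 * (summand N x)\<^sup>2 \<partial>gauss)"
      using summand_integral_sq(1)[of N] by (intro integral_Re) auto
    finally show ?thesis by simp
  qed
  have \<zeta>i: "integrable gauss (\<zeta> N)" for N unfolding \<zeta>_def using yi by simp
  have \<zeta>m: "(\<integral>x. \<zeta> N x \<partial>gauss) = 0" for N unfolding \<zeta>_def using yi[of N] ym[of N] g.prob_space by simp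
  have \<zeta>2: "(\<zeta> N x)\<^sup>2 = (y N x)\<^sup>2 - 2 * \<mu> N * y N x + (\<mu> N)\<^sup>2" for N x
    by (simp add: \<zeta>_def power2_eq_square algebra_simps)
  have \<zeta>2i: "integrable gauss (\<lambda>x. (\<zeta> N x)\<^sup>2)" for N
    unfolding \<zeta>2 using y2i yi by simp
  have \<zeta>2v: "(\<integral>x. (\<zeta> N x)\<^sup>2 \<partial>gauss) = (\<integral>x. (y N x)\<^sup>2 \<partial>gauss) - (\<mu> N)\<^sup>2" for N
    using g.variance_eq[OF yi y2i, of N] by (simp add: \<zeta>_def ym)
  have \<mu>b: "\<bar>\<mu> N\<bar> \<le> cmod u / real N" if "N \<ge> 1" for N
    using abs_Re_le_cmod[of "cnj u * m N"] summand_integral(2)[OF that] by (simp add: \<mu>_def m_def norm_mult)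
  have var: "(\<lambda>N. real N * (\<integral>x. (\<zeta> N x)\<^sup>2 \<partial>gauss)) \<longlonglongrightarrow> (cmod u)\<^sup>2 / 2"
  proof -
    have t1: "(\<lambda>N. Re ((cnj u)\<^sup>2 * (of_nat N * (\<integral>x. (summand N x)\<^sup>2 \<partial>gauss)))) \<longlonglongrightarrow> 0"
    proof (rule Lim_null_comparison)
      show "\<forall>\<^sub>F N in sequentially. norm (Re ((cnj u)\<^sup>2 * (of_nat N * (\<integral>x. (summand N x)\<^sup>2 \<partial>gauss)))) \<le> (cmod u)\<^sup>2 * exp (energy N * (- 2 * \<tau>\<^sup>2))"
        using eventually_ge_at_top[of 1]
      proof eventually_elim
        case (elim N)
        have "\<bar>Re ((cnj u)\<^sup>2 * (of_nat N * (\<integral>x. (summand N x)\<^sup>2 \<partial>gauss)))\<bar> \<le> cmod ((cnj u)\<^sup>2 * (of_nat N * (\<integral>x. (summand N x)\<^sup>2 \<partial>gauss)))"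
          by (rule abs_Re_le_cmod)
        also have "\<dots> = (cmod u)\<^sup>2 * cmod (of_nat N * (\<integral>x. (summand N x)\<^sup>2 \<partial>gauss))"
          by (simp only: norm_mult norm_power complex_mod_cnj)
        finally show ?case unfolding summand_integral_sq(2)[OF elim] by simp
      qed
      have "- 2 * \<tau>\<^sup>2 < 0" using \<tau>_sq small by simp
      from tendsto_mult_left[OF exp_energy_tendsto_0[OF this], of "(cmod u)\<^sup>2"]
      show "(\<lambda>N. (cmod u)\<^sup>2 * exp (energy N * (- 2 * \<tau>\<^sup>2))) \<longlonglongrightarrow> 0" by simp
    qed
    have t2: "(\<lambda>N. real N * (\<mu> N)\<^sup>2) \<longlonglongrightarrow> 0"
    proof (rule Lim_null_comparison)
      show "\<forall>\<^sub>F N in sequentially. norm (real N * (\<mu> N)\<^sup>2) \<le> (cmod u)\<^sup>2 * (1 / real N)"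
        using eventually_ge_at_top[of 1]
      proof eventually_elim
        case (elim N)
        have "(\<mu> N)\<^sup>2 \<le> (cmod u / real N)\<^sup>2" using power_mono[OF \<mu>b[OF elim], of 2] by simp
        then have "real N * (\<mu> N)\<^sup>2 \<le> real N * (cmod u / real N)\<^sup>2" by (intro mult_left_mono) auto
        then show ?case using elim by (simp add: power2_eq_square field_simps)
      qed
      show "(\<lambda>N. (cmod u)\<^sup>2 * (1 / real N)) \<longlonglongrightarrow> 0"
        using tendsto_mult_left[OF lim_1_over_n[where 'a=real], of "(cmod u)\<^sup>2"] by simp
    qed
    have "(\<lambda>N. ((cmod u)\<^sup>2 + Re ((cnj u)\<^sup>2 * (of_nat N * (\<integral>x. (summand N x)\<^sup>2 \<partial>gauss)))) / 2 - real N * (\<mu> N)\<^sup>2) \<longlonglongrightarrow> ((cmod u)\<^sup>2 + 0) / 2 - 0"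
      by (intro tendsto_intros t1 t2) auto
    then have lim: "(\<lambda>N. ((cmod u)\<^sup>2 + Re ((cnj u)\<^sup>2 * (of_nat N * (\<integral>x. (summand N x)\<^sup>2 \<partial>gauss)))) / 2 - real N * (\<mu> N)\<^sup>2) \<longlonglongrightarrow> (cmod u)\<^sup>2 / 2"
      by simp
    show ?thesis
    proof (rule Lim_transform_eventually[OF lim])
      show "\<forall>\<^sub>F N in sequentially. ((cmod u)\<^sup>2 + Re ((cnj u)\<^sup>2 * (of_nat N * (\<integral>x. (summand N x)\<^sup>2 \<partial>gauss)))) / 2 - real N * (\<mu> N)\<^sup>2 = real N * (\<integral>x. (\<zeta> N x)\<^sup>2 \<partial>gauss)"
        using eventually_ge_at_top[of 1]
      proof eventually_elim
        case (elim N)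
        define I where "I = (\<integral>x. (summand N x)\<^sup>2 \<partial>gauss)"
        have "Re ((cnj u)\<^sup>2 * (of_nat N * I)) = real N * Re ((cnj u)\<^sup>2 * I)"
          by (simp add: algebra_simps)
        then show ?case
          unfolding \<zeta>2v y2v summand_integral_norm_sq(2)[OF elim] I_def[symmetric]
          using elim by (simp add: field_simps)
      qed
    qed
  qed
  have lind: "(\<lambda>N. real N * (\<integral>x. min (6 * (\<zeta> N x)\<^sup>2) (\<bar>\<zeta> N x\<bar> ^ 3) \<partial>gauss)) \<longlonglongrightarrow> 0"
  proof -
    \<comment> \<open>This choice makes the exponent \<open>\<kappa>\<close> of the moment of order \<open>2 + p\<close> negative.\<close>
    define p where "p = 1 / 2 - \<sigma>\<^sup>2"
    define q where "q = 2 + p"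
    have p: "0 < p" "p \<le> 1 / 2" using small by (auto simp: p_def)
    define \<kappa> where "\<kappa> = 1 + q\<^sup>2 * \<sigma>\<^sup>2 / 2 - q / 2 - q * \<sigma>\<^sup>2"
    have "\<kappa> = - (p\<^sup>2 * (1 - \<sigma>\<^sup>2 / 2))"
    proof -
      have "1 + (2 + p)\<^sup>2 * (1 / 2 - p) / 2 - (2 + p) / 2 - (2 + p) * (1 / 2 - p) = - (p\<^sup>2 * (1 - (1 / 2 - p) / 2))"
        by (simp add: power2_eq_square field_simps)
      moreover have "\<sigma>\<^sup>2 = 1 / 2 - p" by (simp add: p_def)
      ultimately show ?thesis unfolding \<kappa>_def q_def by (simp only:)
    qed
    then have \<kappa>: "\<kappa> < 0" using p small by simp
    define C where "C = 6 * (2 * cmod u) powr q"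
    \<comment> \<open>The centring is as small as \<open>1 / N\<close>, so it is harmless to bound the sum of the two terms by twice the larger one.\<close>
    have bound: "min (6 * (\<zeta> N x)\<^sup>2) (\<bar>\<zeta> N x\<bar> ^ 3) \<le> C * (cmod (summand N x) powr q + (1 / real N) powr q)" if N: "N \<ge> 1" for N x
    proof -
      define a where "a = max (cmod (summand N x)) (1 / real N)"
      have "\<bar>\<zeta> N x\<bar> \<le> \<bar>y N x\<bar> + \<bar>\<mu> N\<bar>" unfolding \<zeta>_def by (rule abs_triangle_ineq4)
      also have "\<dots> \<le> cmod u * cmod (summand N x) + cmod u * (1 / real N)"
        using \<mu>b[OF N] abs_Re_le_cmod[of "cnj u * summand N x"] by (intro add_mono) (auto simp: y_def norm_mult)
      also have "\<dots> \<le> cmod u * a + cmod u * a" unfolding a_def by (intro add_mono mult_left_mono) auto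
      finally have za: "\<bar>\<zeta> N x\<bar> \<le> 2 * cmod u * a" by (simp add: mult_ac)
      have a0: "a \<ge> 0" by (simp add: a_def le_max_iff_disj)
      have "min (6 * (\<zeta> N x)\<^sup>2) (\<bar>\<zeta> N x\<bar> ^ 3) = min (6 * \<bar>\<zeta> N x\<bar>\<^sup>2) (\<bar>\<zeta> N x\<bar> ^ 3)" by simp
      also have "\<dots> \<le> 6 * \<bar>\<zeta> N x\<bar> powr q" using p by (intro min_square_cube_le_powr) (auto simp: q_def)
      also have "\<dots> \<le> 6 * (2 * cmod u * a) powr q" using za p by (intro mult_left_mono powr_mono2) (auto simp: q_def)
      also have "\<dots> = C * a powr q" using a0 by (simp add: C_def powr_mult)
      also have "\<dots> \<le> C * (cmod (summand N x) powr q + (1 / real N) powr q)"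
        by (intro mult_left_mono) (auto simp: a_def C_def max_def)
      finally show ?thesis .
    qed
    have "(\<lambda>N. C * (exp (energy N * \<kappa>) + exp (energy N * (1 - q)))) \<longlonglongrightarrow> C * (0 + 0)"
      using p by (intro tendsto_intros exp_energy_tendsto_0 \<kappa>) (simp add: q_def)
    then have lim: "(\<lambda>N. C * (exp (energy N * \<kappa>) + exp (energy N * (1 - q)))) \<longlonglongrightarrow> 0" by simp
    show ?thesis
    proof (rule Lim_null_comparison[OF _ lim])
      show "\<forall>\<^sub>F N in sequentially. norm (real N * (\<integral>x. min (6 * (\<zeta> N x)\<^sup>2) (\<bar>\<zeta> N x\<bar> ^ 3) \<partial>gauss)) \<le> C * (exp (energy N * \<kappa>) + exp (energy N * (1 - q)))"
        using eventually_ge_at_top[of 1]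
      proof eventually_elim
        case (elim N)
        define m where "m = (\<lambda>x. min (6 * (\<zeta> N x)\<^sup>2) (\<bar>\<zeta> N x\<bar> ^ 3))"
        have m0: "m x \<ge> 0" for x by (simp add: m_def)
        have "integrable gauss (\<lambda>x. 6 * (\<zeta> N x)\<^sup>2)" using \<zeta>2i by simp
        then have mi: "integrable gauss m"
          by (rule Bochner_Integration.integrable_bound) (auto simp: m_def)
        note pw = summand_integral_powr[OF elim, of q]
        have "(\<integral>x. m x \<partial>gauss) \<le> (\<integral>x. C * (cmod (summand N x) powr q + (1 / real N) powr q) \<partial>gauss)"
          using mi pw(1) bound[OF elim] by (intro integral_mono) (auto simp: m_def)
        also have "\<dots> = C * ((\<integral>x. cmod (summand N x) powr q \<partial>gauss) + (1 / real N) powr q)"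
          using pw(1) g.prob_space by simp
        finally have "real N * (\<integral>x. m x \<partial>gauss) \<le> real N * (C * ((\<integral>x. cmod (summand N x) powr q \<partial>gauss) + (1 / real N) powr q))"
          by (rule mult_left_mono) simp
        also have "\<dots> = C * (real N * (\<integral>x. cmod (summand N x) powr q \<partial>gauss) + real N * (1 / real N) powr q)"
          by (simp add: algebra_simps)
        also have "real N * (1 / real N) powr q = exp (energy N * (1 - q))"
        proof -
          have "(1 / real N) powr q = exp (- (q * energy N))"
            using elim by (simp add: powr_def energy_def ln_div)
          then have "real N * (1 / real N) powr q = exp (energy N + - (q * energy N))"
            using exp_energy[OF elim] by (simp only: exp_add)
          then show ?thesis by (simp add: algebra_simps)
        qed
        finally have "real N * (\<integral>x. m x \<partial>gauss) \<le> C * (exp (energy N * \<kappa>) + exp (energy N * (1 - q)))"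
          unfolding pw(2) \<kappa>_def .
        moreover have "0 \<le> (\<integral>x. m x \<partial>gauss)" using m0 by simp
        ultimately show ?case unfolding m_def[symmetric] by (simp add: abs_mult)
      qed
    qed
  qed
  have "(\<lambda>N. \<integral>\<omega>. exp (\<i> * complex_of_real (\<Sum>k=1..N. \<zeta> N (X k \<omega>))) \<partial>M) \<longlonglongrightarrow> exp (- ((cmod u)\<^sup>2 / 2) / 2)"
    by (rule char_sum_tendsto[OF _ \<zeta>2i \<zeta>m var lind]) simp
  moreover have "(\<Sum>k=1..N. \<zeta> N (X k \<omega>)) = Re (cnj u * coeff N 0 \<omega>)" for N \<omega>
  proof -
    have "coeff N 0 \<omega> = (\<Sum>k=1..N. summand N (X k \<omega>) - m N)"
      unfolding coeff_def centered_sum_def term_coeff_0 m_def summand_def sum_divide_distrib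
      by (simp add: diff_divide_distrib)
    then have "Re (cnj u * coeff N 0 \<omega>) = (\<Sum>k=1..N. Re (cnj u * (summand N (X k \<omega>) - m N)))"
      by (simp only: sum_distrib_left Re_sum)
    moreover have "\<zeta> N x = Re (cnj u * (summand N x - m N))" for x
      unfolding \<zeta>_def y_def \<mu>_def by (simp only: right_diff_distrib minus_complex.sel)
    ultimately show ?thesis by (simp only:)
  qed
  moreover have "- ((cmod u)\<^sup>2 / 2) / 2 = - (cmod u)\<^sup>2 / 4" by simp
  ultimately show ?thesis by (simp only:)
qed

lemma coeff_0_second_moment:
  "integrable M (\<lambda>\<omega>. (cmod (coeff N 0 \<omega>))\<^sup>2)" "expectation (\<lambda>\<omega>. (cmod (coeff N 0 \<omega>))\<^sup>2) \<le> 1"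
proof -
  have eq: "coeff N 0 = centered_sum N (summand N)"
    unfolding coeff_def[abs_def] centered_sum_def[abs_def] term_coeff_0 summand_def sum_divide_distrib
    by (simp add: diff_divide_distrib)
  note cs = centered_sum_second_moment[OF summand_measurable summand_integral_norm_sq(1), of N N]
  show "integrable M (\<lambda>\<omega>. (cmod (coeff N 0 \<omega>))\<^sup>2)" unfolding eq by (rule cs(1))
  have "expectation (\<lambda>\<omega>. (cmod (coeff N 0 \<omega>))\<^sup>2) \<le> real N * (\<integral>x. (cmod (summand N x))\<^sup>2 \<partial>gauss)"
    unfolding eq by (rule cs(2))
  also have "\<dots> \<le> 1" using summand_integral_norm_sq(2)[of N] by (cases "N = 0") (auto simp: Suc_le_eq)
  finally show "expectation (\<lambda>\<omega>. (cmod (coeff N 0 \<omega>))\<^sup>2) \<le> 1" .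
qed

end

section \<open>The complex normal law\<close>

text \<open>
  The isotropic complex normal law with second absolute moment \<open>1\<close>.
\<close>

definition complex_normal :: "complex measure" where
  "complex_normal = distr (gauss \<Otimes>\<^sub>M gauss) borel
     (\<lambda>p. complex_of_real (fst p / sqrt 2) + \<i> * complex_of_real (snd p / sqrt 2))"

interpretation gauss_pair: pair_prob_space gauss gauss
  unfolding pair_prob_space_def pair_sigma_finite_def
  using real_dist_normal_dist by (auto simp: real_distribution_def prob_space_imp_sigma_finite)

lemma prob_space_gauss: "prob_space gauss"
  using real_dist_normal_dist by (simp add: real_distribution_def)

lemma complex_normal_map_measurable:
  "(\<lambda>p. complex_of_real (fst p / sqrt 2) + \<i> * complex_of_real (snd p / sqrt 2)) \<in> borel_measurable (gauss \<Otimes>\<^sub>M gauss)"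
  by measurable

lemma prob_space_complex_normal: "prob_space complex_normal"
  unfolding complex_normal_def
  by (rule gauss_pair.prob_space_distr) measurable

lemma sets_complex_normal: "sets complex_normal = sets borel"
  by (simp add: complex_normal_def)

lemma distr_gauss_fst: "distr (gauss \<Otimes>\<^sub>M gauss) gauss fst = gauss"
  by (rule prob_space.distr_pair_fst[OF prob_space_gauss])

lemma distr_gauss_snd: "distr (gauss \<Otimes>\<^sub>M gauss) gauss snd = gauss"
proof -
  have "distr (gauss \<Otimes>\<^sub>M gauss) gauss snd = distr (distr (gauss \<Otimes>\<^sub>M gauss) (gauss \<Otimes>\<^sub>M gauss) (\<lambda>(x, y). (y, x))) gauss snd"
    using gauss_pair.distr_pair_swap by simp
  also have "\<dots> = distr (gauss \<Otimes>\<^sub>M gauss) gauss (snd \<circ> (\<lambda>(x, y). (y, x)))"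
    by (rule distr_distr) measurable
  also have "snd \<circ> (\<lambda>(x, y). (y, x)) = fst" by (auto simp: fun_eq_iff)
  finally show ?thesis by (simp add: distr_gauss_fst)
qed

lemma complex_normal_char:
  "(\<integral>w. exp (\<i> * complex_of_real (Re (cnj u * w))) \<partial>complex_normal) = exp (- (cmod u)\<^sup>2 / 4)"
proof -
  define a b where "a = Re u / sqrt 2" and "b = Im u / sqrt 2"
  define F where "F p = exp (\<i> * complex_of_real (a * fst p)) * exp (\<i> * complex_of_real (b * snd p))" for p
  have [measurable]: "F \<in> borel_measurable (gauss \<Otimes>\<^sub>M gauss)" unfolding F_def by measurable
  have Fi: "integrable (gauss \<Otimes>\<^sub>M gauss) F"
    by (intro gauss_pair.integrable_const_bound[of _ 1]) (auto simp: F_def norm_mult)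
  have "(\<integral>w. exp (\<i> * complex_of_real (Re (cnj u * w))) \<partial>complex_normal) = (\<integral>p. F p \<partial>(gauss \<Otimes>\<^sub>M gauss))"
    unfolding complex_normal_def
    by (subst integral_distr[OF complex_normal_map_measurable])
       (auto simp: F_def a_def b_def algebra_simps simp flip: exp_add intro!: Bochner_Integration.integral_cong)
  also have "\<dots> = (\<integral>x. (\<integral>y. F (x, y) \<partial>gauss) \<partial>gauss)"
    by (rule gauss_pair.integral_fst'[OF Fi, symmetric])
  also have "\<dots> = (\<integral>x. exp (\<i> * complex_of_real (a * x)) * char gauss b \<partial>gauss)"
    by (simp add: F_def char_def)
  also have "\<dots> = char gauss a * char gauss b" by (simp add: char_def)
  also have "\<dots> = complex_of_real (exp (- (a\<^sup>2 + b\<^sup>2) / 2))"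
  proof -
    have "exp (- (a\<^sup>2 + b\<^sup>2) / 2) = exp (- a\<^sup>2 / 2) * exp (- b\<^sup>2 / 2)"
      unfolding exp_add[symmetric] by (simp add: add_divide_distrib diff_divide_distrib)
    then show ?thesis unfolding char_std_normal_distribution by simp
  qed
  also have "a\<^sup>2 + b\<^sup>2 = (cmod u)\<^sup>2 / 2"
    by (simp add: a_def b_def cmod_power2 power_divide add_divide_distrib)
  finally show ?thesis by simp
qed

lemma gauss_second_moment: "has_bochner_integral gauss (\<lambda>x. x\<^sup>2) 1"
  using std_normal_moment_even[of 1] by (intro has_bochner_integral_density) (auto simp: fact_numeral)

lemma complex_normal_second_moment:
  "integrable complex_normal (\<lambda>w. (cmod w)\<^sup>2)" "(\<integral>w. (cmod w)\<^sup>2 \<partial>complex_normal) \<le> 1"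
proof -
  have f: "integrable (gauss \<Otimes>\<^sub>M gauss) (\<lambda>p. (fst p)\<^sup>2)" "(\<integral>p. (fst p)\<^sup>2 \<partial>(gauss \<Otimes>\<^sub>M gauss)) = 1"
    using gauss_second_moment integrable_distr_eq[of fst "gauss \<Otimes>\<^sub>M gauss" gauss "\<lambda>x::real. x\<^sup>2"]
      integral_distr[of fst "gauss \<Otimes>\<^sub>M gauss" gauss "\<lambda>x::real. x\<^sup>2"]
    by (simp_all add: distr_gauss_fst has_bochner_integral_iff)
  have s: "integrable (gauss \<Otimes>\<^sub>M gauss) (\<lambda>p. (snd p)\<^sup>2)" "(\<integral>p. (snd p)\<^sup>2 \<partial>(gauss \<Otimes>\<^sub>M gauss)) = 1"
    using gauss_second_moment integrable_distr_eq[of snd "gauss \<Otimes>\<^sub>M gauss" gauss "\<lambda>x::real. x\<^sup>2"]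
      integral_distr[of snd "gauss \<Otimes>\<^sub>M gauss" gauss "\<lambda>x::real. x\<^sup>2"]
    by (simp_all add: distr_gauss_snd has_bochner_integral_iff)
  have eq: "(cmod (complex_of_real (fst p / sqrt 2) + \<i> * complex_of_real (snd p / sqrt 2)))\<^sup>2 = (fst p)\<^sup>2 / 2 + (snd p)\<^sup>2 / 2" for p
    by (simp add: cmod_power2 power_divide)
  have m: "(\<lambda>w::complex. (cmod w)\<^sup>2) \<in> borel_measurable borel" by measurable
  show "integrable complex_normal (\<lambda>w. (cmod w)\<^sup>2)"
    unfolding complex_normal_def integrable_distr_eq[OF complex_normal_map_measurable m] eq using f s by simp
  show "(\<integral>w. (cmod w)\<^sup>2 \<partial>complex_normal) \<le> 1"
    unfolding complex_normal_def integral_distr[OF complex_normal_map_measurable m] eq using f s by simp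
qed

lemma AE_complex_normal_nonzero: "AE w in complex_normal. w \<noteq> 0"
proof -
  have "AE x in gauss. x \<noteq> 0"
    using AE_lborel_singleton[of "0::real"] by (subst AE_density) auto
  then have "AE x in distr (gauss \<Otimes>\<^sub>M gauss) gauss fst. x \<noteq> 0" by (simp only: distr_gauss_fst)
  then have "AE p in gauss \<Otimes>\<^sub>M gauss. fst p \<noteq> 0"
    by (subst (asm) AE_distr_iff) auto
  then have "AE p in gauss \<Otimes>\<^sub>M gauss. complex_of_real (fst p / sqrt 2) + \<i> * complex_of_real (snd p / sqrt 2) \<noteq> 0"
    by (rule AE_mp) (auto simp: complex_eq_iff)
  then show ?thesis unfolding complex_normal_def
    by (subst AE_distr_iff[OF complex_normal_map_measurable]) auto
qed

section \<open>Convergence of the zero sums\<close>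

context critical_circle
begin

lemma eventually_remainder_small:
  assumes "0 < \<eta>" "0 \<le> r"
  shows "\<forall>\<^sub>F N in sequentially. r * sqrt (2 / energy N) < 1 \<and>
    r * sqrt (2 / energy N) / (1 - r * sqrt (2 / energy N)) < \<eta> \<and>
    exp R * (exp (r\<^sup>2 / (2 * energy N)) - 1) < \<eta>"
proof -
  have z: "(\<lambda>N. c / energy N) \<longlonglongrightarrow> 0" for c
    by (rule tendsto_divide_0[OF tendsto_const filterlim_at_top_imp_at_infinity[OF energy_at_top]])
  have "(\<lambda>N. r * sqrt (2 / energy N)) \<longlonglongrightarrow> r * sqrt 0"
    by (intro tendsto_intros z)
  then have q: "(\<lambda>N. r * sqrt (2 / energy N)) \<longlonglongrightarrow> 0" by simp
  have "(\<lambda>N. r * sqrt (2 / energy N) / (1 - r * sqrt (2 / energy N))) \<longlonglongrightarrow> 0 / (1 - 0)"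
    by (intro tendsto_intros q) simp
  then have q2: "(\<lambda>N. r * sqrt (2 / energy N) / (1 - r * sqrt (2 / energy N))) \<longlonglongrightarrow> 0" by simp
  have "(\<lambda>N. exp R * (exp (r\<^sup>2 / 2 / energy N) - 1)) \<longlonglongrightarrow> exp R * (exp 0 - 1)"
    by (intro tendsto_intros z)
  then have q3: "(\<lambda>N. exp R * (exp (r\<^sup>2 / (2 * energy N)) - 1)) \<longlonglongrightarrow> 0" by simp
  show ?thesis
    by (intro eventually_conj order_tendstoD(2)[OF q] order_tendstoD(2)[OF q2] order_tendstoD(2)[OF q3])
       (use assms in auto)
qed

text \<open>
  Both error sources are absorbed into expectations: whenever the leading coefficient exceeds \<open>L\<close> or the
  remainder exceeds \<open>\<eta> / 2\<close>, the trivial bound \<open>1\<close> on the difference is dominated by the corresponding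
  quotient in \<open>point\<close>; otherwise the stability of zero sums applies.
\<close>

lemma expectation_zero_sum_tendsto:
  assumes f: "continuous_on UNIV f" "compact (closure {z. f z \<noteq> 0})"
    and \<psi>: "uniformly_continuous_on UNIV \<psi>" "\<And>y. 0 \<le> \<psi> y" "\<And>y. \<psi> y \<le> (1::real)"
  shows "(\<lambda>N. expectation (\<lambda>\<omega>. \<psi> (rescaled_zeros_sum (\<lambda>k. X k \<omega>) N \<beta>0 (phase N) f))) \<longlonglongrightarrow>
    (\<integral>w. \<psi> (zero_sum (\<lambda>s. exp (- s) + w) f) \<partial>complex_normal)"
proof -
  define G where "G w = zero_sum (\<lambda>s. exp (- s) + w) f" for w
  define Y where "Y N \<omega> = rescaled_zeros_sum (\<lambda>k. X k \<omega>) N \<beta>0 (phase N) f" for N \<omega>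
  define S where "S N = coeff N 0" for N
  have Gc: "continuous_on UNIV G" unfolding G_def by (rule continuous_zero_sum_exp[OF f])
  have \<psi>c: "continuous_on UNIV \<psi>" using \<psi>(1) by (rule uniformly_continuous_imp_continuous)
  have \<psi>G: "continuous_on UNIV (\<lambda>w. \<psi> (G w))"
    by (rule continuous_on_compose2[OF \<psi>c Gc]) auto
  have \<psi>abs: "\<bar>\<psi> y\<bar> \<le> 1" for y using \<psi>(2,3)[of y] by simp
  have Sm: "S N \<in> borel_measurable M" for N unfolding S_def by (rule coeff_measurable)
  have \<psi>Gm: "(\<lambda>w. \<psi> (G w)) \<in> borel_measurable borel" by (rule borel_measurable_continuous_onI[OF \<psi>G])
  have \<beta>0: "\<beta>0 \<noteq> 0" using cmod_\<beta>0 by auto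
  have Ym: "Y N \<in> borel_measurable M" for N
    unfolding Y_def[abs_def] by (rule measurable_rescaled_zeros_sum[OF X_measurable \<beta>0 f])
  have \<psi>Ym: "(\<lambda>\<omega>. \<psi> (Y N \<omega>)) \<in> borel_measurable M" for N
    by (rule measurable_compose[OF Ym borel_measurable_continuous_onI[OF \<psi>c]])
  have \<psi>GSm: "(\<lambda>\<omega>. \<psi> (G (S N \<omega>))) \<in> borel_measurable M" for N
    by (rule measurable_compose[OF Sm \<psi>Gm])
  have iY: "integrable M (\<lambda>\<omega>. \<psi> (Y N \<omega>))" and iS: "integrable M (\<lambda>\<omega>. \<psi> (G (S N \<omega>)))" for N
    by (intro integrable_const_bound[of _ 1] \<psi>Ym \<psi>GSm; simp add: \<psi>abs)+
  have "(\<lambda>N. \<integral>w. \<psi> (G w) \<partial>distr M borel (S N)) \<longlonglongrightarrow> (\<integral>w. \<psi> (G w) \<partial>complex_normal)"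
  proof (rule tendsto_integral_if_char_tendsto[where C=1 and B=1])
    show "prob_space (distr M borel (S N))" for N by (rule prob_space_distr[OF Sm])
    have em: "(\<lambda>w. exp (\<i> * complex_of_real (Re (cnj u * w)))) \<in> borel_measurable borel" for u
      by measurable
    show "(\<lambda>N. \<integral>w. exp (\<i> * complex_of_real (Re (cnj u * w))) \<partial>distr M borel (S N)) \<longlonglongrightarrow>
       (\<integral>w. exp (\<i> * complex_of_real (Re (cnj u * w))) \<partial>complex_normal)" for u
      unfolding complex_normal_char integral_distr[OF Sm em]
      unfolding S_def by (rule char_coeff_0_tendsto)
    have nm: "(\<lambda>w::complex. (cmod w)\<^sup>2) \<in> borel_measurable borel" by measurable
    show "integrable (distr M borel (S N)) (\<lambda>w. (cmod w)\<^sup>2)" for N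
      unfolding integrable_distr_eq[OF Sm nm] unfolding S_def by (rule coeff_0_second_moment)
    show "(\<integral>w. (cmod w)\<^sup>2 \<partial>distr M borel (S N)) \<le> 1" for N
      unfolding integral_distr[OF Sm nm] unfolding S_def by (rule coeff_0_second_moment)
  qed (auto simp: prob_space_complex_normal sets_complex_normal complex_normal_second_moment \<psi>G \<psi>abs)
  then have lim1: "(\<lambda>N. expectation (\<lambda>\<omega>. \<psi> (G (S N \<omega>)))) \<longlonglongrightarrow> (\<integral>w. \<psi> (G w) \<partial>complex_normal)"
    by (simp only: integral_distr[OF Sm \<psi>Gm])
  have lim2: "(\<lambda>N. expectation (\<lambda>\<omega>. \<psi> (Y N \<omega>)) - expectation (\<lambda>\<omega>. \<psi> (G (S N \<omega>)))) \<longlonglongrightarrow> 0"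
  proof (rule tendstoI)
    fix e' :: real assume e': "e' > 0"
    define e where "e = e' / 4"
    have e: "e > 0" using e' by (simp add: e_def)
    obtain d where d: "d > 0" "\<And>y y'. \<bar>y - y'\<bar> < d \<Longrightarrow> \<bar>\<psi> y - \<psi> y'\<bar> < e"
      using \<psi>(1) e unfolding uniformly_continuous_on_def dist_real_def by (metis UNIV_I abs_minus_commute)
    \<comment> \<open>By the second moment bound the leading coefficient exceeds \<open>L\<close> with probability at most \<open>e\<close>.\<close>
    define L where "L = sqrt (1 / e)"
    have L: "L > 0" "1 / L\<^sup>2 = e" using e by (simp_all add: L_def)
    obtain \<rho> where \<rho>: "\<rho> > 0" "\<And>z. z \<notin> cball 0 \<rho> \<Longrightarrow> f z = 0" using bounded_support[OF f(2)] by blast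
    obtain \<eta> where \<eta>: "\<eta> > 0" and stable: "\<And>w h. w \<in> cball 0 L \<Longrightarrow> h holomorphic_on UNIV \<Longrightarrow>
        (\<And>s. s \<in> cball 0 (\<rho> + 1) \<Longrightarrow> cmod (h s - (exp (- s) + w)) \<le> \<eta>) \<Longrightarrow> \<bar>zero_sum h f - G w\<bar> \<le> d / 2"
      using zero_sum_exp_stable[OF f(1) \<rho>, of "d / 2" L] d(1) unfolding G_def by fastforce
    \<comment> \<open>The zeros are sought in the disc of radius \<open>\<rho> + 1\<close>; the phase shifts the argument by at most \<open>2 * pi\<close>.\<close>
    define r where "r = \<rho> + 1 + 2 * pi"
    have r: "r \<ge> 0" using \<rho> by (simp add: r_def)
    define \<eta>' where "\<eta>' = min (\<eta> / 2) (e * (\<eta> / 2))"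
    have \<eta>': "\<eta>' > 0" using \<eta> e by (simp add: \<eta>'_def)
    from eventually_remainder_small[OF \<eta>' r, of "\<rho> + 1"] eventually_ge_at_top[of 2]
    show "\<forall>\<^sub>F N in sequentially. dist (expectation (\<lambda>\<omega>. \<psi> (Y N \<omega>)) - expectation (\<lambda>\<omega>. \<psi> (G (S N \<omega>)))) 0 < e'"
    proof eventually_elim
      case (elim N)
      define q where "q = r * sqrt (2 / energy N)"
      have q: "r * sqrt (2 / energy N) < 1" using elim by simp
      note rem = remainder_expectation[OF elim(2) r q]
      have point: "\<bar>\<psi> (Y N \<omega>) - \<psi> (G (S N \<omega>))\<bar> \<le> e + ((cmod (S N \<omega>))\<^sup>2 / L\<^sup>2 + remainder r N \<omega> / (\<eta> / 2))" for \<omega>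
      proof (cases "cmod (S N \<omega>) \<le> L \<and> remainder r N \<omega> \<le> \<eta> / 2")
        case True
        have "\<bar>zero_sum (local_fun N \<omega>) f - G (S N \<omega>)\<bar> \<le> d / 2"
        proof (rule stable[OF _ local_fun_holomorphic])
          show "S N \<omega> \<in> cball 0 L" using True by simp
          fix s :: complex assume "s \<in> cball 0 (\<rho> + 1)"
          then have "cmod s \<le> \<rho> + 1" by simp
          from local_fun_close[OF elim(2) this r_def q, of \<omega>]
          show "cmod (local_fun N \<omega> s - (exp (- s) + S N \<omega>)) \<le> \<eta>"
            using elim True by (simp add: S_def \<eta>'_def)
        qed
        then have "\<bar>\<psi> (Y N \<omega>) - \<psi> (G (S N \<omega>))\<bar> < e"
          using d unfolding Y_def rescaled_zeros_sum_eq_local[OF elim(2)] by simp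
        moreover have "0 \<le> (cmod (S N \<omega>))\<^sup>2 / L\<^sup>2 + remainder r N \<omega> / (\<eta> / 2)"
          using rem(3)[of \<omega>] \<eta> by (intro add_nonneg_nonneg) auto
        ultimately show ?thesis by linarith
      next
        case False
        have a: "0 \<le> (cmod (S N \<omega>))\<^sup>2 / L\<^sup>2" "0 \<le> remainder r N \<omega> / (\<eta> / 2)"
          using rem(3)[of \<omega>] \<eta> by auto
        have "1 \<le> (cmod (S N \<omega>))\<^sup>2 / L\<^sup>2 + remainder r N \<omega> / (\<eta> / 2)"
        proof (cases "cmod (S N \<omega>) \<le> L")
          case True
          then have "1 \<le> remainder r N \<omega> / (\<eta> / 2)" using False \<eta> by (simp add: field_simps)
          then show ?thesis using a by linarith
        next
          case False
          then have "L\<^sup>2 \<le> (cmod (S N \<omega>))\<^sup>2" using L by (intro power_mono) auto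
          then have "1 \<le> (cmod (S N \<omega>))\<^sup>2 / L\<^sup>2" using L(1) by (simp add: field_simps)
          then show ?thesis using a by linarith
        qed
        moreover have "\<bar>\<psi> (Y N \<omega>) - \<psi> (G (S N \<omega>))\<bar> \<le> 1" using \<psi>(2,3)[of "Y N \<omega>"] \<psi>(2,3)[of "G (S N \<omega>)"] by linarith
        ultimately show ?thesis using e by linarith
      qed
      have S2: "integrable M (\<lambda>\<omega>. (cmod (S N \<omega>))\<^sup>2)" "expectation (\<lambda>\<omega>. (cmod (S N \<omega>))\<^sup>2) \<le> 1"
        unfolding S_def by (rule coeff_0_second_moment)+
      have "\<bar>expectation (\<lambda>\<omega>. \<psi> (Y N \<omega>)) - expectation (\<lambda>\<omega>. \<psi> (G (S N \<omega>)))\<bar> = \<bar>expectation (\<lambda>\<omega>. \<psi> (Y N \<omega>) - \<psi> (G (S N \<omega>)))\<bar>"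
        using iY iS by simp
      also have "\<dots> \<le> expectation (\<lambda>\<omega>. \<bar>\<psi> (Y N \<omega>) - \<psi> (G (S N \<omega>))\<bar>)" by (rule integral_abs_bound)
      also have "\<dots> \<le> expectation (\<lambda>\<omega>. e + ((cmod (S N \<omega>))\<^sup>2 / L\<^sup>2 + remainder r N \<omega> / (\<eta> / 2)))"
        by (intro integral_mono point) (use iY iS S2 rem(1) in auto)
      also have "\<dots> = e + (expectation (\<lambda>\<omega>. (cmod (S N \<omega>))\<^sup>2) / L\<^sup>2 + expectation (remainder r N) / (\<eta> / 2))"
        using S2 rem(1) by (simp add: prob_space)
      also have "\<dots> \<le> e + (1 / L\<^sup>2 + e)"
      proof (intro add_left_mono add_mono)
        show "expectation (\<lambda>\<omega>. (cmod (S N \<omega>))\<^sup>2) / L\<^sup>2 \<le> 1 / L\<^sup>2" using S2 by (intro divide_right_mono) auto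
        have "r * sqrt (2 / energy N) / (1 - r * sqrt (2 / energy N)) < \<eta>'" using elim by blast
        moreover have "\<eta>' \<le> e * (\<eta> / 2)" by (simp add: \<eta>'_def)
        ultimately have "expectation (remainder r N) \<le> e * (\<eta> / 2)" using rem(2) by linarith
        then show "expectation (remainder r N) / (\<eta> / 2) \<le> e" using \<eta> by (simp add: field_simps)
      qed
      also have "\<dots> < e'" using e by (simp add: L(2) e_def)
      finally show ?case by simp
    qed
  qed
  from tendsto_add[OF lim2 lim1] show ?thesis unfolding Y_def G_def by simp
qed

end

text \<open>
  At \<open>w = 0\<close> the two sides need not agree, since there \<open>Ln\<close> takes a conventional value. That point is null
  for the normal law, but measurability must take it into account.
\<close>

lemma shifted_lattice_sum:
  assumes f: "continuous_on UNIV f" "compact (closure {z. f z \<noteq> 0})"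
  defines "T \<equiv> \<lambda>w. \<Sum>\<^sub>\<infinity>k\<in>(UNIV :: int set). f (2 * complex_of_real pi * \<i> * of_int k + - Ln (- w))"
  shows "T \<in> borel_measurable borel" "w \<noteq> 0 \<Longrightarrow> T w = zero_sum (\<lambda>s. exp (- s) + w) f"
proof -
  show eq: "T w = zero_sum (\<lambda>s. exp (- s) + w) f" if "w \<noteq> 0" for w
    unfolding T_def using zero_sum_exp[OF that] by simp
  have "(\<lambda>w. zero_sum (\<lambda>s. exp (- s) + w) f) \<in> borel_measurable borel"
    by (rule borel_measurable_continuous_onI[OF continuous_zero_sum_exp[OF f]])
  then have "(\<lambda>w. if w = 0 then T 0 else zero_sum (\<lambda>s. exp (- s) + w) f) \<in> borel_measurable borel"
    by (intro measurable_If) auto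
  moreover have "(\<lambda>w. if w = 0 then T 0 else zero_sum (\<lambda>s. exp (- s) + w) f) = T"
    using eq by (auto simp: fun_eq_iff)
  ultimately show "T \<in> borel_measurable borel" by simp
qed

text \<open>
  \<open>Ln\<close> is continuous off the nonpositive real axis, and on the negative axis it is \<open>ln (cmod w) + \<i> * pi\<close>.
\<close>

lemma measurable_neg_Ln_neg: "(\<lambda>w. - Ln (- w)) \<in> borel_measurable borel"
proof -
  define h where "h w = (if w \<in> - \<real>\<^sub>\<le>\<^sub>0 then Ln w else 0)" for w :: complex
  have [measurable]: "h \<in> borel_measurable borel"
    unfolding h_def[abs_def]
    by (rule borel_measurable_continuous_on_if)
       (auto intro!: continuous_intros simp: closed_nonpos_Reals_complex borel_closed)
  have [measurable]: "(\<real>\<^sub>\<le>\<^sub>0 :: complex set) \<in> sets borel"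
    by (intro borel_closed closed_nonpos_Reals_complex)
  have "Ln w = (if w = 0 then Ln 0 else if w \<in> \<real>\<^sub>\<le>\<^sub>0 then complex_of_real (ln (cmod w)) + complex_of_real pi * \<i> else h w)" for w
  proof (cases "w \<in> \<real>\<^sub>\<le>\<^sub>0 \<and> w \<noteq> 0")
    case True
    then obtain x where "w = of_real x" "x < 0" by (auto elim!: nonpos_Reals_cases)
    then show ?thesis using True Ln_of_real'[of x] by simp
  qed (auto simp: h_def)
  then have "Ln = (\<lambda>w. if w = 0 then Ln 0 else if w \<in> \<real>\<^sub>\<le>\<^sub>0 then complex_of_real (ln (cmod w)) + complex_of_real pi * \<i> else h w)"
    by (rule ext)
  moreover have "(\<lambda>w. if w = 0 then Ln 0 else if w \<in> \<real>\<^sub>\<le>\<^sub>0 then complex_of_real (ln (cmod w)) + complex_of_real pi * \<i> else h w) \<in> borel_measurable borel"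
    by measurable
  ultimately have [measurable]: "Ln \<in> borel_measurable borel" by simp
  show ?thesis by measurable
qed

theorem theorem2p11:
  fixes M :: "'a measure" and X :: "nat \<Rightarrow> 'a \<Rightarrow> real" and \<sigma>\<^sub>0 \<tau>\<^sub>0 :: real and \<beta>\<^sub>0 :: complex
  assumes "prob_space M"
    and "prob_space.indep_vars M (\<lambda>_. borel) X {1..}"
    and "\<And>k. k \<ge> 1 \<Longrightarrow> distributed M lborel (X k) (\<lambda>x. ennreal (std_normal_density x))"
    and "\<beta>\<^sub>0 = Complex \<sigma>\<^sub>0 \<tau>\<^sub>0"
    and "\<sigma>\<^sub>0\<^sup>2 + \<tau>\<^sub>0\<^sup>2 = 1"
    and "\<sigma>\<^sub>0\<^sup>2 < 1 / 2"
  shows "\<exists>(P :: complex measure) (\<xi> :: complex \<Rightarrow> complex) (\<delta> :: nat \<Rightarrow> real).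
    prob_space P \<and> \<xi> \<in> borel_measurable P \<and> bounded (range \<delta>) \<and>
    (\<forall>f :: complex \<Rightarrow> real. continuous_on UNIV f \<longrightarrow> compact (closure {z. f z \<noteq> 0}) \<longrightarrow>
      weak_conv_m
        (\<lambda>N. distr M borel (\<lambda>\<omega>. rescaled_zeros_sum (\<lambda>k. X k \<omega>) N \<beta>\<^sub>0 (\<delta> N) f))
        (distr P borel (\<lambda>\<omega>. \<Sum>\<^sub>\<infinity>k\<in>(UNIV :: int set).
           f (2 * complex_of_real pi * \<i> * of_int k + \<xi> \<omega>))))"
proof -
  interpret prob_space M by fact
  interpret critical_circle M X \<sigma>\<^sub>0 \<tau>\<^sub>0
    by unfold_locales (use assms in auto)
  have \<beta>0: "\<beta>\<^sub>0 = \<beta>0" by (simp add: assms(4) \<beta>0_def)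
  have \<beta>0nz: "\<beta>0 \<noteq> 0" using cmod_\<beta>0 by auto
  interpret P: prob_space complex_normal by (rule prob_space_complex_normal)
  define \<xi> where "\<xi> w = - Ln (- w)" for w :: complex
  have mP: "h \<in> borel_measurable complex_normal" if "h \<in> borel_measurable borel" for h :: "complex \<Rightarrow> 'b::topological_space"
    using that by (simp cong: measurable_cong_sets add: sets_complex_normal)
  have \<xi>: "\<xi> \<in> borel_measurable complex_normal"
    unfolding \<xi>_def[abs_def] by (rule mP[OF measurable_neg_Ln_neg])
  have \<delta>: "bounded (range phase)"
    unfolding bounded_iff using phase_bounds by (intro exI[of _ "2 * pi"]) auto
  have "weak_conv_m
        (\<lambda>N. distr M borel (\<lambda>\<omega>. rescaled_zeros_sum (\<lambda>k. X k \<omega>) N \<beta>\<^sub>0 (phase N) f))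
        (distr complex_normal borel (\<lambda>\<omega>. \<Sum>\<^sub>\<infinity>k\<in>(UNIV :: int set).
           f (2 * complex_of_real pi * \<i> * of_int k + \<xi> \<omega>)))"
    if f: "continuous_on UNIV f" "compact (closure {z. f z \<noteq> 0})" for f
  proof -
    define Y where "Y N \<omega> = rescaled_zeros_sum (\<lambda>k. X k \<omega>) N \<beta>\<^sub>0 (phase N) f" for N \<omega>
    define T where "T w = (\<Sum>\<^sub>\<infinity>k\<in>(UNIV :: int set). f (2 * complex_of_real pi * \<i> * of_int k + \<xi> w))" for w
    note T = shifted_lattice_sum[OF f, folded \<xi>_def, folded T_def]
    have Ym: "Y N \<in> borel_measurable M" for N
      unfolding Y_def[abs_def] \<beta>0 by (rule measurable_rescaled_zeros_sum[OF X_measurable \<beta>0nz f])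
    have Tm: "T \<in> borel_measurable complex_normal" by (rule mP[OF T(1)])
    have "weak_conv_m (\<lambda>N. distr M borel (Y N)) (distr complex_normal borel T)"
    proof (rule integral_cts_step_conv_imp_weak_conv)
      show "real_distribution (distr M borel (Y N))" for N
        by (rule real_distribution_distr[OF Ym])
      show "real_distribution (distr complex_normal borel T)"
        by (rule P.real_distribution_distr[OF Tm])
      fix x y :: real assume xy: "x < y"
      have uc: "uniformly_continuous_on UNIV (cts_step x y)" by (rule cts_step_uniformly_continuous[OF xy])
      have cm: "cts_step x y \<in> borel_measurable borel"
        by (rule borel_measurable_continuous_onI[OF uniformly_continuous_imp_continuous[OF uc]])
      have zm: "(\<lambda>w. zero_sum (\<lambda>s. exp (- s) + w) f) \<in> borel_measurable complex_normal"
        by (rule mP[OF borel_measurable_continuous_onI[OF continuous_zero_sum_exp[OF f]]])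
      have "(\<lambda>N. expectation (\<lambda>\<omega>. cts_step x y (Y N \<omega>))) \<longlonglongrightarrow>
          (\<integral>w. cts_step x y (zero_sum (\<lambda>s. exp (- s) + w) f) \<partial>complex_normal)"
        unfolding Y_def \<beta>0
        by (rule expectation_zero_sum_tendsto[OF f uc]) (use xy in \<open>auto simp: cts_step_def\<close>)
      also have "(\<integral>w. cts_step x y (zero_sum (\<lambda>s. exp (- s) + w) f) \<partial>complex_normal) = (\<integral>w. cts_step x y (T w) \<partial>complex_normal)"
      \<comment> \<open>The two integrands can differ only at \<open>0\<close>, which is a null point.\<close>
      proof (rule integral_cong_AE)
        show "AE w in complex_normal. cts_step x y (zero_sum (\<lambda>s. exp (- s) + w) f) = cts_step x y (T w)"
          using AE_complex_normal_nonzero by eventually_elim (simp add: T(2))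
      qed (rule measurable_compose[OF zm cm] measurable_compose[OF Tm cm])+
      finally show "(\<lambda>N. integral\<^sup>L (distr M borel (Y N)) (cts_step x y)) \<longlonglongrightarrow> integral\<^sup>L (distr complex_normal borel T) (cts_step x y)"
        by (simp only: integral_distr[OF Ym cm] integral_distr[OF Tm cm])
    qed
    then show ?thesis unfolding Y_def[abs_def] T_def[abs_def] .
  qed
  then show ?thesis
    using prob_space_complex_normal \<xi> \<delta> by blast
qed

end
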